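(* Let $\mathfrak g$ be a unimodular six-dimensional real solvable Lie algebra whose nilradical $\mathfrak h$ has codimension $2$. Then $\mathfrak g$ admits an SKT structure $(J,\langle\cdot,\cdot\rangle)$ if and only if $\mathfrak g$ is isomorphic to one of the following Lie algebras: $$\tau_{3,0}\times\tau_{3,0}=(-f^{25},\,f^{15},\,-f^{46},\,f^{36},\,0,\,0),$$ $$\mathfrak g_{5.35}^{-2,0}\oplus\mathbb R=(2f^{15},\,-f^{25}-f^{36},\,-f^{35}+f^{26},\,0,\,0,\,0).$$ Hence, in particular, $\mathfrak h$ must be abelian. Explicit examples of SKT structures are given respectively by $$Jf_1=f_2,\quad Jf_3=f_4,\quad Jf_5=f_6,\quad \langle\cdot,\cdot\rangle=\sum_{i=1}^6(f^i)^2$$ on $\tau_{3,0}\times\tau_{3,0}$, and $$Jf_1=f_5,\quad Jf_2=f_3,\quad Jf_4=f_6,\quad \langle\cdot,\cdot\rangle=\sum_{i=1}^6(f^i)^2$$ on $\mathfrak g_{5.35}^{-2,0}\oplus\mathbb R$.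
   Context: The nilradical is the maximal nilpotent ideal; unimodular means $\mathrm{tr}(\mathrm{ad}_X)=0$ for all $X$. The notation $(\alpha_1,\dots,\alpha_6)$ denotes the six-dimensional Lie algebra having a basis $\{f_1,\dots,f_6\}$ with dual basis $\{f^1,\dots,f^6\}$ such that $df^i=\alpha_i$, where $f^{ij}=f^i\wedge f^j$ and $d$ is the Chevalley–Eilenberg differential ($d\alpha(X,Y)=-\alpha([X,Y])$ on $1$-forms). A Hermitian structure on $\mathfrak g$ is a pair $(J,\langle\cdot,\cdot\rangle)$ with $J^2=-\mathrm{Id}$, $J$ integrable ($[X,Y]+J([JX,Y]+[X,JY])-[JX,JY]=0$ for all $X,Y$), and $\langle\cdot,\cdot\rangle$ an inner product with $\langle JX,JY\rangle=\langle X,Y\rangle$. Fundamental form $\omega=\langle J\cdot,\cdot\rangle$, Bismut torsion $c(X,Y,Z)=d\omega(JX,JY,JZ)$. The structure is SKT if $dc=0$. $\sum_i(f^i)^2$ is the inner product making $\{f_i\}$ orthonormal. *)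

theory Defs
  imports "HOL-Analysis.Analysis"
begin

section \<open>Real Lie algebras\<close>

text \<open>
  A Lie algebra is a bracket on the whole of a real vector space; \<open>n\<close>-dimensionality is expressed by
  \<open>dim UNIV = n\<close> (for \<open>n > 0\<close> this includes finite-dimensionality, as \<open>dim\<close> is 0 on
  infinite-dimensional spaces).
\<close>

definition lie_algebra :: "('a::real_vector \<Rightarrow> 'a \<Rightarrow> 'a) \<Rightarrow> bool" where
  "lie_algebra br \<longleftrightarrow> bilinear br \<and> (\<forall>x. br x x = 0) \<and>
     (\<forall>x y z. br x (br y z) + br y (br z x) + br z (br x y) = 0)"

definition lie_iso ::
  "('a::real_vector \<Rightarrow> 'a \<Rightarrow> 'a) \<Rightarrow> ('b::real_vector \<Rightarrow> 'b \<Rightarrow> 'b) \<Rightarrow> bool" where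
  "lie_iso br br' \<longleftrightarrow>
     (\<exists>\<phi>. linear \<phi> \<and> bij \<phi> \<and> (\<forall>x y. \<phi> (br x y) = br' (\<phi> x) (\<phi> y)))"

definition commutator_space ::
  "('a::real_vector \<Rightarrow> 'a \<Rightarrow> 'a) \<Rightarrow> 'a set \<Rightarrow> 'a set \<Rightarrow> 'a set" where
  "commutator_space br A B = span {br x y |x y. x \<in> A \<and> y \<in> B}"

primrec derived_series :: "('a::real_vector \<Rightarrow> 'a \<Rightarrow> 'a) \<Rightarrow> 'a set \<Rightarrow> nat \<Rightarrow> 'a set" where
  "derived_series br A 0 = A"
| "derived_series br A (Suc n) =
     commutator_space br (derived_series br A n) (derived_series br A n)"

primrec lower_central_series :: "('a::real_vector \<Rightarrow> 'a \<Rightarrow> 'a) \<Rightarrow> 'a set \<Rightarrow> nat \<Rightarrow> 'a set" where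
  "lower_central_series br A 0 = A"
| "lower_central_series br A (Suc n) = commutator_space br A (lower_central_series br A n)"

definition lie_solvable :: "('a::real_vector \<Rightarrow> 'a \<Rightarrow> 'a) \<Rightarrow> bool" where
  "lie_solvable br \<longleftrightarrow> (\<exists>n. derived_series br UNIV n = {0})"

definition lie_nilpotent_on :: "('a::real_vector \<Rightarrow> 'a \<Rightarrow> 'a) \<Rightarrow> 'a set \<Rightarrow> bool" where
  "lie_nilpotent_on br A \<longleftrightarrow> (\<exists>n. lower_central_series br A n = {0})"

definition lie_abelian_on :: "('a::real_vector \<Rightarrow> 'a \<Rightarrow> 'a) \<Rightarrow> 'a set \<Rightarrow> bool" where
  "lie_abelian_on br A \<longleftrightarrow> (\<forall>x\<in>A. \<forall>y\<in>A. br x y = 0)"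

definition lie_ideal :: "('a::real_vector \<Rightarrow> 'a \<Rightarrow> 'a) \<Rightarrow> 'a set \<Rightarrow> bool" where
  "lie_ideal br I \<longleftrightarrow> subspace I \<and> (\<forall>x. \<forall>y\<in>I. br x y \<in> I)"

text \<open>The nilradical is the greatest nilpotent ideal.\<close>

definition is_nilradical :: "('a::real_vector \<Rightarrow> 'a \<Rightarrow> 'a) \<Rightarrow> 'a set \<Rightarrow> bool" where
  "is_nilradical br h \<longleftrightarrow> lie_ideal br h \<and> lie_nilpotent_on br h \<and>
     (\<forall>I. lie_ideal br I \<and> lie_nilpotent_on br I \<longrightarrow> I \<subseteq> h)"

text \<open>
  The trace of an endomorphism of a finite-dimensional real vector space, computed in the
  library's arbitrarily chosen basis \<open>extend_basis {}\<close>; \<open>linear_trace_eq\<close> shows that every basis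
  gives the same value.
\<close>

definition linear_trace :: "('a::real_vector \<Rightarrow> 'a) \<Rightarrow> real" where
  "linear_trace f = (\<Sum>b\<in>extend_basis {}. representation (extend_basis {}) (f b) b)"

lemma linear_trace_eq:
  fixes f :: "'a::real_vector \<Rightarrow> 'a"
  assumes f: "linear f" and B: "independent B" "span B = UNIV" "finite B"
  shows "linear_trace f = (\<Sum>b\<in>B. representation B (f b) b)"
proof -
  define C :: "'a set" where "C = extend_basis {}"
  have C: "independent C" "span C = UNIV"
    using real_vector.independent_extend_basis[OF real_vector.independent_empty]
      real_vector.span_extend_basis[OF real_vector.independent_empty]
    by (auto simp: C_def)
  have fC: "finite C"
    using independent_span_bound[OF B(3) C(1)] B(2) by auto
  have expand: "representation D (f b) b =
      (\<Sum>c\<in>E. representation E (f b) c * representation D c b)"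
    if D: "independent D" "span D = UNIV" and E: "independent E" "span E = UNIV" "finite E"
    for D E :: "'a set" and b
  proof -
    have "f b = (\<Sum>c\<in>E. representation E (f b) c *\<^sub>R c)"
      using real_vector.sum_representation_eq[of E "f b" E] E
      by simp
    then have "representation D (f b) b =
        representation D (\<Sum>c\<in>E. representation E (f b) c *\<^sub>R c) b" by simp
    also have "\<dots> = (\<Sum>c\<in>E. representation E (f b) c * representation D c b)"
      using D by (simp add: representation_sum representation_scale)
    finally show ?thesis .
  qed
  have coeff: "representation D (f b) b' = (\<Sum>c\<in>E. representation E b c * representation D (f c) b')"
    if D: "independent D" "span D = UNIV" and E: "independent E" "span E = UNIV" "finite E"
    for D E :: "'a set" and b b'
  proof -
    have "b = (\<Sum>c\<in>E. representation E b c *\<^sub>R c)"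
      using real_vector.sum_representation_eq[of E b E] E
      by simp
    then have "f b = (\<Sum>c\<in>E. representation E b c *\<^sub>R f c)"
      by (metis (no_types, lifting) f linear_scale linear_sum sum.cong)
    then have "representation D (f b) b' =
        representation D (\<Sum>c\<in>E. representation E b c *\<^sub>R f c) b'" by simp
    also have "\<dots> = (\<Sum>c\<in>E. representation E b c * representation D (f c) b')"
      using D by (simp add: representation_sum representation_scale)
    finally show ?thesis .
  qed
  have "linear_trace f = (\<Sum>c\<in>C. \<Sum>b\<in>B. representation B c b * representation C (f b) c)"
    unfolding linear_trace_def C_def[symmetric] by (intro sum.cong refl coeff C B)
  also have "\<dots> = (\<Sum>b\<in>B. \<Sum>c\<in>C. representation C (f b) c * representation B c b)"
    by (subst sum.swap) (simp add: mult.commute)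
  also have "\<dots> = (\<Sum>b\<in>B. representation B (f b) b)"
    by (intro sum.cong refl expand[symmetric] B C fC)
  finally show ?thesis .
qed

definition unimodular :: "('a::real_vector \<Rightarrow> 'a \<Rightarrow> 'a) \<Rightarrow> bool" where
  "unimodular br \<longleftrightarrow> (\<forall>x. linear_trace (br x) = 0)"


section \<open>Chevalley--Eilenberg differential and SKT structures\<close>

text \<open>
  The differential on 1-, 2- and 3-forms, with the convention
  \<open>(d\<alpha>)(x\<^sub>0,\<dots>,x\<^sub>k) = \<Sum> i<j. (-1)^(i+j) \<alpha>([x\<^sub>i,x\<^sub>j], x\<^sub>0, \<dots>, x\<^sub>k)\<close>, where \<open>x\<^sub>i\<close> and \<open>x\<^sub>j\<close>
  are omitted from the list \<open>x\<^sub>0, \<dots>, x\<^sub>k\<close>.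
\<close>

definition ce_d1 :: "('a::real_vector \<Rightarrow> 'a \<Rightarrow> 'a) \<Rightarrow> ('a \<Rightarrow> real) \<Rightarrow> 'a \<Rightarrow> 'a \<Rightarrow> real" where
  "ce_d1 br \<alpha> x y = - \<alpha> (br x y)"

definition ce_d2 ::
  "('a::real_vector \<Rightarrow> 'a \<Rightarrow> 'a) \<Rightarrow> ('a \<Rightarrow> 'a \<Rightarrow> real) \<Rightarrow> 'a \<Rightarrow> 'a \<Rightarrow> 'a \<Rightarrow> real" where
  "ce_d2 br \<alpha> x y z = - \<alpha> (br x y) z + \<alpha> (br x z) y - \<alpha> (br y z) x"

definition ce_d3 ::
  "('a::real_vector \<Rightarrow> 'a \<Rightarrow> 'a) \<Rightarrow> ('a \<Rightarrow> 'a \<Rightarrow> 'a \<Rightarrow> real) \<Rightarrow> 'a \<Rightarrow> 'a \<Rightarrow> 'a \<Rightarrow> 'a \<Rightarrow> real" where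
  "ce_d3 br \<alpha> x y z w =
     - \<alpha> (br x y) z w + \<alpha> (br x z) y w - \<alpha> (br x w) y z
     - \<alpha> (br y z) x w + \<alpha> (br y w) x z - \<alpha> (br z w) x y"

definition inner_product :: "('a::real_vector \<Rightarrow> 'a \<Rightarrow> real) \<Rightarrow> bool" where
  "inner_product g \<longleftrightarrow> bilinear g \<and> (\<forall>x y. g x y = g y x) \<and> (\<forall>x. x \<noteq> 0 \<longrightarrow> g x x > 0)"

definition complex_structure :: "('a::real_vector \<Rightarrow> 'a \<Rightarrow> 'a) \<Rightarrow> ('a \<Rightarrow> 'a) \<Rightarrow> bool" where
  "complex_structure br J \<longleftrightarrow> linear J \<and> (\<forall>x. J (J x) = - x) \<and>
     (\<forall>x y. br x y + J (br (J x) y + br x (J y)) - br (J x) (J y) = 0)"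

definition hermitian_structure ::
  "('a::real_vector \<Rightarrow> 'a \<Rightarrow> 'a) \<Rightarrow> ('a \<Rightarrow> 'a) \<Rightarrow> ('a \<Rightarrow> 'a \<Rightarrow> real) \<Rightarrow> bool" where
  "hermitian_structure br J g \<longleftrightarrow>
     complex_structure br J \<and> inner_product g \<and> (\<forall>x y. g (J x) (J y) = g x y)"

definition fundamental_form :: "('a \<Rightarrow> 'a) \<Rightarrow> ('a \<Rightarrow> 'a \<Rightarrow> real) \<Rightarrow> 'a \<Rightarrow> 'a \<Rightarrow> real" where
  "fundamental_form J g x y = g (J x) y"

definition bismut_torsion ::
  "('a::real_vector \<Rightarrow> 'a \<Rightarrow> 'a) \<Rightarrow> ('a \<Rightarrow> 'a) \<Rightarrow> ('a \<Rightarrow> 'a \<Rightarrow> real) \<Rightarrow> 'a \<Rightarrow> 'a \<Rightarrow> 'a \<Rightarrow> real" where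
  "bismut_torsion br J g x y z = ce_d2 br (fundamental_form J g) (J x) (J y) (J z)"

definition skt_structure ::
  "('a::real_vector \<Rightarrow> 'a \<Rightarrow> 'a) \<Rightarrow> ('a \<Rightarrow> 'a) \<Rightarrow> ('a \<Rightarrow> 'a \<Rightarrow> real) \<Rightarrow> bool" where
  "skt_structure br J g \<longleftrightarrow> hermitian_structure br J g \<and>
     (\<forall>x y z w. ce_d3 br (bismut_torsion br J g) x y z w = 0)"


section \<open>Six-dimensional Lie algebras given by structure equations\<close>

text \<open>
  The model space is \<open>real^6\<close>, with \<open>f\<^sub>i\<close> the \<open>i\<close>-th standard basis vector, so that the dual basis
  consists of the coordinate functions. The numeral index type \<open>6\<close> is arithmetic modulo 6, so the
  index 6 is the same as 0, and \<open>1,\<dots>,6\<close> are pairwise distinct.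
\<close>

abbreviation f_vec :: "6 \<Rightarrow> real^6" where
  "f_vec i \<equiv> axis i 1"

definition f_wedge :: "6 \<Rightarrow> 6 \<Rightarrow> real^6 \<Rightarrow> real^6 \<Rightarrow> real" where
  "f_wedge i j x y = x $ i * y $ j - x $ j * y $ i"

text \<open>
  The bracket with structure equations \<open>df\<^sup>i = \<alpha>\<^sub>i\<close>, where \<open>\<alpha>\<close> lists the 2-forms
  \<open>\<alpha>\<^sub>1,\<dots>,\<alpha>\<^sub>6\<close>: since \<open>df\<^sup>i(x,y) = -f\<^sup>i([x,y])\<close>, the \<open>i\<close>-th coordinate of \<open>[x,y]\<close> is
  \<open>-\<alpha>\<^sub>i(x,y)\<close>.
\<close>

definition structure_bracket ::
  "(real^6 \<Rightarrow> real^6 \<Rightarrow> real) list \<Rightarrow> real^6 \<Rightarrow> real^6 \<Rightarrow> real^6" where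
  "structure_bracket \<alpha> x y = - vector (map (\<lambda>a. a x y) \<alpha>)"

text \<open>\<open>\<tau>\<^sub>3\<^sub>,\<^sub>0 \<times> \<tau>\<^sub>3\<^sub>,\<^sub>0 = (-f\<^sup>2\<^sup>5, f\<^sup>1\<^sup>5, -f\<^sup>4\<^sup>6, f\<^sup>3\<^sup>6, 0, 0)\<close>\<close>

definition tau30_tau30 :: "real^6 \<Rightarrow> real^6 \<Rightarrow> real^6" where
  "tau30_tau30 = structure_bracket
     [\<lambda>x y. - f_wedge 2 5 x y,
      \<lambda>x y. f_wedge 1 5 x y,
      \<lambda>x y. - f_wedge 4 6 x y,
      \<lambda>x y. f_wedge 3 6 x y,
      \<lambda>x y. 0,
      \<lambda>x y. 0]"

text \<open>
  \<open>\<gg>\<^sub>5\<^sub>.\<^sub>3\<^sub>5 \<oplus> \<real> = (2f\<^sup>1\<^sup>5, -f\<^sup>2\<^sup>5-f\<^sup>3\<^sup>6, -f\<^sup>3\<^sup>5+f\<^sup>2\<^sup>6, 0, 0, 0)\<close>, with parameters \<open>-2, 0\<close>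
\<close>

definition g535_R :: "real^6 \<Rightarrow> real^6 \<Rightarrow> real^6" where
  "g535_R = structure_bracket
     [\<lambda>x y. 2 * f_wedge 1 5 x y,
      \<lambda>x y. - f_wedge 2 5 x y - f_wedge 3 6 x y,
      \<lambda>x y. - f_wedge 3 5 x y + f_wedge 2 6 x y,
      \<lambda>x y. 0,
      \<lambda>x y. 0,
      \<lambda>x y. 0]"

lemma exhaust_6: "i = 1 \<or> i = 2 \<or> i = 3 \<or> i = 4 \<or> i = 5 \<or> i = 6" for i :: 6
proof (induct i)
  case (of_int z)
  then have "z = 0 \<or> z = 1 \<or> z = 2 \<or> z = 3 \<or> z = 4 \<or> z = 5" by simp arith
  then show ?case by auto
qed

lemma forall_6: "(\<forall>i::6. P i) \<longleftrightarrow> P 1 \<and> P 2 \<and> P 3 \<and> P 4 \<and> P 5 \<and> P 6"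
  by (metis exhaust_6)

lemma vector_6:
  "(vector [a,b,c,d,e,f] :: 'a::zero^6) $ 1 = a"
  "(vector [a,b,c,d,e,f] :: 'a::zero^6) $ 2 = b"
  "(vector [a,b,c,d,e,f] :: 'a::zero^6) $ 3 = c"
  "(vector [a,b,c,d,e,f] :: 'a::zero^6) $ 4 = d"
  "(vector [a,b,c,d,e,f] :: 'a::zero^6) $ 5 = e"
  "(vector [a,b,c,d,e,f] :: 'a::zero^6) $ 6 = f"
  unfolding vector_def by simp_all

lemma structure_equations:
  fixes a1 a2 a3 a4 a5 a6 :: "real^6 \<Rightarrow> real^6 \<Rightarrow> real"
  defines "br \<equiv> structure_bracket [a1, a2, a3, a4, a5, a6]"
  shows "ce_d1 br (\<lambda>x. x $ 1) = a1" "ce_d1 br (\<lambda>x. x $ 2) = a2" "ce_d1 br (\<lambda>x. x $ 3) = a3"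
    "ce_d1 br (\<lambda>x. x $ 4) = a4" "ce_d1 br (\<lambda>x. x $ 5) = a5" "ce_d1 br (\<lambda>x. x $ 6) = a6"
  by (simp_all add: fun_eq_iff ce_d1_def br_def structure_bracket_def vector_6)

lemma lie_algebra_tau30_tau30: "lie_algebra tau30_tau30"
  unfolding lie_algebra_def bilinear_def tau30_tau30_def
  by (auto intro!: linearI simp: vec_eq_iff forall_6 structure_bracket_def vector_6 f_wedge_def
      algebra_simps)

lemma lie_algebra_g535_R: "lie_algebra g535_R"
  unfolding lie_algebra_def bilinear_def g535_R_def
  by (auto intro!: linearI simp: vec_eq_iff forall_6 structure_bracket_def vector_6 f_wedge_def
      algebra_simps)

end

theory Submission
  imports Defs
begin

text \<open>
  Let \<open>\<gg>\<close> be the given Lie algebra and \<open>h\<close> its nilradical. Three facts about \<open>h\<close> are used throughout: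
  it contains \<open>[\<gg>,\<gg>]\<close> (\<open>br_in_h\<close>), every \<open>ad x\<close> is traceless on it (\<open>trace_ad_h\<close>), and \<open>ad x\<close> is nilpotent
  on it only if \<open>x \<in> h\<close> (\<open>ad_nilpotent4_in_h\<close>). So the action of \<open>\<gg>\<close> on \<open>h\<close> amounts to two traceless
  operators that commute modulo \<open>ad h\<close> and have no nonzero nilpotent combination.

  The nilradical is abelian. A four-dimensional nilpotent Lie algebra is abelian, filiform, or the product of
  the Heisenberg algebra and a line. In the filiform case the weights of \<open>\<gg>\<close> on \<open>h\<close> are governed by two
  linear functionals, which unimodularity makes proportional, so that some \<open>x \<notin> h\<close> acts nilpotently
  (\<open>nilradical_not_filiform\<close>). In the Heisenberg case commuting traceless \<open>2\<times>2\<close> matrices are proportional,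
  and this forces \<open>\<gg>\<close> to act nontrivially on the line \<open>[h,h]\<close> (\<open>heisenberg_center_weight\<close>). That
  is incompatible with a complex structure preserving the centre of \<open>h\<close>. What remains is that
  \<open>h \<inter> Jh\<close> is a \<open>J\<close>-line, and its possible positions with respect to the centre are excluded one by one, by
  integrability or by evaluating the closedness of the torsion on this line (\<open>nilradical_not_heisenberg\<close>).

  Abelian nilradicals with \<open>Jh \<noteq> h\<close>. Then \<open>K = h \<inter> Jh\<close> is a \<open>J\<close>-line, and \<open>x \<cdot> y = [Jx,y]\<close> makes
  \<open>h/K\<close> a commutative associative plane algebra acting on \<open>K\<close> by complex numbers. Closedness of the torsion
  says that \<open>-2\<close> times the real part of this action is multiplicative, and unimodularity says that it is the trace
  of multiplication. The only plane algebra whose trace is multiplicative and that has no nilpotent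
  obstruction is the sum of \<open>\<real>\<close> and a null line, and this is \<open>\<gg>\<^sub>5\<^sub>.\<^sub>3\<^sub>5 \<oplus> \<real>\<close>
  (\<open>lie_iso_g535_R\<close>).

  Abelian nilradicals with \<open>Jh = h\<close>. Take \<open>e \<notin> h\<close> and let \<open>A\<close>, \<open>B\<close> be \<open>ad e\<close>, \<open>ad (Je)\<close> on \<open>h\<close>. The trace over
  \<open>h\<close> of the closedness of the torsion is minus a sum of squares, which makes \<open>AJ\<close> and \<open>BJ\<close> symmetric. Together with
  integrability and \<open>AB = BA\<close> this puts \<open>A\<close> and \<open>B\<close> into the unitary Lie algebra \<open>\<uu>(2)\<close>. Two independent
  commuting elements of \<open>\<uu>(2)\<close> span the diagonal matrices in a suitable basis, which is
  \<open>\<tau>\<^sub>3\<^sub>,\<^sub>0 \<times> \<tau>\<^sub>3\<^sub>,\<^sub>0\<close> (\<open>lie_iso_tau30_tau30\<close>).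

  Conversely, SKT structures are carried along isomorphisms (\<open>skt_structure_pullback\<close>), and the two models have the stated
  ones: on \<open>\<tau>\<^sub>3\<^sub>,\<^sub>0 \<times> \<tau>\<^sub>3\<^sub>,\<^sub>0\<close> the torsion vanishes, on \<open>\<gg>\<^sub>5\<^sub>.\<^sub>3\<^sub>5 \<oplus> \<real>\<close> it is \<open>2f\<^sup>1\<^sup>2\<^sup>3\<close>.
\<close>

section \<open>Coordinates in a four-dimensional subspace of a six-dimensional space\<close>

text \<open>
  Splits numeral multiples, so that linear combinations whose coefficients were collected differently
  acquire the same normal form.
\<close>

lemma scaleR_mult_numeral:
  fixes v :: "'a::real_vector"
  shows "(a * 2) *\<^sub>R v = a *\<^sub>R v + a *\<^sub>R v" "(a * 3) *\<^sub>R v = a *\<^sub>R v + (a *\<^sub>R v + a *\<^sub>R v)"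
    "(a * (b * 2)) *\<^sub>R v = (a * b) *\<^sub>R v + (a * b) *\<^sub>R v"
    "(a * (b * 3)) *\<^sub>R v = (a * b) *\<^sub>R v + ((a * b) *\<^sub>R v + (a * b) *\<^sub>R v)"
  by (simp_all flip: scaleR_add_left)

lemma subspace_coeff_zero:
  fixes a :: "'a::real_vector"
  assumes "subspace S" "a \<notin> S" "\<alpha> *\<^sub>R a + y \<in> S" "y \<in> S"
  shows "\<alpha> = 0"
proof (rule ccontr)
  assume "\<alpha> \<noteq> 0"
  have "\<alpha> *\<^sub>R a \<in> S" using subspace_diff[OF assms(1,3,4)] by simp
  then have "(1/\<alpha>) *\<^sub>R (\<alpha> *\<^sub>R a) \<in> S" by (rule subspace_scale[OF assms(1)])
  with \<open>\<alpha> \<noteq> 0\<close> assms(2) show False by simp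
qed

lemma in_span2:
  "x \<in> span {a, b :: 'a::real_vector} \<longleftrightarrow> (\<exists>\<alpha> \<beta>. x = \<alpha> *\<^sub>R a + \<beta> *\<^sub>R b)"
proof -
  have "x \<in> span {a, b} \<longleftrightarrow> (\<exists>\<alpha> \<beta>. x - \<alpha> *\<^sub>R a - \<beta> *\<^sub>R b = 0)"
    by (simp only: span_breakdown_eq span_empty singleton_iff)
  also have "\<dots> \<longleftrightarrow> (\<exists>\<alpha> \<beta>. x = \<alpha> *\<^sub>R a + \<beta> *\<^sub>R b)" by (simp add: algebra_simps)
  finally show ?thesis .
qed

lemma in_span3:
  "x \<in> span {a, b, c :: 'a::real_vector} \<longleftrightarrow> (\<exists>\<alpha> \<beta> \<gamma>. x = \<alpha> *\<^sub>R a + \<beta> *\<^sub>R b + \<gamma> *\<^sub>R c)"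
proof -
  have "x \<in> span {a, b, c} \<longleftrightarrow> (\<exists>\<alpha> \<beta> \<gamma>. x - \<alpha> *\<^sub>R a - \<beta> *\<^sub>R b - \<gamma> *\<^sub>R c = 0)"
    by (simp only: span_breakdown_eq span_empty singleton_iff)
  also have "\<dots> \<longleftrightarrow> (\<exists>\<alpha> \<beta> \<gamma>. x = \<alpha> *\<^sub>R a + \<beta> *\<^sub>R b + \<gamma> *\<^sub>R c)" by (simp add: algebra_simps)
  finally show ?thesis .
qed

lemma in_span4:
  "x \<in> span {a, b, c, d :: 'a::real_vector} \<longleftrightarrow>
    (\<exists>\<alpha> \<beta> \<gamma> \<delta>. x = \<alpha> *\<^sub>R a + \<beta> *\<^sub>R b + \<gamma> *\<^sub>R c + \<delta> *\<^sub>R d)"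
proof -
  have "x \<in> span {a, b, c, d} \<longleftrightarrow>
      (\<exists>\<alpha> \<beta> \<gamma> \<delta>. x - \<alpha> *\<^sub>R a - \<beta> *\<^sub>R b - \<gamma> *\<^sub>R c - \<delta> *\<^sub>R d = 0)"
    by (simp only: span_breakdown_eq span_empty singleton_iff)
  also have "\<dots> \<longleftrightarrow> (\<exists>\<alpha> \<beta> \<gamma> \<delta>. x = \<alpha> *\<^sub>R a + \<beta> *\<^sub>R b + \<gamma> *\<^sub>R c + \<delta> *\<^sub>R d)"
    by (simp add: algebra_simps)
  finally show ?thesis .
qed

lemma independent_card_eq_dim_spans:
  fixes S :: "'a::real_vector set"
  assumes S: "subspace S" "dim S = n" "n > 0"
    and B: "independent B" "B \<subseteq> S" "finite B" "card B = n"
  shows "span B = S"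
proof (rule ccontr)
  assume ne: "span B \<noteq> S"
  have sub: "span B \<subseteq> S" using B(2) S(1) by (rule span_minimal)
  with ne obtain y where y: "y \<in> S" "y \<notin> span B" by auto
  obtain C where C: "C \<subseteq> S" "independent C" "S \<subseteq> span C" "card C = n"
    using basis_exists[of S] S(2) by metis
  have fC: "finite C" using C(4) S(3) by (metis card.infinite less_irrefl)
  have "independent (insert y B)" using y(2) B(1) by (rule independent_insertI)
  moreover have "insert y B \<subseteq> span C" using y(1) B(2) C(3) by auto
  ultimately have "card (insert y B) \<le> card C" using independent_span_bound[OF fC] by auto
  moreover have "y \<notin> B" using y(2) span_base by blast
  ultimately show False using B(3,4) C(4) by simp
qed

text \<open>
  An ordered basis. The cardinality clause makes the four vectors distinct, which the set alone does not express.
\<close>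

definition frame4 :: "'a::real_vector set \<Rightarrow> 'a \<Rightarrow> 'a \<Rightarrow> 'a \<Rightarrow> 'a \<Rightarrow> bool" where
  "frame4 S a b c d \<longleftrightarrow> independent {a, b, c, d} \<and> card {a, b, c, d} = 4 \<and> span {a, b, c, d} = S"

lemma frame4I:
  fixes a b c d :: "'a::real_vector"
  assumes S: "subspace S" "dim S = 4" and mem: "a \<in> S" "b \<in> S" "c \<in> S" "d \<in> S"
    and out: "d \<noteq> 0" "c \<notin> span {d}" "b \<notin> span {c, d}" "a \<notin> span {b, c, d}"
  shows "frame4 S a b c d"
proof -
  have i1: "independent {d}" using out(1) by simp
  have i2: "independent {c, d}" using out(2) i1 by (rule independent_insertI)
  have i3: "independent {b, c, d}" using out(3) i2 by (rule independent_insertI)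
  have i4: "independent {a, b, c, d}" using out(4) i3 by (rule independent_insertI)
  have ne: "c \<noteq> d" "b \<noteq> c" "b \<noteq> d" "a \<noteq> b" "a \<noteq> c" "a \<noteq> d"
    using out by (auto intro: span_base)
  have card: "card {a, b, c, d} = 4" using ne by simp
  have "span {a, b, c, d} = S"
    by (rule independent_card_eq_dim_spans[OF S]) (use mem i4 card in auto)
  with i4 card show ?thesis by (simp add: frame4_def)
qed

lemma frame4I_coeffs:
  fixes a b c d :: "'a::real_vector"
  assumes S: "subspace S" "dim S = 4" and mem: "a \<in> S" "b \<in> S" "c \<in> S" "d \<in> S"
    and ind: "\<And>\<alpha> \<beta> \<gamma> \<delta>. \<alpha> *\<^sub>R a + \<beta> *\<^sub>R b + \<gamma> *\<^sub>R c + \<delta> *\<^sub>R d = 0 \<Longrightarrow>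
      \<alpha> = 0 \<and> \<beta> = 0 \<and> \<gamma> = 0 \<and> \<delta> = 0"
  shows "frame4 S a b c d"
proof (rule frame4I[OF S mem])
  show "d \<noteq> 0" using ind[of 0 0 0 1] by auto
  show "c \<notin> span {d}"
  proof
    assume "c \<in> span {d}"
    then obtain k where "c = k *\<^sub>R d" by (auto simp: span_singleton)
    then show False using ind[of 0 0 1 "- k"] by simp
  qed
  show "b \<notin> span {c, d}"
  proof
    assume "b \<in> span {c, d}"
    then obtain k l where "b = k *\<^sub>R c + l *\<^sub>R d" by (auto simp: in_span2)
    then show False using ind[of 0 1 "- k" "- l"] by simp
  qed
  show "a \<notin> span {b, c, d}"
  proof
    assume "a \<in> span {b, c, d}"
    then obtain j k l where "a = j *\<^sub>R b + k *\<^sub>R c + l *\<^sub>R d" by (auto simp: in_span3)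
    then show False using ind[of 1 "- j" "- k" "- l"] by simp
  qed
qed

lemma frame4_notin_span:
  assumes "frame4 S a b c d"
  shows "d \<noteq> 0" "c \<notin> span {d}" "b \<notin> span {c, d}" "a \<notin> span {b, c, d}"
proof -
  have ind: "independent {a, b, c, d}" and card: "card {a, b, c, d} = 4"
    using assms by (auto simp: frame4_def)
  have ne: "a \<notin> {b, c, d}" "b \<notin> {c, d}" "c \<noteq> d"
    using card by (auto simp: card_insert_if split: if_splits)
  show "a \<notin> span {b, c, d}" using ind ne(1) independent_insert[of a "{b, c, d}"] by presburger
  have i3: "independent {b, c, d}" using ind ne(1) independent_insert[of a "{b, c, d}"] by presburger
  show "b \<notin> span {c, d}" using i3 ne(2) independent_insert[of b "{c, d}"] by presburger
  have i2: "independent {c, d}" using i3 ne(2) independent_insert[of b "{c, d}"] by presburger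
  show "c \<notin> span {d}" using i2 ne(3) independent_insert[of c "{d}"] by auto
  show "d \<noteq> 0" using i2 by (metis dependent_zero insertI1 insert_commute)
qed

lemma frame4_coeffs:
  assumes F: "frame4 S a b c d"
    and eq: "\<alpha> *\<^sub>R a + \<beta> *\<^sub>R b + \<gamma> *\<^sub>R c + \<delta> *\<^sub>R d = 0"
  shows "\<alpha> = 0 \<and> \<beta> = 0 \<and> \<gamma> = 0 \<and> \<delta> = 0"
proof -
  note n = frame4_notin_span[OF F]
  have mem: "u *\<^sub>R b + v *\<^sub>R c + w *\<^sub>R d \<in> span {b, c, d}" "v *\<^sub>R c + w *\<^sub>R d \<in> span {c, d}"
    "w *\<^sub>R d \<in> span {d}" for u v w
    by (auto intro!: span_add span_scale intro: span_base)
  have "\<alpha> = 0"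
    by (rule subspace_coeff_zero[OF subspace_span n(4) _ mem(1)[of \<beta> \<gamma> \<delta>]])
      (use eq in \<open>simp add: add.assoc span_zero\<close>)
  moreover from this have "\<beta> = 0"
    by (intro subspace_coeff_zero[OF subspace_span n(3) _ mem(2)[of \<gamma> \<delta>]])
      (use eq in \<open>simp add: add.assoc span_zero\<close>)
  moreover from calculation have "\<gamma> = 0"
    by (intro subspace_coeff_zero[OF subspace_span n(2) _ mem(3)[of \<delta>]])
      (use eq in \<open>simp add: span_zero\<close>)
  ultimately show ?thesis using eq n(1) by simp
qed

lemma frame4_expand:
  assumes "frame4 S a b c d" "x \<in> S"
  obtains \<alpha> \<beta> \<gamma> \<delta> where "x = \<alpha> *\<^sub>R a + \<beta> *\<^sub>R b + \<gamma> *\<^sub>R c + \<delta> *\<^sub>R d"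
  using assms in_span4[of x a b c d] by (auto simp: frame4_def)

lemma frame4_mem:
  assumes "frame4 S a b c d"
  shows "a \<in> S" "b \<in> S" "c \<in> S" "d \<in> S" "subspace S"
  using assms span_base[of _ "{a, b, c, d}"] by (auto simp: frame4_def)

lemma frame4_coeffs_eq:
  assumes F: "frame4 S a b c d"
    and eq: "\<alpha> *\<^sub>R a + \<beta> *\<^sub>R b + \<gamma> *\<^sub>R c + \<delta> *\<^sub>R d =
      \<alpha>' *\<^sub>R a + \<beta>' *\<^sub>R b + \<gamma>' *\<^sub>R c + \<delta>' *\<^sub>R d"
  shows "\<alpha> = \<alpha>' \<and> \<beta> = \<beta>' \<and> \<gamma> = \<gamma>' \<and> \<delta> = \<delta>'"
proof -
  have "(\<alpha> - \<alpha>') *\<^sub>R a + (\<beta> - \<beta>') *\<^sub>R b + (\<gamma> - \<gamma>') *\<^sub>R c + (\<delta> - \<delta>') *\<^sub>R d = 0"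
    using eq by (simp add: algebra_simps)
  from frame4_coeffs[OF F this] show ?thesis by simp
qed

text \<open>
  Independence modulo \<open>h\<close>; when \<open>h\<close> has codimension two, \<open>x\<close> and \<open>y\<close> represent a basis of the quotient.
\<close>

definition transversal :: "'a::real_vector set \<Rightarrow> 'a \<Rightarrow> 'a \<Rightarrow> bool" where
  "transversal h x y \<longleftrightarrow> (\<forall>\<alpha> \<beta>. \<alpha> *\<^sub>R x + \<beta> *\<^sub>R y \<in> h \<longrightarrow> \<alpha> = 0 \<and> \<beta> = 0)"

lemma transversal_notin: "subspace h \<Longrightarrow> transversal h x y \<Longrightarrow> x \<notin> h \<and> y \<notin> h"
  unfolding transversal_def
  by (metis add.left_neutral add.right_neutral scaleR_one scaleR_zero_left zero_neq_one)

lemma frame4_exists: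
  assumes "subspace h" "dim h = 4"
  obtains a b c d where "frame4 h a b c d"
proof -
  obtain B where B: "B \<subseteq> h" "independent B" "h \<subseteq> span B" "card B = 4"
    using basis_exists[of h] assms(2) by metis
  have "span B = h" using B(1,3) assms(1) span_minimal by blast
  moreover obtain a b c d where "B = {a, b, c, d}"
    using B(4) by (auto simp: eval_nat_numeral card_Suc_eq)
  ultimately show ?thesis using that B by (auto simp: frame4_def)
qed

lemma transversal_basis6:
  fixes h :: "'a::real_vector set"
  assumes F: "frame4 h a b c d" and T: "transversal h x y" and dimU: "dim (UNIV :: 'a set) = 6"
  shows "independent {x, y, a, b, c, d}" "card {x, y, a, b, c, d} = 6"
    "span {x, y, a, b, c, d} = UNIV"
proof -
  have h: "subspace h" using frame4_mem[OF F] by simp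
  have sp: "span {a, b, c, d} = h" and ind: "independent {a, b, c, d}"
    and card4: "card {a, b, c, d} = 4" using F by (auto simp: frame4_def)
  have y: "y \<notin> span {a, b, c, d}" using transversal_notin[OF h T] sp by simp
  have i5: "independent {y, a, b, c, d}" using y ind by (rule independent_insertI)
  have x: "x \<notin> span {y, a, b, c, d}"
  proof
    assume "x \<in> span {y, a, b, c, d}"
    then obtain k where "x - k *\<^sub>R y \<in> h" using span_breakdown_eq[of x y] sp by auto
    then have "1 *\<^sub>R x + (- k) *\<^sub>R y \<in> h" by simp
    with T show False unfolding transversal_def by (metis zero_neq_one)
  qed
  show i6: "independent {x, y, a, b, c, d}" using x i5 by (rule independent_insertI)
  have "y \<notin> {a, b, c, d}" "x \<notin> {y, a, b, c, d}" using x y span_base by metis+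
  then show c6: "card {x, y, a, b, c, d} = 6"
    using card4 card_insert_disjoint[of "{y, a, b, c, d}" x] card_insert_disjoint[of "{a, b, c, d}" y]
    by simp
  show "span {x, y, a, b, c, d} = UNIV"
    by (rule independent_card_eq_dim_spans[OF subspace_UNIV dimU]) (use i6 c6 in auto)
qed

lemma transversal_expand:
  fixes h :: "'a::real_vector set"
  assumes h: "subspace h" "dim h = 4" and dimU: "dim (UNIV :: 'a set) = 6" and T: "transversal h x y"
  obtains \<alpha> \<beta> t where "t \<in> h" "v = \<alpha> *\<^sub>R x + \<beta> *\<^sub>R y + t"
proof -
  obtain a b c d where F: "frame4 h a b c d" using frame4_exists[OF h] .
  have "v \<in> span {x, y, a, b, c, d}" using transversal_basis6[OF F T dimU] by simp
  then obtain \<alpha> \<beta> where "v - \<alpha> *\<^sub>R x - \<beta> *\<^sub>R y \<in> span {a, b, c, d}"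
    by (auto simp only: span_breakdown_eq[of _ x] span_breakdown_eq[of _ y])
  then show ?thesis
    using that[of "v - \<alpha> *\<^sub>R x - \<beta> *\<^sub>R y" \<alpha> \<beta>] F by (simp add: frame4_def)
qed

lemma transversal_exists:
  fixes h :: "'a::real_vector set"
  assumes h: "subspace h" "dim h = 4" and dimU: "dim (UNIV :: 'a set) = 6"
  obtains x y where "transversal h x y"
proof -
  obtain a b c d where F: "frame4 h a b c d" using frame4_exists[OF h] .
  have ind: "independent {a, b, c, d}" and sp: "span {a, b, c, d} = h"
    and card4: "card {a, b, c, d} = 4" using F by (auto simp: frame4_def)
  obtain B :: "'a set" where "independent B" "UNIV \<subseteq> span B" "card B = dim (UNIV :: 'a set)"
    by (rule basis_exists[of "UNIV :: 'a set"]) blast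
  then have B: "independent B" "span B = UNIV" "card B = 6" using dimU by auto
  have "h \<noteq> UNIV" using h(2) dimU by auto
  then obtain y where y: "y \<notin> h" by auto
  have c5: "card {y, a, b, c, d} \<le> 5" using card_insert_le_m1[of 5 "{a,b,c,d}" y] card4 by simp
  have "span {y, a, b, c, d} \<noteq> UNIV"
  proof
    assume "span {y, a, b, c, d} = UNIV"
    then have "card B \<le> card {y, a, b, c, d}"
      using independent_span_bound[of "{y, a, b, c, d}" B] B by auto
    with c5 B(3) show False by simp
  qed
  then obtain x where x: "x \<notin> span {y, a, b, c, d}" by auto
  have "transversal h x y"
    unfolding transversal_def
  proof (intro allI impI)
    fix \<alpha> \<beta> assume *: "\<alpha> *\<^sub>R x + \<beta> *\<^sub>R y \<in> h"
    have sub: "h \<subseteq> span {y, a, b, c, d}" unfolding sp[symmetric] by (rule span_mono) auto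
    have "\<alpha> = 0"
      by (rule subspace_coeff_zero[OF subspace_span x, of _ "\<beta> *\<^sub>R y"])
        (use * sub in \<open>auto intro: span_scale span_base\<close>)
    with * have "\<beta> *\<^sub>R y + 0 \<in> h" by simp
    from subspace_coeff_zero[OF h(1) y this] h(1) have "\<beta> = 0" by (simp add: subspace_0)
    with \<open>\<alpha> = 0\<close> show "\<alpha> = 0 \<and> \<beta> = 0" by simp
  qed
  then show ?thesis by (rule that)
qed

lemma transversal_combination:
  assumes h: "subspace h" and T: "transversal h x y" and "(\<alpha>, \<beta>) \<noteq> (0, 0)"
  shows "\<alpha> *\<^sub>R x + \<beta> *\<^sub>R y \<notin> h"
  using assms unfolding transversal_def by auto

text \<open>
  The vectors \<open>x\<close> and \<open>y\<close> contribute nothing to the trace because the image of \<open>f\<close> lies in \<open>h\<close>.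
\<close>

lemma linear_trace_frame:
  fixes h :: "'a::real_vector set"
  assumes F: "frame4 h a b c d" and T: "transversal h x y" and dimU: "dim (UNIV :: 'a set) = 6"
    and f: "linear f" "\<And>v. f v \<in> h"
    and fa: "f a = a1 *\<^sub>R a + a2 *\<^sub>R b + a3 *\<^sub>R c + a4 *\<^sub>R d"
    and fb: "f b = b1 *\<^sub>R a + b2 *\<^sub>R b + b3 *\<^sub>R c + b4 *\<^sub>R d"
    and fc: "f c = c1 *\<^sub>R a + c2 *\<^sub>R b + c3 *\<^sub>R c + c4 *\<^sub>R d"
    and fd: "f d = d1 *\<^sub>R a + d2 *\<^sub>R b + d3 *\<^sub>R c + d4 *\<^sub>R d"
  shows "linear_trace f = a1 + b2 + c3 + d4"
proof -
  let ?B = "{x, y, a, b, c, d}"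
  note B = transversal_basis6[OF F T dimU]
  let ?r = "representation ?B"
  have rep: "?r (\<alpha> *\<^sub>R a + \<beta> *\<^sub>R b + \<gamma> *\<^sub>R c + \<delta> *\<^sub>R d) v =
      (if v = a then \<alpha> else 0) + (if v = b then \<beta> else 0) + (if v = c then \<gamma> else 0) + (if v = d then \<delta> else 0)"
    for \<alpha> \<beta> \<gamma> \<delta> v
  proof -
    have "?r a v = (if v = a then 1 else 0)" "?r b v = (if v = b then 1 else 0)"
      "?r c v = (if v = c then 1 else 0)" "?r d v = (if v = d then 1 else 0)"
      using representation_basis[OF B(1), of a] representation_basis[OF B(1), of b]
        representation_basis[OF B(1), of c] representation_basis[OF B(1), of d]
      by (auto simp: fun_eq_iff)
    then show ?thesis
      using B(1,3) by (simp add: representation_add representation_scale span_add span_scale)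
  qed
  have ne: "x \<noteq> y" "x \<noteq> a" "x \<noteq> b" "x \<noteq> c" "x \<noteq> d" "y \<noteq> a" "y \<noteq> b" "y \<noteq> c" "y \<noteq> d"
    "a \<noteq> b" "a \<noteq> c" "a \<noteq> d" "b \<noteq> c" "b \<noteq> d" "c \<noteq> d"
    using B(2) by (auto simp: card_insert_if split: if_splits)
  have zx: "?r (f v) x = 0" "?r (f v) y = 0" for v
  proof -
    obtain \<alpha> \<beta> \<gamma> \<delta> where "f v = \<alpha> *\<^sub>R a + \<beta> *\<^sub>R b + \<gamma> *\<^sub>R c + \<delta> *\<^sub>R d"
      using frame4_expand[OF F f(2)] by metis
    then show "?r (f v) x = 0" "?r (f v) y = 0" using ne by (simp_all add: rep)
  qed
  have "linear_trace f = (\<Sum>v\<in>?B. ?r (f v) v)"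
    by (rule linear_trace_eq[OF f(1) B(1,3)]) simp
  also have "\<dots> = ?r (f x) x + ?r (f y) y + ?r (f a) a + ?r (f b) b + ?r (f c) c + ?r (f d) d"
    using ne by simp
  also have "\<dots> = a1 + b2 + c3 + d4"
    using ne by (simp add: zx) (simp add: fa fb fc fd rep)
  finally show ?thesis .
qed

text \<open>
  Vanishing minors mean proportional triples. This is how commutativity is exploited: two traceless
  \<open>2\<times>2\<close> matrices, or two elements of \<open>\<ss>\<uu>(2)\<close>, commute exactly when the minors of their coordinates vanish.
\<close>

lemma parallel_coefficients:
  fixes a b c a' b' c' :: real
  assumes "a * b' = a' * b" "a * c' = a' * c" "b * c' = b' * c"
  obtains \<xi> \<eta> where "(\<xi>, \<eta>) \<noteq> (0, 0)"
    "\<xi> * a + \<eta> * a' = 0" "\<xi> * b + \<eta> * b' = 0" "\<xi> * c + \<eta> * c' = 0"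
proof -
  consider "a = 0" "b = 0" "c = 0" | "a \<noteq> 0" | "b \<noteq> 0" | "c \<noteq> 0" by blast
  then show ?thesis
  proof cases
    case 1 then show ?thesis using that[of 1 0] by simp
  next
    case 2 then show ?thesis using that[of "a'" "- a"] assms by (simp add: algebra_simps)
  next
    case 3 then show ?thesis using that[of "b'" "- b"] assms by (simp add: algebra_simps)
  next
    case 4 then show ?thesis using that[of "c'" "- c"] assms by (simp add: algebra_simps)
  qed
qed

section \<open>Nilpotent operators and nilpotent ideals\<close>

lemma linear_funpow:
  fixes f :: "'b::real_vector \<Rightarrow> 'b"
  assumes "linear f" shows "linear (f ^^ n)"
proof (induction n)
  case 0 then show ?case using linear_id by (simp add: id_def)
next
  case (Suc n) then show ?case using linear_compose[OF Suc assms] by (simp add: o_def)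
qed

text \<open>
  By induction \<open>X Y\<^sup>k - Y\<^sup>k X = k Y\<^sup>k\<close>, so \<open>k \<parallel>Y\<^sup>k\<parallel> \<le> 2 \<parallel>X\<parallel> \<parallel>Y\<^sup>k\<parallel>\<close> for operator norms, and
  \<open>Y\<^sup>k = 0\<close> as soon as \<open>k\<close> exceeds \<open>2 \<parallel>X\<parallel>\<close>.
\<close>

lemma commutator_self_nilpotent:
  fixes X Y :: "'b::euclidean_space \<Rightarrow> 'b"
  assumes X: "linear X" and Y: "linear Y" and XY: "\<And>t. X (Y t) - Y (X t) = Y t"
  shows "\<exists>N. \<forall>t. (Y ^^ N) t = 0"
proof -
  have comm: "X ((Y ^^ k) t) - (Y ^^ k) (X t) = real k *\<^sub>R (Y ^^ k) t" for k t
  proof (induction k arbitrary: t)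
    case (Suc k)
    have "X ((Y ^^ Suc k) t) = X ((Y ^^ k) (Y t))" by (simp add: funpow_swap1)
    also have "\<dots> = (Y ^^ k) (X (Y t)) + real k *\<^sub>R (Y ^^ k) (Y t)"
      using Suc[of "Y t"] by (simp add: algebra_simps)
    also have "X (Y t) = Y (X t) + Y t" using XY[of t] by (simp add: algebra_simps)
    also have "(Y ^^ k) (Y (X t) + Y t) = (Y ^^ Suc k) (X t) + (Y ^^ Suc k) t"
      using linear_add[OF linear_funpow[OF Y, of k]] by (simp add: funpow_swap1)
    finally show ?case by (simp add: funpow_swap1 algebra_simps)
  qed simp
  have bX: "bounded_linear X" using X by (rule linear_conv_bounded_linear[THEN iffD1])
  obtain k :: nat where k: "2 * onorm X < real k" using reals_Archimedean2 by blast
  have bY: "bounded_linear (Y ^^ k)"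
    using linear_funpow[OF Y] by (rule linear_conv_bounded_linear[THEN iffD1])
  have "onorm (Y ^^ k) = 0"
  proof (rule ccontr)
    assume "onorm (Y ^^ k) \<noteq> 0"
    then have pos: "onorm (Y ^^ k) > 0" using onorm_pos_le[OF bY] by simp
    have "real k * onorm (Y ^^ k) = onorm (\<lambda>t. X ((Y ^^ k) t) + - (Y ^^ k) (X t))"
      using onorm_scaleR[OF bY, of "real k"] comm[of k] by (simp add: fun_eq_iff)
    also have "\<dots> \<le> onorm (\<lambda>t. X ((Y ^^ k) t)) + onorm (\<lambda>t. - (Y ^^ k) (X t))"
      by (intro onorm_triangle bounded_linear_minus bounded_linear_compose[OF bX bY]
          bounded_linear_compose[OF bY bX])
    also have "\<dots> \<le> onorm X * onorm (Y ^^ k) + onorm (Y ^^ k) * onorm X"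
      using onorm_compose[OF bX bY] onorm_compose[OF bY bX]
      by (simp add: onorm_neg o_def mult.commute)
    also have "\<dots> = 2 * onorm X * onorm (Y ^^ k)" by simp
    finally have "real k \<le> 2 * onorm X" using pos by simp
    with k show False by simp
  qed
  then have "\<forall>t. (Y ^^ k) t = 0" using onorm_eq_0[OF bY] by blast
  then show ?thesis by blast
qed

locale lie_alg =
  fixes br :: "'a::real_vector \<Rightarrow> 'a \<Rightarrow> 'a"
  assumes lie: "lie_algebra br"
begin

lemma bilinear_br: "bilinear br" using lie by (simp add: lie_algebra_def)

lemmas br_simps = bilinear_ladd[OF bilinear_br] bilinear_radd[OF bilinear_br]
  bilinear_lmul[OF bilinear_br] bilinear_rmul[OF bilinear_br]
  bilinear_lneg[OF bilinear_br] bilinear_rneg[OF bilinear_br]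
  bilinear_lzero[OF bilinear_br] bilinear_rzero[OF bilinear_br]
  bilinear_lsub[OF bilinear_br] bilinear_rsub[OF bilinear_br]

lemma br_self: "br x x = 0" using lie by (simp add: lie_algebra_def)

lemma br_skew: "br y x = - br x y"
proof -
  have "br (x + y) (x + y) = br x x + br x y + (br y x + br y y)"
    by (simp only: br_simps(1,2) add_ac)
  then have "br y x + br x y = 0" by (simp only: br_self add_0_left add_0_right add.commute)
  then show ?thesis by (simp only: eq_neg_iff_add_eq_0)
qed

lemma jacobi: "br x (br y z) = br (br x y) z + br y (br x z)"
proof -
  have "br x (br y z) + br y (br z x) + br z (br x y) = 0"
    using lie by (simp add: lie_algebra_def)
  moreover have "br x (br y z) = (br x (br y z) + br y (br z x) + br z (br x y))
      - br y (br z x) - br z (br x y)" by simp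
  ultimately have "br x (br y z) = - br y (br z x) - br z (br x y)" by simp
  then show ?thesis by (simp add: br_skew[of z x] br_skew[of z "br x y"] br_simps)
qed

lemma linear_br: "linear (br x)" using bilinear_br by (simp add: bilinear_def)

lemma lie_ideal_left: "lie_ideal br I \<Longrightarrow> y \<in> I \<Longrightarrow> br x y \<in> I"
  by (simp add: lie_ideal_def)

lemma lie_ideal_right: "lie_ideal br I \<Longrightarrow> y \<in> I \<Longrightarrow> br y x \<in> I"
  using br_skew[of y x] by (simp add: lie_ideal_def subspace_neg)

lemma commutator_space_ideal:
  assumes A: "lie_ideal br A" and B: "lie_ideal br B"
  shows "lie_ideal br (commutator_space br A B)"
  unfolding lie_ideal_def
proof (intro conjI allI ballI)
  show "subspace (commutator_space br A B)" by (simp add: commutator_space_def)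
next
  fix x y assume "y \<in> commutator_space br A B"
  then have "y \<in> span {br a b |a b. a \<in> A \<and> b \<in> B}" by (simp add: commutator_space_def)
  then show "br x y \<in> commutator_space br A B"
    unfolding commutator_space_def
  proof (induction rule: span_induct_alt)
    case base then show ?case by (simp add: br_simps span_zero)
  next
    case (step c u v)
    then obtain a b where u: "u = br a b" "a \<in> A" "b \<in> B" by auto
    have "br x u = br (br x a) b + br a (br x b)" using u(1) jacobi[of x a b] by simp
    also have "\<dots> \<in> span {br a b |a b. a \<in> A \<and> b \<in> B}"
      using lie_ideal_left[OF A u(2), of x] lie_ideal_left[OF B u(3), of x] u(2,3)
      by (intro span_add span_base) blast+
    finally show ?case using step(2) by (simp add: br_simps span_add span_scale)
  qed
qed

lemma lower_central_series_ideal: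
  "lie_ideal br h \<Longrightarrow> lie_ideal br (lower_central_series br h n)"
  by (induction n) (auto intro: commutator_space_ideal)

lemma lower_central_series_step:
  "x \<in> h \<Longrightarrow> y \<in> lower_central_series br h n \<Longrightarrow> br x y \<in> lower_central_series br h (Suc n)"
  by (auto simp: commutator_space_def intro: span_base)

lemma commutator_space_subset:
  assumes "subspace T" "\<And>x y. x \<in> A \<Longrightarrow> y \<in> B \<Longrightarrow> br x y \<in> T"
  shows "commutator_space br A B \<subseteq> T"
  unfolding commutator_space_def by (rule span_minimal) (use assms in auto)

lemma lower_central_series_Suc_subset:
  assumes "lie_ideal br h"
  shows "lower_central_series br h (Suc n) \<subseteq> lower_central_series br h n"
  unfolding lower_central_series.simps
  using lower_central_series_ideal[OF assms, of n]
  by (intro commutator_space_subset) (simp_all add: lie_ideal_def)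

text \<open>
  Write \<open>C\<^sub>j\<close> for the lower central series of \<open>h\<close>. That of \<open>K\<close> passes from \<open>C\<^sub>j\<close> into \<open>C\<^sub>j\<^sub>+\<^sub>1\<close> through the spaces
  \<open>C\<^sub>j\<^sub>+\<^sub>1 + (ad x)\<^sup>i C\<^sub>j\<close>: bracketing with \<open>h\<close> leads into \<open>C\<^sub>j\<^sub>+\<^sub>1\<close> at once, bracketing with \<open>x\<close> raises \<open>i\<close>, and \<open>i = N\<close> is the end.
\<close>

lemma nilpotent_extension:
  assumes h: "lie_ideal br h" "lie_nilpotent_on br h"
    and nil: "\<And>y. y \<in> h \<Longrightarrow> (br x ^^ N) y = 0"
    and K: "\<And>v. v \<in> K \<Longrightarrow> \<exists>a \<alpha>. a \<in> h \<and> v = a + \<alpha> *\<^sub>R x"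
  shows "lie_nilpotent_on br K"
proof -
  let ?C = "lower_central_series br h" and ?L = "lower_central_series br K"
  have C: "lie_ideal br (?C j)" for j using h(1) by (rule lower_central_series_ideal)
  have pow: "(br x ^^ i) d \<in> ?C j" if "d \<in> ?C j" for i j d
    using that by (induction i) (auto intro: lie_ideal_left[OF C])
  have subC: "subspace (?C j)" for j using C by (simp add: lie_ideal_def)
  have "\<exists>n. ?L (Suc n) \<subseteq> ?C j" for j
  proof (induction j)
    case 0
    have "?L (Suc 0) \<subseteq> h"
      unfolding lower_central_series.simps
    proof (rule commutator_space_subset)
      show "subspace h" using h(1) by (simp add: lie_ideal_def)
      fix u v assume "u \<in> K" "v \<in> K"
      then obtain a \<alpha> b \<beta> where "a \<in> h" "u = a + \<alpha> *\<^sub>R x" "b \<in> h" "v = b + \<beta> *\<^sub>R x"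
        using K by meson
      moreover have "br u v = br a v + \<alpha> *\<^sub>R br x b"
        using \<open>u = _\<close> \<open>v = _\<close> by (simp add: br_simps br_self)
      moreover have "br a v \<in> h" "br x b \<in> h"
        using lie_ideal_left[OF h(1) \<open>b \<in> h\<close>] lie_ideal_right[OF h(1) \<open>a \<in> h\<close>] by auto
      ultimately show "br u v \<in> h"
        using h(1) by (simp add: lie_ideal_def subspace_add subspace_scale)
    qed
    then show ?case by (intro exI[of _ 0]) simp
  next
    case (Suc j)
    then obtain n where n: "?L (Suc n) \<subseteq> ?C j" by auto
    define S where "S i = {c + (br x ^^ i) d |c d. c \<in> ?C (Suc j) \<and> d \<in> ?C j}" for i
    have subS: "subspace (S i)" for i
    proof -
      have lin: "linear (br x ^^ i)" by (rule linear_funpow[OF linear_br])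
      have "S i = {u + v |u v. u \<in> ?C (Suc j) \<and> v \<in> (br x ^^ i) ` ?C j}"
        by (auto simp: S_def)
      then show ?thesis
        using subspace_sums[OF subC[of "Suc j"] linear_subspace_image[OF lin subC[of j]]] by simp
    qed
    have "?L (Suc n + i) \<subseteq> S i" for i
    proof (induction i)
      case 0
      have "t \<in> S 0" if "t \<in> ?C j" for t
      proof -
        have "t = 0 + (br x ^^ 0) t" by simp
        with that subspace_0[OF subC[of "Suc j"]] show ?thesis unfolding S_def by blast
      qed
      with n show ?case by auto
    next
      case (Suc i)
      have "?L (Suc n + Suc i) = commutator_space br K (?L (Suc n + i))" by simp
      also have "\<dots> \<subseteq> S (Suc i)"
      proof (rule commutator_space_subset[OF subS])
        fix u v assume "u \<in> K" "v \<in> ?L (Suc n + i)"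
        then obtain a \<alpha> c d where *: "a \<in> h" "u = a + \<alpha> *\<^sub>R x" "c \<in> ?C (Suc j)" "d \<in> ?C j"
          "v = c + (br x ^^ i) d"
        proof -
          obtain c d where "c \<in> ?C (Suc j)" "d \<in> ?C j" "v = c + (br x ^^ i) d"
            using Suc \<open>v \<in> _\<close> unfolding S_def by blast
          then show ?thesis using that K[OF \<open>u \<in> K\<close>] by blast
        qed
        have c: "c \<in> ?C j" using lower_central_series_Suc_subset[OF h(1)] *(3) by blast
        have "br a v \<in> ?C (Suc j)"
          using * c pow[OF *(4)] subC by (intro lower_central_series_step) (auto intro: subspace_add)
        moreover have "br x c \<in> ?C (Suc j)" using C *(3) by (rule lie_ideal_left)
        ultimately have "br a v + \<alpha> *\<^sub>R br x c \<in> ?C (Suc j)"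
          using subC by (intro subspace_add subspace_scale)
        moreover have "br u v = (br a v + \<alpha> *\<^sub>R br x c) + (br x ^^ Suc i) (\<alpha> *\<^sub>R d)"
          using * linear_scale[OF linear_funpow[OF linear_br[of x], of "Suc i"], of \<alpha> d]
          by (simp add: br_simps algebra_simps)
        moreover have "\<alpha> *\<^sub>R d \<in> ?C j" using *(4) subC by (simp add: subspace_scale)
        ultimately show "br u v \<in> S (Suc i)" unfolding S_def by blast
      qed
      finally show ?case .
    qed
    from this[of N] have "?L (Suc n + N) \<subseteq> S N" .
    also have "S N \<subseteq> ?C (Suc j)"
    proof -
      have "?C j \<subseteq> h"
      proof (induction j)
        case (Suc j) then show ?case using lower_central_series_Suc_subset[OF h(1), of j] by blast
      qed simp
      then show ?thesis by (auto simp: S_def nil subset_iff)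
    qed
    finally show ?case by (metis add_Suc)
  qed
  moreover obtain m where "?C m = {0}" using h(2) by (auto simp: lie_nilpotent_on_def)
  ultimately obtain n where "?L (Suc n) \<subseteq> {0}" by metis
  moreover have "0 \<in> ?L (Suc n)" by (simp add: commutator_space_def span_zero)
  ultimately have "?L (Suc n) = {0}" by blast
  then show ?thesis unfolding lie_nilpotent_on_def by blast
qed

end

text \<open>
  This is \<open>commutator_self_nilpotent\<close> for the operators induced on \<open>V/W\<close>. The quotient is realised as a complement
  of \<open>W\<close> in \<open>V\<close>, by a projection \<open>p\<close> that vanishes on \<open>W\<close>; a linear isomorphism with \<open>\<real>\<^sup>6\<close> supplies a norm.
\<close>

lemma commutator_self_nilpotent_quotient:
  fixes X Y :: "'a::real_vector \<Rightarrow> 'a"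
  assumes dimU: "dim (UNIV :: 'a set) = 6" and X: "linear X" and Y: "linear Y"
    and W: "subspace W" "W \<subseteq> V" and V: "subspace V"
    and inv: "\<And>t. t \<in> V \<Longrightarrow> X t \<in> V" "\<And>t. t \<in> V \<Longrightarrow> Y t \<in> V"
      "\<And>t. t \<in> W \<Longrightarrow> X t \<in> W" "\<And>t. t \<in> W \<Longrightarrow> Y t \<in> W"
    and comm: "\<And>t. t \<in> V \<Longrightarrow> X (Y t) - Y (X t) - Y t \<in> W"
  shows "\<exists>N. \<forall>t\<in>V. (Y ^^ N) t \<in> W"
proof -
  obtain B where B: "B \<subseteq> W" "independent B" "W \<subseteq> span B"
    by (rule maximal_independent_subset)
  have spB: "span B = W" using B W(1) span_minimal by blast
  obtain C where C: "B \<subseteq> C" "C \<subseteq> V" "independent C" "V \<subseteq> span C"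
    using maximal_independent_subset_extend[of B V] B W(2) by blast
  obtain p where p: "linear p" "\<And>b. b \<in> C \<Longrightarrow> p b = (if b \<in> B then 0 else b)"
      "range p = span ((\<lambda>b. if b \<in> B then 0 else b) ` C)"
    using linear_independent_extend_subspace[OF C(3), of "\<lambda>b. if b \<in> B then 0 else b"] by metis
  have pV: "p t \<in> V" for t
  proof -
    have "span ((\<lambda>b. if b \<in> B then 0 else b) ` C) \<subseteq> V"
      using C(2) V by (intro span_minimal) (auto simp: subspace_0)
    then show ?thesis using p(3) by blast
  qed
  have pW: "p t = 0" if "t \<in> W" for t
  proof -
    have "t \<in> span B" using that spB by simp
    then show ?thesis
      by (rule linear_eq_0_on_span[OF p(1), rotated]) (use p(2) C(1) in auto)
  qed
  have diffW: "t - p t \<in> W" if "t \<in> V" for t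
  proof -
    have "t \<in> span C" using that C(4) by blast
    then show ?thesis
    proof (induction rule: span_induct_alt)
      case base then show ?case using linear_0[OF p(1)] W(1) by (simp add: subspace_0)
    next
      case (step c x y)
      have "x - p x \<in> W" using step(1) p(2) B(1) W(1) by (auto simp: subspace_0)
      then have "c *\<^sub>R (x - p x) + (y - p y) \<in> W" using step(2) W(1)
        by (intro subspace_add subspace_scale)
      then show ?case by (simp add: linear_add[OF p(1)] linear_scale[OF p(1)] algebra_simps)
    qed
  qed
  have p_inv: "p (F (p t)) = p (F t)"
    if "t \<in> V" "linear F" "\<And>t. t \<in> W \<Longrightarrow> F t \<in> W" for F t
  proof -
    have "p (F (t - p t)) = 0" using that diffW by (intro pW) auto
    then show ?thesis by (simp add: linear_diff[OF p(1)] linear_diff[OF that(2)])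
  qed
  obtain D :: "'a set" where D: "independent D" "span D = UNIV" "card D = 6"
  proof -
    obtain D :: "'a set" where "independent D" "UNIV \<subseteq> span D" "card D = dim (UNIV :: 'a set)"
      by (rule basis_exists[of "UNIV :: 'a set"]) blast
    then show ?thesis using that dimU by auto
  qed
  have "finite D" using D(3) by (metis card.infinite zero_neq_numeral)
  obtain f where f: "bij_betw f D (Basis :: (real^6) set)"
    using finite_same_card_bij[OF \<open>finite D\<close> finite_Basis[where 'a = "real^6"]] D(3) by auto
  obtain \<phi> where \<phi>: "linear \<phi>" "\<forall>b\<in>D. \<phi> b = f b"
    using linear_independent_extend[OF D(1)] by metis
  obtain \<psi> where \<psi>: "linear \<psi>" "\<forall>b\<in>Basis. \<psi> b = inv_into D f b"
    using linear_independent_extend[OF independent_Basis[where 'a = "real^6"]] by metis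
  note lin = \<phi>(1) \<psi>(1)
  have \<psi>\<phi>: "\<psi> (\<phi> t) = t" for t
  proof (rule linear_eq_on[where B = D and g = "\<lambda>t. t"])
    show "linear (\<lambda>t. \<psi> (\<phi> t))" using linear_compose[OF lin] by (simp add: o_def)
    show "linear (\<lambda>t :: 'a. t)" by (rule linear_id[unfolded id_def])
    show "t \<in> span D" using D by simp
    fix b assume b: "b \<in> D"
    then have "f b \<in> Basis" using f by (auto simp: bij_betw_def)
    then show "\<psi> (\<phi> b) = b"
      using b f \<phi>(2) \<psi>(2) by (simp add: bij_betw_def)
  qed
  define X' where "X' s = \<phi> (p (X (p (\<psi> s))))" for s
  define Y' where "Y' s = \<phi> (p (Y (p (\<psi> s))))" for s
  have linX': "linear X'"
    unfolding X'_def
    using linear_compose[OF linear_compose[OF linear_compose[OF linear_compose[OF lin(2) p(1)] X] p(1)] lin(1)]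
    by (simp add: o_def)
  have linY': "linear Y'"
    unfolding Y'_def
    using linear_compose[OF linear_compose[OF linear_compose[OF linear_compose[OF lin(2) p(1)] Y] p(1)] lin(1)]
    by (simp add: o_def)
  have "X' (Y' s) - Y' (X' s) = Y' s" for s
  proof -
    let ?t = "p (\<psi> s)"
    have t: "?t \<in> V" by (rule pV)
    have pp: "p (p u) = p u" if "u \<in> V" for u
      using p_inv[OF that linear_id] by simp
    have "X' (Y' s) = \<phi> (p (X (Y ?t)))"
      using p_inv[OF inv(2)[OF t] X inv(3)] pp[OF inv(2)[OF t]] by (simp add: X'_def Y'_def \<psi>\<phi>)
    moreover have "Y' (X' s) = \<phi> (p (Y (X ?t)))"
      using p_inv[OF inv(1)[OF t] Y inv(4)] pp[OF inv(1)[OF t]] by (simp add: X'_def Y'_def \<psi>\<phi>)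
    moreover have "p (X (Y ?t)) - p (Y (X ?t)) - p (Y ?t) = 0"
      using pW[OF comm[OF t]] by (simp add: linear_diff[OF p(1)])
    ultimately show ?thesis
      by (simp add: Y'_def linear_diff[OF lin(1), symmetric])
  qed
  from commutator_self_nilpotent[OF linX' linY' this] obtain N where N: "\<And>s. (Y' ^^ N) s = 0"
    by blast
  have pow: "(Y' ^^ n) (\<phi> (p t)) = \<phi> (p ((Y ^^ n) t)) \<and> (Y ^^ n) t \<in> V" if "t \<in> V" for n t
  proof (induction n)
    case (Suc n)
    have V: "(Y ^^ n) t \<in> V" using Suc by simp
    have "Y' (\<phi> (p ((Y ^^ n) t))) = \<phi> (p (Y (p (p ((Y ^^ n) t)))))" by (simp add: Y'_def \<psi>\<phi>)
    also have "p (p ((Y ^^ n) t)) = p ((Y ^^ n) t)" using p_inv[OF V linear_id] by simp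
    also have "p (Y (p ((Y ^^ n) t))) = p (Y ((Y ^^ n) t))" by (rule p_inv[OF V Y inv(4)])
    finally show ?case using Suc inv(2)[OF V] by simp
  qed (use that in simp)
  have "(Y ^^ N) t \<in> W" if "t \<in> V" for t
  proof -
    have "\<phi> (p ((Y ^^ N) t)) = 0" using pow[OF that, of N] N by metis
    then have "p ((Y ^^ N) t) = 0" using \<psi>\<phi> linear_0[OF lin(2)] by metis
    then show ?thesis using diffW[of "(Y ^^ N) t"] pow[OF that, of N] by simp
  qed
  then show ?thesis by blast
qed

section \<open>The nilradical of codimension two\<close>

locale unimodular_codim2 = lie_alg br for br :: "'a::real_vector \<Rightarrow> 'a \<Rightarrow> 'a" +
  fixes h :: "'a set"
  assumes dimU: "dim (UNIV :: 'a set) = 6" and unimod: "unimodular br"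
    and nilrad: "is_nilradical br h" and dimh: "dim h = 4"
begin

lemma h_ideal: "lie_ideal br h" using nilrad by (simp add: is_nilradical_def)
lemma h_nilpotent: "lie_nilpotent_on br h" using nilrad by (simp add: is_nilradical_def)
lemma h_subspace: "subspace h" using h_ideal by (simp add: lie_ideal_def)

lemmas h_closed = subspace_add[OF h_subspace] subspace_scale[OF h_subspace]
  subspace_neg[OF h_subspace] subspace_diff[OF h_subspace] subspace_0[OF h_subspace]

lemma h_br: "y \<in> h \<Longrightarrow> br x y \<in> h" "y \<in> h \<Longrightarrow> br y x \<in> h"
  using lie_ideal_left[OF h_ideal] lie_ideal_right[OF h_ideal] by auto

text \<open>
  Otherwise \<open>h + \<real>x\<close> would be a nilpotent ideal larger than the nilradical.
\<close>

lemma ad_nilpotent_in_h: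
  assumes nil: "\<And>y. y \<in> h \<Longrightarrow> (br x ^^ N) y = 0"
    and ideal: "\<And>v. \<exists>\<alpha>. br v x - \<alpha> *\<^sub>R x \<in> h"
  shows "x \<in> h"
proof -
  let ?K = "{a + \<alpha> *\<^sub>R x |a \<alpha>. a \<in> h}"
  have "lie_nilpotent_on br ?K"
    by (rule nilpotent_extension[OF h_ideal h_nilpotent nil]) auto
  moreover have "lie_ideal br ?K"
    unfolding lie_ideal_def
  proof (intro conjI allI ballI)
    have "?K = {a + b |a b. a \<in> h \<and> b \<in> span {x}}" by (auto simp: span_singleton)
    then show "subspace ?K" using subspace_sums[OF h_subspace subspace_span] by simp
    fix v y assume "y \<in> ?K"
    then obtain a \<alpha> where y: "a \<in> h" "y = a + \<alpha> *\<^sub>R x" by blast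
    obtain \<beta> where \<beta>: "br v x - \<beta> *\<^sub>R x \<in> h" using ideal by blast
    have "br v y = (br v a + \<alpha> *\<^sub>R (br v x - \<beta> *\<^sub>R x)) + (\<alpha> * \<beta>) *\<^sub>R x"
      using y by (simp add: br_simps algebra_simps)
    moreover have "br v a + \<alpha> *\<^sub>R (br v x - \<beta> *\<^sub>R x) \<in> h"
      using y(1) \<beta> by (intro h_closed(1,2) h_br)
    ultimately show "br v y \<in> ?K" by blast
  qed
  ultimately have "?K \<subseteq> h" using nilrad by (simp add: is_nilradical_def)
  moreover have "0 + 1 *\<^sub>R x \<in> ?K" using h_closed(5) by blast
  ultimately show ?thesis by auto
qed

text \<open>
  On each factor \<open>C\<^sub>j/C\<^sub>j\<^sub>+\<^sub>1\<close> of the lower central series of \<open>h\<close> the ideal \<open>h\<close> acts trivially, so there \<open>ad y\<close> is its own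
  commutator with \<open>ad x\<close> and hence nilpotent. Therefore \<open>ad y\<close> is nilpotent on \<open>h\<close>.
\<close>

lemma no_affine_quotient:
  assumes xy: "br x y - y \<in> h" and quot: "\<And>v. \<exists>\<alpha>. br v y - \<alpha> *\<^sub>R y \<in> h"
  shows "y \<in> h"
proof -
  let ?C = "lower_central_series br h"
  have C: "lie_ideal br (?C j)" for j using h_ideal by (rule lower_central_series_ideal)
  have "\<exists>N. \<forall>t\<in>?C j. (br y ^^ N) t \<in> ?C (Suc j)" for j
  proof (rule commutator_self_nilpotent_quotient[OF dimU, where X = "br x"])
    show "subspace (?C j)" "subspace (?C (Suc j))" using C by (auto simp only: lie_ideal_def)
    fix t assume t: "t \<in> ?C j"
    have "br x (br y t) - br y (br x t) - br y t = br (br x y - y) t"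
      by (simp add: jacobi[of x y t] br_simps)
    also have "\<dots> \<in> ?C (Suc j)" using xy t by (rule lower_central_series_step)
    finally show "br x (br y t) - br y (br x t) - br y t \<in> ?C (Suc j)" .
  qed (use linear_br lower_central_series_Suc_subset[OF h_ideal] lie_ideal_left[OF C] in \<open>simp_all only:\<close>)
  then obtain N where N: "\<And>j t. t \<in> ?C j \<Longrightarrow> (br y ^^ N j) t \<in> ?C (Suc j)" by metis
  have "\<exists>M. \<forall>t\<in>h. (br y ^^ M) t \<in> ?C j" for j
  proof (induction j)
    case 0 then show ?case by (intro exI[of _ 0]) simp
  next
    case (Suc j)
    then obtain M where "\<forall>t\<in>h. (br y ^^ M) t \<in> ?C j" by blast
    then have "\<forall>t\<in>h. (br y ^^ (N j + M)) t \<in> ?C (Suc j)"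
      using N[of _ j] by (simp only: funpow_add o_apply) blast
    then show ?case by blast
  qed
  moreover obtain m where "?C m = {0}" using h_nilpotent by (auto simp: lie_nilpotent_on_def)
  ultimately obtain M where "\<forall>t\<in>h. (br y ^^ M) t = 0" by blast
  then show ?thesis using quot by (intro ad_nilpotent_in_h) auto
qed

text \<open>
  The two-dimensional quotient \<open>\<gg>/h\<close> is abelian or affine. If it is affine, its derived line is spanned by the class of some
  \<open>z\<close> with \<open>[w,z] \<equiv> z\<close>, which \<open>no_affine_quotient\<close> excludes.
\<close>

lemma br_in_h: "br u v \<in> h"
proof -
  obtain x y where T: "transversal h x y" using transversal_exists[OF h_subspace dimh dimU] .
  note ex = transversal_expand[OF h_subspace dimh dimU T]
  have xy: "br x y \<in> h"
  proof (rule ccontr)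
    assume n: "br x y \<notin> h"
    obtain \<alpha> \<beta> t where t: "t \<in> h" "br x y = \<alpha> *\<^sub>R x + \<beta> *\<^sub>R y + t" by (rule ex)
    define z where "z = \<alpha> *\<^sub>R x + \<beta> *\<^sub>R y"
    have bz: "br x y = z + t" using t by (simp add: z_def)
    have brxz: "br x z = \<beta> *\<^sub>R (z + t)" "br y z = - \<alpha> *\<^sub>R (z + t)"
      unfolding z_def by (simp_all add: br_simps br_self br_skew[of y x] t(2)) (simp add: algebra_simps)
    have z: "z \<notin> h" using n t(1) bz h_closed by auto
    have brz: "\<exists>\<gamma>. br v z - \<gamma> *\<^sub>R z \<in> h" for v
    proof -
      obtain a b s where s: "s \<in> h" "v = a *\<^sub>R x + b *\<^sub>R y + s" by (rule ex)
      have "br v z - (a * \<beta> - b * \<alpha>) *\<^sub>R z = (a * \<beta> - b * \<alpha>) *\<^sub>R t + br s z"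
        by (simp add: s(2) br_simps brxz algebra_simps)
      also have "\<dots> \<in> h" using s(1) t(1) by (intro h_closed(1,2) h_br)
      finally show ?thesis by blast
    qed
    obtain w where "br w z - z \<in> h"
    proof (cases "\<alpha> = 0")
      case False
      have "br (- (1/\<alpha>) *\<^sub>R y) z - z = t"
        using False by (simp add: br_simps brxz)
      with t(1) that show ?thesis by metis
    next
      case True
      then have "\<beta> \<noteq> 0" using z h_closed by (auto simp: z_def)
      then have "br ((1/\<beta>) *\<^sub>R x) z - z = t"
        using True by (simp add: br_simps brxz)
      with t(1) that show ?thesis by metis
    qed
    from no_affine_quotient[OF this brz] z show False by simp
  qed
  obtain a b s where s: "s \<in> h" "u = a *\<^sub>R x + b *\<^sub>R y + s" by (rule ex)
  obtain a' b' s' where s': "s' \<in> h" "v = a' *\<^sub>R x + b' *\<^sub>R y + s'" by (rule ex)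
  have "br u v = (a * b' - b * a') *\<^sub>R br x y + (br (a *\<^sub>R x + b *\<^sub>R y) s' + br s v)"
    using s(2) s'(2) br_skew[of y x] by (simp add: br_simps br_self algebra_simps)
  also have "\<dots> \<in> h" using xy h_br(1)[OF s'(1)] h_br(2)[OF s(1)] by (intro h_closed(1,2))
  finally show ?thesis .
qed

lemma ad_nilpotent4_in_h:
  assumes "\<And>y. y \<in> h \<Longrightarrow> br x (br x (br x (br x y))) = 0"
  shows "x \<in> h"
  by (rule ad_nilpotent_in_h[where N = 4])
    (use assms br_in_h in \<open>auto simp: eval_nat_numeral intro: exI[of _ 0]\<close>)

lemma ad_triangular_in_h:
  assumes F: "frame4 h a b c d"
    and a: "br x a \<in> span {b, c, d}" and b: "br x b \<in> span {c, d}" and c: "br x c \<in> span {d}"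
    and d: "br x d = 0"
  shows "x \<in> h"
proof (rule ad_nilpotent4_in_h)
  fix y assume "y \<in> h"
  then obtain \<alpha> \<beta> \<gamma> \<delta> where y: "y = \<alpha> *\<^sub>R a + \<beta> *\<^sub>R b + \<gamma> *\<^sub>R c + \<delta> *\<^sub>R d"
    using frame4_expand[OF F] by metis
  obtain a1 a2 a3 where a': "br x a = a1 *\<^sub>R b + a2 *\<^sub>R c + a3 *\<^sub>R d" using a by (auto simp: in_span3)
  obtain b1 b2 where b': "br x b = b1 *\<^sub>R c + b2 *\<^sub>R d" using b by (auto simp: in_span2)
  obtain c1 where c': "br x c = c1 *\<^sub>R d" using c by (auto simp: span_singleton)
  show "br x (br x (br x (br x y))) = 0" by (simp add: y br_simps a' b' c' d)
qed

lemma trace_ad_h: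
  assumes F: "frame4 h a b c d"
    and "br x a = a1 *\<^sub>R a + a2 *\<^sub>R b + a3 *\<^sub>R c + a4 *\<^sub>R d"
    and "br x b = b1 *\<^sub>R a + b2 *\<^sub>R b + b3 *\<^sub>R c + b4 *\<^sub>R d"
    and "br x c = c1 *\<^sub>R a + c2 *\<^sub>R b + c3 *\<^sub>R c + c4 *\<^sub>R d"
    and "br x d = d1 *\<^sub>R a + d2 *\<^sub>R b + d3 *\<^sub>R c + d4 *\<^sub>R d"
  shows "a1 + b2 + c3 + d4 = 0"
proof -
  obtain u v where T: "transversal h u v" using transversal_exists[OF h_subspace dimh dimU] .
  show ?thesis
    using linear_trace_frame[OF F T dimU linear_br br_in_h assms(2-5)] unimod
    by (simp add: unimodular_def)
qed

end

section \<open>Four-dimensional nilradicals\<close>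

context unimodular_codim2
begin

text \<open>
  Here \<open>h\<close> is the product of the Heisenberg algebra on \<open>p, q, z\<close> and the line of \<open>w\<close>; its centre is the span of \<open>z\<close> and \<open>w\<close>.
\<close>

definition heisenberg_frame :: "'a \<Rightarrow> 'a \<Rightarrow> 'a \<Rightarrow> 'a \<Rightarrow> bool" where
  "heisenberg_frame p q z w \<longleftrightarrow> frame4 h p q z w \<and> br p q = z \<and>
     br p z = 0 \<and> br q z = 0 \<and> br p w = 0 \<and> br q w = 0 \<and> br z w = 0"

definition filiform_frame :: "'a \<Rightarrow> 'a \<Rightarrow> 'a \<Rightarrow> 'a \<Rightarrow> bool" where
  "filiform_frame p q r s \<longleftrightarrow> frame4 h p q r s \<and> br p q = r \<and> br p r = s \<and>
     br q r = 0 \<and> br p s = 0 \<and> br q s = 0 \<and> br r s = 0"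

lemma h_not_in_small_span:
  assumes "finite T" "card T < 4"
  shows "\<not> h \<subseteq> span T"
proof
  assume "h \<subseteq> span T"
  obtain a b c d where F: "frame4 h a b c d" using frame4_exists[OF h_subspace dimh] .
  then have "independent {a, b, c, d}" "card {a, b, c, d} = 4" by (auto simp: frame4_def)
  moreover have "{a, b, c, d} \<subseteq> h" using frame4_mem[OF F] by simp
  ultimately have "independent {a, b, c, d}" "card {a, b, c, d} = 4" "{a, b, c, d} \<subseteq> h"
    by blast+
  then show False
    using independent_span_bound[OF assms(1), of "{a, b, c, d}"] \<open>h \<subseteq> span T\<close> assms(2) by force
qed

text \<open>
  Take \<open>b\<close> in the last term of the lower central series that is not contained in \<open>F\<close>. Iterated from \<open>F = 0\<close>, this
  produces a basis of \<open>h\<close> adapted to a flag that \<open>ad h\<close> lowers.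
\<close>

lemma nilpotent_step:
  assumes F: "\<not> h \<subseteq> F" "0 \<in> F"
  obtains b where "b \<in> h" "b \<notin> F" "\<And>x. x \<in> h \<Longrightarrow> br x b \<in> F"
proof -
  let ?C = "lower_central_series br h"
  obtain m where "?C m = {0}" using h_nilpotent by (auto simp: lie_nilpotent_on_def)
  then have ex: "\<exists>n. ?C n \<subseteq> F" using F(2) by (metis empty_subsetI insert_subset)
  define j where "j = (LEAST n. ?C n \<subseteq> F)"
  have j: "?C j \<subseteq> F" unfolding j_def using ex by (rule LeastI_ex)
  have "j \<noteq> 0" using j F(1) by (metis lower_central_series.simps(1))
  then obtain i where i: "j = Suc i" by (cases j) auto
  have "\<not> ?C i \<subseteq> F" using not_less_Least[of i "\<lambda>n. ?C n \<subseteq> F"] i by (simp add: j_def)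
  then obtain b where b: "b \<in> ?C i" "b \<notin> F" by blast
  have sub: "?C n \<subseteq> h" for n
  proof (induction n)
    case (Suc n) then show ?case using lower_central_series_Suc_subset[OF h_ideal, of n] by blast
  qed simp
  show ?thesis
  proof (rule that)
    show "b \<in> h" "b \<notin> F" using b sub by auto
    fix x assume "x \<in> h"
    then have "br x b \<in> ?C (Suc i)" using b(1) by (rule lower_central_series_step)
    then show "br x b \<in> F" using j i by blast
  qed
qed

text \<open>
  If \<open>[p,q]\<close> has no component along \<open>r\<close>, then a multiple of \<open>r\<close> can be subtracted from \<open>q\<close> to make it central.
\<close>

lemma heisenberg_or_filiform:
  assumes F: "frame4 h p q r s" and pq: "br p q = \<alpha> *\<^sub>R r + \<beta> *\<^sub>R s" and pr: "br p r = \<gamma> *\<^sub>R s"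
    and \<gamma>: "\<gamma> \<noteq> 0" and qr: "br q r = 0" and s: "br p s = 0" "br q s = 0" "br r s = 0"
  shows "(\<exists>p q z w. heisenberg_frame p q z w) \<or> (\<exists>p q r s. filiform_frame p q r s)"
proof (cases "\<alpha> = 0")
  case True
  let ?w = "q - (\<beta> / \<gamma>) *\<^sub>R r"
  have "frame4 h p r (\<gamma> *\<^sub>R s) ?w"
  proof (rule frame4I_coeffs[OF h_subspace dimh])
    fix a b c d assume "a *\<^sub>R p + b *\<^sub>R r + c *\<^sub>R \<gamma> *\<^sub>R s + d *\<^sub>R ?w = 0"
    then have "a *\<^sub>R p + d *\<^sub>R q + (b - d * \<beta> / \<gamma>) *\<^sub>R r + (c * \<gamma>) *\<^sub>R s = 0"
      by (simp add: algebra_simps)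
    from frame4_coeffs[OF F this] \<gamma> show "a = 0 \<and> b = 0 \<and> c = 0 \<and> d = 0" by auto
  qed (use frame4_mem[OF F] h_closed in auto)
  then have "heisenberg_frame p r (\<gamma> *\<^sub>R s) ?w"
    using pq pr \<gamma> qr s True br_skew[of s q] br_skew[of s r] br_skew[of r q]
    by (simp add: heisenberg_frame_def br_simps br_self)
  then show ?thesis by blast
next
  case False
  let ?r = "\<alpha> *\<^sub>R r + \<beta> *\<^sub>R s"
  have "frame4 h p q ?r ((\<alpha> * \<gamma>) *\<^sub>R s)"
  proof (rule frame4I_coeffs[OF h_subspace dimh])
    fix a b c d assume "a *\<^sub>R p + b *\<^sub>R q + c *\<^sub>R ?r + d *\<^sub>R (\<alpha> * \<gamma>) *\<^sub>R s = 0"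
    then have "a *\<^sub>R p + b *\<^sub>R q + (c * \<alpha>) *\<^sub>R r + (c * \<beta> + d * \<alpha> * \<gamma>) *\<^sub>R s = 0"
      by (simp add: algebra_simps)
    from frame4_coeffs[OF F this] \<gamma> False show "a = 0 \<and> b = 0 \<and> c = 0 \<and> d = 0" by auto
  qed (use frame4_mem[OF F] h_closed in auto)
  then have "filiform_frame p q ?r ((\<alpha> * \<gamma>) *\<^sub>R s)"
    using pq pr qr s by (simp add: filiform_frame_def br_simps br_self)
  then show ?thesis by blast
qed

text \<open>
  In a flag basis \<open>a, b, c, d\<close> only \<open>[a,b]\<close>, \<open>[a,c]\<close>, \<open>[b,c]\<close> can be nonzero, and the last two are multiples of \<open>d\<close>.
  A change of \<open>a\<close> and \<open>b\<close> makes one of these multiples vanish.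
\<close>

lemma nilradical_cases:
  "lie_abelian_on br h \<or> (\<exists>p q z w. heisenberg_frame p q z w) \<or> (\<exists>p q r s. filiform_frame p q r s)"
proof -
  obtain d where d: "d \<in> h" "d \<noteq> 0" "\<And>x. x \<in> h \<Longrightarrow> br x d = 0"
    using nilpotent_step[of "{0}"] h_not_in_small_span[of "{}"] by auto
  obtain c where c: "c \<in> h" "c \<notin> span {d}" "\<And>x. x \<in> h \<Longrightarrow> br x c \<in> span {d}"
    using nilpotent_step[of "span {d}"] h_not_in_small_span[of "{d}"] by (auto simp: span_zero)
  have "card {c, d} < 4" "card {u, c, d} < 4" for u
    by (auto simp: card_insert_if)
  then obtain b where b: "b \<in> h" "b \<notin> span {c, d}" "\<And>x. x \<in> h \<Longrightarrow> br x b \<in> span {c, d}"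
    using nilpotent_step[of "span {c, d}"] h_not_in_small_span[of "{c, d}"]
    by (metis finite.emptyI finite.insertI span_zero)
  obtain a where a: "a \<in> h" "a \<notin> span {b, c, d}"
    using h_not_in_small_span[of "{b, c, d}"] \<open>\<And>u. card {u, c, d} < 4\<close> by (meson finite.emptyI finite.insertI subsetI)
  have F: "frame4 h a b c d"
    by (rule frame4I[OF h_subspace dimh]) (use a b c d in auto)
  obtain \<alpha> \<beta> where ab: "br a b = \<alpha> *\<^sub>R c + \<beta> *\<^sub>R d" using b(3)[OF a(1)] by (auto simp: in_span2)
  obtain \<gamma> where ac: "br a c = \<gamma> *\<^sub>R d" using c(3)[OF a(1)] by (auto simp: span_singleton)
  obtain \<delta> where bc: "br b c = \<delta> *\<^sub>R d" using c(3)[OF b(1)] by (auto simp: span_singleton)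
  have dd: "br a d = 0" "br b d = 0" "br c d = 0" using d a b c by auto
  have skew: "br b a = - br a b" "br c a = - br a c" "br c b = - br b c"
    "br d a = - br a d" "br d b = - br b d" "br d c = - br c d" by (rule br_skew)+
  consider "\<gamma> \<noteq> 0" | "\<gamma> = 0" "\<delta> \<noteq> 0" | "\<gamma> = 0" "\<delta> = 0" "\<alpha> = 0" "\<beta> = 0" | "\<gamma> = 0" "\<delta> = 0" "\<alpha> \<noteq> 0"
    | "\<gamma> = 0" "\<delta> = 0" "\<alpha> = 0" "\<beta> \<noteq> 0" by blast
  then show ?thesis
  proof cases
    case 1
    let ?q = "b - (\<delta> / \<gamma>) *\<^sub>R a"
    have "frame4 h a ?q c d"
    proof (rule frame4I_coeffs[OF h_subspace dimh])
      fix u v s t assume "u *\<^sub>R a + v *\<^sub>R ?q + s *\<^sub>R c + t *\<^sub>R d = 0"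
      then have "(u - v * \<delta> / \<gamma>) *\<^sub>R a + v *\<^sub>R b + s *\<^sub>R c + t *\<^sub>R d = 0" by (simp add: algebra_simps)
      from frame4_coeffs[OF F this] show "u = 0 \<and> v = 0 \<and> s = 0 \<and> t = 0" by auto
    qed (use frame4_mem[OF F] h_closed in auto)
    from heisenberg_or_filiform[OF this, of \<alpha> \<beta> \<gamma>] 1 show ?thesis
      by (simp add: br_simps br_self ab ac bc dd)
  next
    case 2
    have "frame4 h b a c d"
      using F by (simp add: frame4_def insert_commute)
    from heisenberg_or_filiform[OF this, of "- \<alpha>" "- \<beta>" \<delta>] 2 show ?thesis
      by (simp add: br_simps br_self skew ab ac bc dd)
  next
    case 3
    have "br x y = 0" if xy: "x \<in> h" "y \<in> h" for x y
    proof -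
      obtain x1 x2 x3 x4 where "x = x1 *\<^sub>R a + x2 *\<^sub>R b + x3 *\<^sub>R c + x4 *\<^sub>R d"
        using frame4_expand[OF F xy(1)] .
      moreover obtain y1 y2 y3 y4 where "y = y1 *\<^sub>R a + y2 *\<^sub>R b + y3 *\<^sub>R c + y4 *\<^sub>R d"
        using frame4_expand[OF F xy(2)] .
      ultimately show ?thesis using 3 by (simp add: br_simps br_self skew ab ac bc dd)
    qed
    then show ?thesis by (simp add: lie_abelian_on_def)
  next
    case 4
    have "frame4 h a b (\<alpha> *\<^sub>R c + \<beta> *\<^sub>R d) d"
    proof (rule frame4I_coeffs[OF h_subspace dimh])
      fix u v s t assume "u *\<^sub>R a + v *\<^sub>R b + s *\<^sub>R (\<alpha> *\<^sub>R c + \<beta> *\<^sub>R d) + t *\<^sub>R d = 0"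
      then have "u *\<^sub>R a + v *\<^sub>R b + (s * \<alpha>) *\<^sub>R c + (s * \<beta> + t) *\<^sub>R d = 0" by (simp add: algebra_simps)
      from frame4_coeffs[OF F this] 4 show "u = 0 \<and> v = 0 \<and> s = 0 \<and> t = 0" by auto
    qed (use frame4_mem[OF F] h_closed in auto)
    then have "heisenberg_frame a b (\<alpha> *\<^sub>R c + \<beta> *\<^sub>R d) d"
      using 4 by (simp add: heisenberg_frame_def br_simps br_self ab ac bc dd)
    then show ?thesis by blast
  next
    case 5
    have "frame4 h a b (\<beta> *\<^sub>R d) c"
    proof (rule frame4I_coeffs[OF h_subspace dimh])
      fix u v s t assume "u *\<^sub>R a + v *\<^sub>R b + s *\<^sub>R \<beta> *\<^sub>R d + t *\<^sub>R c = 0"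
      then have "u *\<^sub>R a + v *\<^sub>R b + t *\<^sub>R c + (s * \<beta>) *\<^sub>R d = 0" by (simp add: algebra_simps)
      from frame4_coeffs[OF F this] 5 show "u = 0 \<and> v = 0 \<and> s = 0 \<and> t = 0" by auto
    qed (use frame4_mem[OF F] h_closed in auto)
    then have "heisenberg_frame a b (\<beta> *\<^sub>R d) c"
      using 5 by (simp add: heisenberg_frame_def br_simps br_self skew ab ac bc dd)
    then show ?thesis by blast
  qed
qed

text \<open>
  A derivation is determined by its values on \<open>p\<close> and \<open>q\<close>, and \<open>[q,r] = 0\<close> forces \<open>[x,q]\<close> to have no component along \<open>p\<close>.
  The diagonal entries \<open>a\<close>, \<open>d\<close>, \<open>a + d\<close>, \<open>2a + d\<close> then add up to zero.
\<close>

lemma filiform_action: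
  assumes "filiform_frame p q r s"
  obtains a b d p3 p4 q3 q4 t where
    "br x p = a *\<^sub>R p + b *\<^sub>R q + p3 *\<^sub>R r + p4 *\<^sub>R s" "br x q = d *\<^sub>R q + q3 *\<^sub>R r + q4 *\<^sub>R s"
    "br x r = (a + d) *\<^sub>R r + t *\<^sub>R s" "br x s = (2 * a + d) *\<^sub>R s" "4 * a + 3 * d = 0"
proof -
  have F: "frame4 h p q r s" and rel: "br p q = r" "br p r = s" "br q r = 0" "br p s = 0" "br q s = 0"
    "br r s = 0" using assms by (auto simp: filiform_frame_def)
  have skew: "br q p = - r" "br r p = - s" "br r q = 0" "br s p = 0" "br s q = 0" "br s r = 0"
    using rel br_skew[of q p] br_skew[of r p] br_skew[of r q] br_skew[of s p] br_skew[of s q]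
      br_skew[of s r] by auto
  obtain a b p3 p4 where p: "br x p = a *\<^sub>R p + b *\<^sub>R q + p3 *\<^sub>R r + p4 *\<^sub>R s"
    using frame4_expand[OF F br_in_h] .
  obtain c d q3 q4 where q: "br x q = c *\<^sub>R p + d *\<^sub>R q + q3 *\<^sub>R r + q4 *\<^sub>R s"
    using frame4_expand[OF F br_in_h] .
  have r: "br x r = (a + d) *\<^sub>R r + (q3 - p3 * 0) *\<^sub>R s"
    using jacobi[of x p q] by (simp add: rel p q skew br_simps br_self algebra_simps)
  have "0 = c *\<^sub>R s"
    using jacobi[of x q r] by (simp add: rel p q r skew br_simps br_self algebra_simps)
  then have c: "c = 0" using frame4_notin_span(1)[OF F] by simp
  have s: "br x s = (2 * a + d) *\<^sub>R s"
    using jacobi[of x p r] by (simp add: rel p q r skew br_simps br_self algebra_simps)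
      (simp flip: scaleR_add_left)
  have "a + d + (a + d) + (2 * a + d) = 0"
    by (rule trace_ad_h[OF F, of x a b p3 p4 0 d q3 q4 0 0 "a + d" "q3 - p3 * 0" 0 0 0 "2 * a + d"])
      (simp_all add: p q r s c)
  then show ?thesis using that[OF p, of d q3 q4 "q3 - p3 * 0"] q r s c by simp
qed

text \<open>
  By \<open>4a + 3d = 0\<close> the single condition \<open>a = 0\<close> makes all weights vanish. It is linear on the two-dimensional \<open>\<gg>/h\<close>, so
  some \<open>x \<notin> h\<close> satisfies it and acts nilpotently.
\<close>

lemma nilradical_not_filiform: "\<not> filiform_frame p q r s"
proof
  assume fil: "filiform_frame p q r s"
  then have F: "frame4 h p q r s" by (simp add: filiform_frame_def)
  obtain x y where T: "transversal h x y" using transversal_exists[OF h_subspace dimh dimU] .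
  obtain a b d p3 p4 q3 q4 t where x: "br x p = a *\<^sub>R p + b *\<^sub>R q + p3 *\<^sub>R r + p4 *\<^sub>R s"
    "br x q = d *\<^sub>R q + q3 *\<^sub>R r + q4 *\<^sub>R s" "br x r = (a + d) *\<^sub>R r + t *\<^sub>R s" "br x s = (2 * a + d) *\<^sub>R s"
    "4 * a + 3 * d = 0"
    using filiform_action[OF fil, of x] .
  obtain a' b' d' p3' p4' q3' q4' t' where y: "br y p = a' *\<^sub>R p + b' *\<^sub>R q + p3' *\<^sub>R r + p4' *\<^sub>R s"
    "br y q = d' *\<^sub>R q + q3' *\<^sub>R r + q4' *\<^sub>R s" "br y r = (a' + d') *\<^sub>R r + t' *\<^sub>R s"
    "br y s = (2 * a' + d') *\<^sub>R s" "4 * a' + 3 * d' = 0"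
    using filiform_action[OF fil, of y] .
  have dd: "d = - 4 / 3 * a" "d' = - 4 / 3 * a'" using x(5) y(5) by auto
  obtain \<xi> \<eta> where ne: "(\<xi>, \<eta>) \<noteq> (0, 0)" and 0: "\<xi> * a + \<eta> * a' = 0"
    using parallel_coefficients[of a 0 a' 0 0 0] by auto
  have "\<xi> * d + \<eta> * d' = - 4 / 3 * (\<xi> * a + \<eta> * a')" by (simp add: dd algebra_simps)
  then have e0: "\<xi> * d + \<eta> * d' = 0" using 0 by simp
  let ?v = "\<xi> *\<^sub>R x + \<eta> *\<^sub>R y"
  have "?v \<in> h"
  proof (rule ad_triangular_in_h[OF F])
    have "br ?v p = (\<xi> * a + \<eta> * a') *\<^sub>R p + (\<xi> * b + \<eta> * b') *\<^sub>R q + (\<xi> * p3 + \<eta> * p3') *\<^sub>R r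
        + (\<xi> * p4 + \<eta> * p4') *\<^sub>R s" by (simp add: br_simps x y algebra_simps)
    then show "br ?v p \<in> span {q, r, s}" unfolding in_span3 0 by auto
    have "br ?v q = (\<xi> * d + \<eta> * d') *\<^sub>R q + (\<xi> * q3 + \<eta> * q3') *\<^sub>R r + (\<xi> * q4 + \<eta> * q4') *\<^sub>R s"
      by (simp add: br_simps x y algebra_simps)
    then show "br ?v q \<in> span {r, s}" unfolding in_span2 e0 by auto
    have "br ?v r = ((\<xi> * a + \<eta> * a') + (\<xi> * d + \<eta> * d')) *\<^sub>R r + (\<xi> * t + \<eta> * t') *\<^sub>R s"
      by (simp add: br_simps x y algebra_simps)
    then show "br ?v r \<in> span {s}" unfolding span_singleton 0 e0 by auto
    have "br ?v s = (2 * (\<xi> * a + \<eta> * a') + (\<xi> * d + \<eta> * d')) *\<^sub>R s"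
      by (simp add: br_simps x y algebra_simps)
    then show "br ?v s = 0" unfolding 0 e0 by simp
  qed
  with transversal_combination[OF h_subspace T ne] show False by simp
qed

text \<open>
  The derivation property makes the weight of \<open>z = [p,q]\<close> equal to the trace on \<open>p, q\<close>, and keeps \<open>w\<close> in the centre; the
  coefficient of \<open>w\<close> in \<open>[x,w]\<close> is then what tracelessness on \<open>h\<close> leaves.
\<close>

lemma heisenberg_action:
  assumes "heisenberg_frame p q z w"
  obtains \<alpha> \<beta> \<gamma> \<delta> p3 p4 q3 q4 t where
    "br x p = \<alpha> *\<^sub>R p + \<beta> *\<^sub>R q + p3 *\<^sub>R z + p4 *\<^sub>R w"
    "br x q = \<gamma> *\<^sub>R p + \<delta> *\<^sub>R q + q3 *\<^sub>R z + q4 *\<^sub>R w"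
    "br x z = (\<alpha> + \<delta>) *\<^sub>R z" "br x w = t *\<^sub>R z + (- 2 * (\<alpha> + \<delta>)) *\<^sub>R w"
proof -
  have F: "frame4 h p q z w" and rel: "br p q = z" "br p z = 0" "br q z = 0" "br p w = 0" "br q w = 0"
    "br z w = 0" using assms by (auto simp: heisenberg_frame_def)
  have skew: "br q p = - z" "br z p = 0" "br z q = 0" "br w p = 0" "br w q = 0" "br w z = 0"
    using rel br_skew[of q p] br_skew[of z p] br_skew[of z q] br_skew[of w p] br_skew[of w q]
      br_skew[of w z] by auto
  obtain \<alpha> \<beta> p3 p4 where p: "br x p = \<alpha> *\<^sub>R p + \<beta> *\<^sub>R q + p3 *\<^sub>R z + p4 *\<^sub>R w"
    using frame4_expand[OF F br_in_h] .
  obtain \<gamma> \<delta> q3 q4 where q: "br x q = \<gamma> *\<^sub>R p + \<delta> *\<^sub>R q + q3 *\<^sub>R z + q4 *\<^sub>R w"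
    using frame4_expand[OF F br_in_h] .
  obtain w1 w2 w3 w4 where w: "br x w = w1 *\<^sub>R p + w2 *\<^sub>R q + w3 *\<^sub>R z + w4 *\<^sub>R w"
    using frame4_expand[OF F br_in_h] .
  have z0: "z \<noteq> 0" using frame4_coeffs[OF F, of 0 0 1 0] by auto
  have z: "br x z = (\<alpha> + \<delta>) *\<^sub>R z"
    using jacobi[of x p q] by (simp add: rel p q skew br_simps br_self algebra_simps)
  have "w2 *\<^sub>R z = 0"
    using jacobi[of x p w] by (simp add: rel p q w skew br_simps br_self)
  moreover have "w1 *\<^sub>R z = 0"
    using jacobi[of x q w] by (simp add: rel p q w skew br_simps br_self)
  ultimately have w12: "w1 = 0" "w2 = 0" using z0 by auto
  have "\<alpha> + \<delta> + (\<alpha> + \<delta>) + w4 = 0"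
    by (rule trace_ad_h[OF F, of x \<alpha> \<beta> p3 p4 \<gamma> \<delta> q3 q4 0 0 "\<alpha> + \<delta>" 0 0 0 w3 w4])
      (simp_all add: p q z w w12)
  then have "w4 = - 2 * (\<alpha> + \<delta>)" by simp
  then show ?thesis using that[OF p q z, of w3] w w12 by simp
qed

text \<open>
  If \<open>\<gg>\<close> centralised \<open>z\<close>, it would act on \<open>h\<close> modulo its centre by traceless \<open>2\<times>2\<close> matrices, which commute because
  \<open>[\<gg>,\<gg>] \<subseteq> h\<close> acts trivially there. Commuting traceless matrices are proportional, so some element outside \<open>h\<close>
  would act by zero on this quotient and nilpotently on \<open>h\<close>.
\<close>

lemma heisenberg_center_weight:
  assumes H: "heisenberg_frame p q z w"
  shows "\<exists>x. br x z \<noteq> 0"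
proof (rule ccontr)
  assume "\<not> ?thesis"
  then have z: "br x z = 0" for x by simp
  have F: "frame4 h p q z w" and rel: "br p q = z" "br p z = 0" "br q z = 0" "br p w = 0" "br q w = 0"
    "br z w = 0" using H by (auto simp: heisenberg_frame_def)
  have skew: "br q p = - z" "br z p = 0" "br z q = 0" "br w p = 0" "br w q = 0" "br w z = 0"
    using rel br_skew[of q p] br_skew[of z p] br_skew[of z q] br_skew[of w p] br_skew[of w q]
      br_skew[of w z] by auto
  have z0: "z \<noteq> 0" using frame4_coeffs[OF F, of 0 0 1 0] by auto
  obtain x y where T: "transversal h x y" using transversal_exists[OF h_subspace dimh dimU] .
  obtain \<alpha> \<beta> \<gamma> \<delta> p3 p4 q3 q4 t where x:
    "br x p = \<alpha> *\<^sub>R p + \<beta> *\<^sub>R q + p3 *\<^sub>R z + p4 *\<^sub>R w"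
    "br x q = \<gamma> *\<^sub>R p + \<delta> *\<^sub>R q + q3 *\<^sub>R z + q4 *\<^sub>R w"
    "br x z = (\<alpha> + \<delta>) *\<^sub>R z" "br x w = t *\<^sub>R z + (- 2 * (\<alpha> + \<delta>)) *\<^sub>R w"
    using heisenberg_action[OF H, of x] .
  obtain \<alpha>' \<beta>' \<gamma>' \<delta>' p3' p4' q3' q4' t' where y:
    "br y p = \<alpha>' *\<^sub>R p + \<beta>' *\<^sub>R q + p3' *\<^sub>R z + p4' *\<^sub>R w"
    "br y q = \<gamma>' *\<^sub>R p + \<delta>' *\<^sub>R q + q3' *\<^sub>R z + q4' *\<^sub>R w"
    "br y z = (\<alpha>' + \<delta>') *\<^sub>R z" "br y w = t' *\<^sub>R z + (- 2 * (\<alpha>' + \<delta>')) *\<^sub>R w"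
    using heisenberg_action[OF H, of y] .
  have tr: "\<delta> = - \<alpha>" "\<delta>' = - \<alpha>'" using x(3) y(3) z[of x] z[of y] z0 by (auto simp: add_eq_0_iff)
  obtain c1 c2 c3 c4 where xy: "br x y = c1 *\<^sub>R p + c2 *\<^sub>R q + c3 *\<^sub>R z + c4 *\<^sub>R w"
    using frame4_expand[OF F br_in_h] .
  have "(\<beta>' * \<gamma> - \<beta> * \<gamma>') *\<^sub>R p + ((\<alpha>' * \<beta> - \<alpha> * \<beta>') *\<^sub>R q + (\<alpha>' * \<beta> - \<alpha> * \<beta>') *\<^sub>R q)
      + (\<alpha>' * p3 + \<beta>' * q3 + p4' * t - \<alpha> * p3' - \<beta> * q3' - p4 * t' + c2) *\<^sub>R z
      + (\<alpha>' * p4 + \<beta>' * q4 - \<alpha> * p4' - \<beta> * q4') *\<^sub>R w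
      = br x (br y p) - br (br x y) p - br y (br x p)"
    by (simp add: x y xy skew rel tr z br_simps br_self algebra_simps)
  also have "\<dots> = 0" by (simp add: jacobi[of x y p])
  finally have 1: "\<beta>' * \<gamma> = \<beta> * \<gamma>'" "\<alpha>' * \<beta> = \<alpha> * \<beta>'"
    unfolding scaleR_add_left[symmetric] using frame4_coeffs[OF F] by fastforce+
  have "((\<alpha> * \<gamma>' - \<alpha>' * \<gamma>) *\<^sub>R p + (\<alpha> * \<gamma>' - \<alpha>' * \<gamma>) *\<^sub>R p) + (\<gamma>' * \<beta> - \<gamma> * \<beta>') *\<^sub>R q
      + (\<gamma>' * p3 - \<alpha>' * q3 + q4' * t - \<gamma> * p3' + \<alpha> * q3' - q4 * t' - c1) *\<^sub>R z
      + (\<gamma>' * p4 - \<alpha>' * q4 - \<gamma> * p4' + \<alpha> * q4') *\<^sub>R w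
      = br x (br y q) - br (br x y) q - br y (br x q)"
    by (simp add: x y xy skew rel tr z br_simps br_self algebra_simps)
  also have "\<dots> = 0" by (simp add: jacobi[of x y q])
  finally have 2: "\<alpha> * \<gamma>' = \<alpha>' * \<gamma>"
    unfolding scaleR_add_left[symmetric] using frame4_coeffs[OF F] by fastforce
  obtain \<xi> \<eta> where ne: "(\<xi>, \<eta>) \<noteq> (0, 0)" and 0: "\<xi> * \<alpha> + \<eta> * \<alpha>' = 0" "\<xi> * \<beta> + \<eta> * \<beta>' = 0"
    "\<xi> * \<gamma> + \<eta> * \<gamma>' = 0"
    by (rule parallel_coefficients[of \<alpha> \<beta>' \<alpha>' \<beta> \<gamma>' \<gamma>]) (use 1 2 in \<open>auto simp: mult.commute\<close>)
  let ?v = "\<xi> *\<^sub>R x + \<eta> *\<^sub>R y"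
  have "?v \<in> h"
  proof (rule ad_nilpotent4_in_h)
    fix u assume "u \<in> h"
    then obtain a b c d where u: "u = a *\<^sub>R p + b *\<^sub>R q + c *\<^sub>R z + d *\<^sub>R w"
      using frame4_expand[OF F] by metis
    have "br ?v p = (\<xi> * \<alpha> + \<eta> * \<alpha>') *\<^sub>R p + (\<xi> * \<beta> + \<eta> * \<beta>') *\<^sub>R q + (\<xi> * p3 + \<eta> * p3') *\<^sub>R z
        + (\<xi> * p4 + \<eta> * p4') *\<^sub>R w" by (simp add: br_simps x y algebra_simps)
    then have vp: "br ?v p = (\<xi> * p3 + \<eta> * p3') *\<^sub>R z + (\<xi> * p4 + \<eta> * p4') *\<^sub>R w" unfolding 0 by simp
    have "br ?v q = (\<xi> * \<gamma> + \<eta> * \<gamma>') *\<^sub>R p - (\<xi> * \<alpha> + \<eta> * \<alpha>') *\<^sub>R q + (\<xi> * q3 + \<eta> * q3') *\<^sub>R z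
        + (\<xi> * q4 + \<eta> * q4') *\<^sub>R w" by (simp add: br_simps x y tr algebra_simps)
    then have vq: "br ?v q = (\<xi> * q3 + \<eta> * q3') *\<^sub>R z + (\<xi> * q4 + \<eta> * q4') *\<^sub>R w" unfolding 0 by simp
    have vw: "br ?v w = (\<xi> * t + \<eta> * t') *\<^sub>R z" by (simp add: br_simps x y tr algebra_simps)
    have vz: "br ?v z = 0" by (rule z)
    have lin: "br ?v (s + s') = br ?v s + br ?v s'" "br ?v (k *\<^sub>R s) = k *\<^sub>R br ?v s" "br ?v 0 = 0" for s s' k
      by (rule br_simps)+
    show "br ?v (br ?v (br ?v (br ?v u))) = 0"
      unfolding u by (simp only: lin vp vq vz vw scaleR_zero_right add_0_right add_0_left)
  qed
  with transversal_combination[OF h_subspace T ne] show False by simp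
qed

end

section \<open>The Bismut torsion and the position of the nilradical\<close>

locale skt_codim2 = unimodular_codim2 br h
  for br :: "'a::real_vector \<Rightarrow> 'a \<Rightarrow> 'a" and h :: "'a set" +
  fixes J :: "'a \<Rightarrow> 'a" and g :: "'a \<Rightarrow> 'a \<Rightarrow> real"
  assumes skt: "skt_structure br J g"
begin

lemma linear_J: "linear J"
  using skt by (simp add: skt_structure_def hermitian_structure_def complex_structure_def)

lemmas J_simps = linear_add[OF linear_J] linear_scale[OF linear_J] linear_neg[OF linear_J]
  linear_diff[OF linear_J] linear_0[OF linear_J]

lemma JJ: "J (J x) = - x"
  using skt by (simp add: skt_structure_def hermitian_structure_def complex_structure_def)

lemma integrable: "br (J x) (J y) = br x y + J (br (J x) y + br x (J y))"
proof -
  have "br x y + J (br (J x) y + br x (J y)) - br (J x) (J y) = 0"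
    using skt by (simp add: skt_structure_def hermitian_structure_def complex_structure_def)
  then show ?thesis by simp
qed

lemma bilinear_g: "bilinear g"
  using skt by (simp add: skt_structure_def hermitian_structure_def inner_product_def)

lemmas g_simps = bilinear_ladd[OF bilinear_g] bilinear_radd[OF bilinear_g]
  bilinear_lmul[OF bilinear_g] bilinear_rmul[OF bilinear_g]
  bilinear_lneg[OF bilinear_g] bilinear_rneg[OF bilinear_g]
  bilinear_lzero[OF bilinear_g] bilinear_rzero[OF bilinear_g]
  bilinear_lsub[OF bilinear_g] bilinear_rsub[OF bilinear_g]

lemma g_sym: "g x y = g y x"
  using skt by (simp add: skt_structure_def hermitian_structure_def inner_product_def)

lemma g_pos: "x \<noteq> 0 \<Longrightarrow> g x x > 0"
  using skt by (simp add: skt_structure_def hermitian_structure_def inner_product_def)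

lemma g_JJ: "g (J x) (J y) = g x y"
  using skt by (simp add: skt_structure_def hermitian_structure_def)

lemma g_J_self: "g x (J x) = 0" "g (J x) x = 0"
proof -
  have "g (J x) (J (J x)) = g x (J x)" by (rule g_JJ)
  then show "g x (J x) = 0" using g_sym[of "J x" x] by (simp add: JJ g_simps)
  then show "g (J x) x = 0" using g_sym[of "J x" x] by simp
qed

abbreviation torsion :: "'a \<Rightarrow> 'a \<Rightarrow> 'a \<Rightarrow> real" where
  "torsion \<equiv> bismut_torsion br J g"

lemma torsion_eq:
  "torsion x y z = - g (br (J x) (J y)) z - g (br (J y) (J z)) x - g (br (J z) (J x)) y"
  by (simp add: bismut_torsion_def ce_d2_def fundamental_form_def g_JJ br_skew[of "J z" "J x"] g_simps)

lemma torsion_simps: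
  "torsion (x + x') y z = torsion x y z + torsion x' y z"
  "torsion x (y + y') z = torsion x y z + torsion x y' z"
  "torsion x y (z + z') = torsion x y z + torsion x y z'"
  "torsion (a *\<^sub>R x) y z = a * torsion x y z" "torsion x (a *\<^sub>R y) z = a * torsion x y z"
  "torsion x y (a *\<^sub>R z) = a * torsion x y z"
  "torsion (- x) y z = - torsion x y z" "torsion x (- y) z = - torsion x y z"
  "torsion x y (- z) = - torsion x y z"
  "torsion (x - x') y z = torsion x y z - torsion x' y z"
  "torsion x (y - y') z = torsion x y z - torsion x y' z"
  "torsion x y (z - z') = torsion x y z - torsion x y z'"
  "torsion 0 y z = 0" "torsion x 0 z = 0" "torsion x y 0 = 0"
  by (simp_all add: torsion_eq J_simps br_simps g_simps algebra_simps)

lemma torsion_alternating: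
  "torsion y x z = - torsion x y z" "torsion x z y = - torsion x y z" "torsion z y x = - torsion x y z"
  "torsion x x z = 0" "torsion x z x = 0" "torsion z x x = 0"
  by (simp_all add: torsion_eq br_self g_simps br_skew[of "J y" "J x"] br_skew[of "J z" "J x"]
      br_skew[of "J z" "J y"])

lemma torsion_closed:
  "- torsion (br x y) z w + torsion (br x z) y w - torsion (br x w) y z
   - torsion (br y z) x w + torsion (br y w) x z - torsion (br z w) x y = 0"
  using skt by (simp add: skt_structure_def ce_d3_def)

lemma torsion_J_line:
  "torsion e (J e) v = - g (br e (J e)) v - g (br (J v) e) e - g (br (J v) (J e)) (J e)"
  using br_skew[of "J e" e] br_skew[of e "J v"] br_skew[of "J e" "J v"]
  by (simp add: torsion_eq JJ br_simps g_simps)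

text \<open>
  In all cases in which \<open>h\<close> is not a complex subspace, the SKT condition enters only through its value on
  \<open>e, Je, x, Jy\<close>, where the line of \<open>e\<close> and \<open>Je\<close> lies in \<open>h\<close> and is preserved by \<open>ad (Jy)\<close>.
\<close>

lemma torsion_closed_J_line:
  assumes x: "br e x = 0" "br (J e) x = \<epsilon> *\<^sub>R e"
    and y: "br (J y) e = a *\<^sub>R e + b *\<^sub>R J e" "br (J y) (J e) = a' *\<^sub>R J e - b *\<^sub>R e"
  shows "(a + a') * torsion e (J e) x + torsion e (J e) (br (J y) x) = torsion (br e (J e)) x (J y)"
proof -
  have sk: "br e (J y) = - (a *\<^sub>R e + b *\<^sub>R J e)" "br (J e) (J y) = - (a' *\<^sub>R J e - b *\<^sub>R e)"
    "br x (J y) = - br (J y) x"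
    using br_skew[of e "J y"] br_skew[of "J e" "J y"] br_skew[of x "J y"] by (simp_all only: y)
  have cyc: "torsion (br (J y) x) e (J e) = torsion e (J e) (br (J y) x)"
    using torsion_alternating(1)[of e "br (J y) x" "J e"] torsion_alternating(2)[of e "br (J y) x" "J e"]
    by simp
  have al: "torsion (J e) e v = - torsion e (J e) v" for v by (rule torsion_alternating(1))
  show ?thesis
    using torsion_closed[of e "J e" x "J y"]
    unfolding x sk torsion_simps torsion_alternating(4-6) cyc al by (simp add: algebra_simps)
qed

lemma J_line_independent:
  assumes e: "e \<noteq> 0" and eq: "\<alpha> *\<^sub>R e + \<beta> *\<^sub>R J e = 0"
  shows "\<alpha> = 0 \<and> \<beta> = 0"
proof -
  have "g (\<alpha> *\<^sub>R e + \<beta> *\<^sub>R J e) e = 0" "g (\<alpha> *\<^sub>R e + \<beta> *\<^sub>R J e) (J e) = 0"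
    unfolding eq by (simp_all add: g_simps)
  then show ?thesis using g_pos[OF e] by (simp add: g_simps g_J_self g_JJ)
qed

text \<open>
  Multiplying \<open>\<alpha>f + \<beta>Jf\<close> by the complex number \<open>\<alpha> - \<beta>J\<close> turns it into \<open>(\<alpha>\<^sup>2 + \<beta>\<^sup>2)f\<close> and preserves the \<open>J\<close>-line of \<open>e\<close>.
\<close>

lemma J_pair_independent:
  assumes e: "e \<noteq> 0" and f: "f \<notin> span {e, J e}"
    and eq: "\<alpha> *\<^sub>R f + \<beta> *\<^sub>R J f + \<gamma> *\<^sub>R e + \<delta> *\<^sub>R J e = 0"
  shows "\<alpha> = 0 \<and> \<beta> = 0 \<and> \<gamma> = 0 \<and> \<delta> = 0"
proof -
  have "\<alpha> *\<^sub>R (\<alpha> *\<^sub>R f + \<beta> *\<^sub>R J f + \<gamma> *\<^sub>R e + \<delta> *\<^sub>R J e)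
      - \<beta> *\<^sub>R J (\<alpha> *\<^sub>R f + \<beta> *\<^sub>R J f + \<gamma> *\<^sub>R e + \<delta> *\<^sub>R J e) = 0"
    unfolding eq by (simp add: J_simps)
  then have "(\<alpha>\<^sup>2 + \<beta>\<^sup>2) *\<^sub>R f + ((\<alpha> * \<gamma> + \<beta> * \<delta>) *\<^sub>R e + (\<alpha> * \<delta> - \<beta> * \<gamma>) *\<^sub>R J e) = 0"
    by (simp add: J_simps JJ power2_eq_square algebra_simps)
  then have "\<alpha>\<^sup>2 + \<beta>\<^sup>2 = 0"
    by (intro subspace_coeff_zero[OF subspace_span f,
          where y = "(\<alpha> * \<gamma> + \<beta> * \<delta>) *\<^sub>R e + (\<alpha> * \<delta> - \<beta> * \<gamma>) *\<^sub>R J e"])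
      (simp_all add: span_zero, auto simp: in_span2)
  then have "\<alpha> = 0" "\<beta> = 0" by auto
  with J_line_independent[OF e, of \<gamma> \<delta>] eq show ?thesis by simp
qed

text \<open>
  The component of \<open>J\<close> along \<open>\<gg>/h\<close> maps the four-dimensional \<open>h\<close> to a plane, so it has a kernel. Three basis vectors
  already suffice, and the cross product of the two rows of coordinates gives a kernel element unless these rows are
  proportional.
\<close>

lemma exists_J_line: obtains e where "e \<noteq> 0" "e \<in> h" "J e \<in> h"
proof -
  obtain u v where T: "transversal h u v" using transversal_exists[OF h_subspace dimh dimU] .
  obtain a b c d where F: "frame4 h a b c d" using frame4_exists[OF h_subspace dimh] .
  note ex = transversal_expand[OF h_subspace dimh dimU T]
  obtain a1 a2 a3 where a: "a3 \<in> h" "J a = a1 *\<^sub>R u + a2 *\<^sub>R v + a3" by (rule ex)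
  obtain b1 b2 b3 where b: "b3 \<in> h" "J b = b1 *\<^sub>R u + b2 *\<^sub>R v + b3" by (rule ex)
  obtain c1 c2 c3 where c: "c3 \<in> h" "J c = c1 *\<^sub>R u + c2 *\<^sub>R v + c3" by (rule ex)
  obtain k l m where klm: "(k, l, m) \<noteq> (0, 0, 0)" "k * a1 + l * b1 + m * c1 = 0"
    "k * a2 + l * b2 + m * c2 = 0"
  proof (cases "b1 * c2 = c1 * b2 \<and> c1 * a2 = a1 * c2 \<and> a1 * b2 = b1 * a2")
    case False
    then show ?thesis
      using that[of "b1 * c2 - c1 * b2" "c1 * a2 - a1 * c2" "a1 * b2 - b1 * a2"]
      by (auto simp: algebra_simps)
  next
    case True
    consider "a1 \<noteq> 0 \<or> b1 \<noteq> 0" | "a2 \<noteq> 0 \<or> b2 \<noteq> 0" | "a1 = 0" "b1 = 0" "a2 = 0" "b2 = 0" by blast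
    then show ?thesis
    proof cases
      case 1 then show ?thesis using that[of b1 "- a1" 0] True by (auto simp: algebra_simps)
    next
      case 2 then show ?thesis using that[of b2 "- a2" 0] True by (auto simp: algebra_simps)
    next
      case 3 then show ?thesis using that[of 1 0 0] by auto
    qed
  qed
  let ?e = "k *\<^sub>R a + l *\<^sub>R b + m *\<^sub>R c"
  have "?e \<noteq> 0" using frame4_coeffs[OF F, of k l m 0] klm(1) by auto
  moreover have "?e \<in> h" using frame4_mem[OF F] h_closed by simp
  moreover have "J ?e = (k * a1 + l * b1 + m * c1) *\<^sub>R u + (k * a2 + l * b2 + m * c2) *\<^sub>R v
      + (k *\<^sub>R a3 + l *\<^sub>R b3 + m *\<^sub>R c3)"
    by (simp add: J_simps a b c algebra_simps)
  then have "J ?e = k *\<^sub>R a3 + l *\<^sub>R b3 + m *\<^sub>R c3" unfolding klm by simp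
  then have "J ?e \<in> h" using a(1) b(1) c(1) h_closed by simp
  ultimately show ?thesis by (rule that)
qed

text \<open>
  Two different \<open>J\<close>-lines would span \<open>h\<close>, and \<open>h\<close> would be a complex subspace.
\<close>

lemma J_line_unique:
  assumes e: "e \<noteq> 0" "e \<in> h" "J e \<in> h" and f: "f \<in> h" "J f \<in> h" and x: "x \<in> h" "J x \<notin> h"
  shows "f \<in> span {e, J e}"
proof (rule ccontr)
  assume n: "f \<notin> span {e, J e}"
  have "frame4 h f (J f) e (J e)"
    by (rule frame4I_coeffs[OF h_subspace dimh]) (use e f J_pair_independent[OF e(1) n] in auto)
  then obtain \<alpha> \<beta> \<gamma> \<delta> where "x = \<alpha> *\<^sub>R f + \<beta> *\<^sub>R J f + \<gamma> *\<^sub>R e + \<delta> *\<^sub>R J e"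
    using frame4_expand x(1) by metis
  then have "J x = \<alpha> *\<^sub>R J f - \<beta> *\<^sub>R f + \<gamma> *\<^sub>R J e - \<delta> *\<^sub>R e" by (simp add: J_simps JJ)
  also have "\<dots> \<in> h" using e f by (intro h_closed)
  finally show False using x(2) by simp
qed

section \<open>The nilradical is abelian\<close>

lemma heisenberg_bracket:
  assumes H: "heisenberg_frame p q z w" and x: "x \<in> h" and y: "y \<in> h"
  obtains \<beta> where "br x y = \<beta> *\<^sub>R z"
proof -
  have F: "frame4 h p q z w" and rel: "br p q = z" "br p z = 0" "br q z = 0" "br p w = 0" "br q w = 0"
    "br z w = 0" using H by (auto simp: heisenberg_frame_def)
  have skew: "br q p = - z" "br z p = 0" "br z q = 0" "br w p = 0" "br w q = 0" "br w z = 0"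
    using rel br_skew[of q p] br_skew[of z p] br_skew[of z q] br_skew[of w p] br_skew[of w q]
      br_skew[of w z] by auto
  obtain x1 x2 x3 x4 where "x = x1 *\<^sub>R p + x2 *\<^sub>R q + x3 *\<^sub>R z + x4 *\<^sub>R w"
    using frame4_expand[OF F x] .
  moreover obtain y1 y2 y3 y4 where "y = y1 *\<^sub>R p + y2 *\<^sub>R q + y3 *\<^sub>R z + y4 *\<^sub>R w"
    using frame4_expand[OF F y] .
  ultimately have "br x y = (x1 * y2 - x2 * y1) *\<^sub>R z"
    by (simp add: br_simps br_self skew rel algebra_simps)
  then show ?thesis by (rule that)
qed

lemma heisenberg_central:
  assumes H: "heisenberg_frame p q z w" and t: "t \<in> span {z, w}" and x: "x \<in> h"
  shows "br t x = 0" "br x t = 0" "t \<in> h"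
proof -
  have F: "frame4 h p q z w" and rel: "br p q = z" "br p z = 0" "br q z = 0" "br p w = 0" "br q w = 0"
    "br z w = 0" using H by (auto simp: heisenberg_frame_def)
  have skew: "br w z = 0" using rel br_skew[of w z] by auto
  obtain x1 x2 x3 x4 where "x = x1 *\<^sub>R p + x2 *\<^sub>R q + x3 *\<^sub>R z + x4 *\<^sub>R w"
    using frame4_expand[OF F x] .
  moreover obtain a b where ab: "t = a *\<^sub>R z + b *\<^sub>R w" using t by (auto simp: in_span2)
  ultimately show "br x t = 0" by (simp add: br_simps br_self rel skew)
  then show "br t x = 0" using br_skew[of t x] by simp
  show "t \<in> h" using frame4_mem[OF F] h_closed by (simp add: ab)
qed

lemma heisenberg_centralizer:
  assumes H: "heisenberg_frame p q z w" and t: "t \<in> h" "br p t = 0" "br q t = 0"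
  shows "t \<in> span {z, w}"
proof -
  have F: "frame4 h p q z w" and rel: "br p q = z" "br p z = 0" "br q z = 0" "br p w = 0" "br q w = 0"
    "br z w = 0" using H by (auto simp: heisenberg_frame_def)
  have z0: "z \<noteq> 0" using frame4_coeffs[OF F, of 0 0 1 0] by auto
  obtain a b c d where "t = a *\<^sub>R p + b *\<^sub>R q + c *\<^sub>R z + d *\<^sub>R w"
    using frame4_expand[OF F t(1)] .
  with t rel z0 br_skew[of q p] show ?thesis by (auto simp: br_simps br_self in_span2)
qed

lemma heisenberg_frame_change_w:
  assumes H: "heisenberg_frame p q z w" and w': "w' \<in> span {z, w}" "w' \<notin> span {z}"
  shows "heisenberg_frame p q z w'"
proof -
  have F: "frame4 h p q z w" using H by (auto simp: heisenberg_frame_def)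
  obtain a b where ab: "w' = a *\<^sub>R z + b *\<^sub>R w" using w'(1) by (auto simp: in_span2)
  have b: "b \<noteq> 0" using w'(2) ab by (auto simp: span_singleton)
  have "frame4 h p q z w'"
  proof (rule frame4I_coeffs[OF h_subspace dimh])
    fix j k l m assume "j *\<^sub>R p + k *\<^sub>R q + l *\<^sub>R z + m *\<^sub>R w' = 0"
    then have "j *\<^sub>R p + k *\<^sub>R q + (l + m * a) *\<^sub>R z + (m * b) *\<^sub>R w = 0" by (simp add: ab algebra_simps)
    from frame4_coeffs[OF F this] b show "j = 0 \<and> k = 0 \<and> l = 0 \<and> m = 0" by auto
  qed (use frame4_mem[OF F] heisenberg_central(3)[OF H w'(1)] in auto)
  then show ?thesis
    using H heisenberg_central(2)[OF H w'(1)] frame4_mem[OF F] by (simp add: heisenberg_frame_def)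
qed

lemma heisenberg_frame_change_p:
  assumes H: "heisenberg_frame p q z w" and u: "u \<in> h" "u \<notin> span {z, w}"
  obtains v where "heisenberg_frame u v z w"
proof -
  have F: "frame4 h p q z w" and rel: "br p q = z" "br p z = 0" "br q z = 0" "br p w = 0" "br q w = 0"
    "br z w = 0" using H by (auto simp: heisenberg_frame_def)
  have skew: "br q p = - z" "br z p = 0" "br z q = 0" "br w p = 0" "br w q = 0" "br w z = 0"
    using rel br_skew[of q p] br_skew[of z p] br_skew[of z q] br_skew[of w p] br_skew[of w q]
      br_skew[of w z] by auto
  obtain a b c d where t: "u = a *\<^sub>R p + b *\<^sub>R q + c *\<^sub>R z + d *\<^sub>R w"
    using frame4_expand[OF F u(1)] .
  have ab: "a \<noteq> 0 \<or> b \<noteq> 0"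
  proof (rule ccontr)
    assume "\<not> ?thesis"
    then have "u = c *\<^sub>R z + d *\<^sub>R w" using t by simp
    with u(2) show False unfolding in_span2 by blast
  qed
  obtain k l where kl: "a * l - b * k = 1"
  proof (cases "a = 0")
    case True then show ?thesis using ab that[of 0 "- 1 / b"] by simp
  next
    case False then show ?thesis using that[of "1 / a" 0] by simp
  qed
  define v where "v = k *\<^sub>R p + l *\<^sub>R q"
  have "frame4 h u v z w"
  proof (rule frame4I_coeffs[OF h_subspace dimh])
    fix i j m n assume "i *\<^sub>R u + j *\<^sub>R v + m *\<^sub>R z + n *\<^sub>R w = 0"
    then have "(i * a + j * k) *\<^sub>R p + (i * b + j * l) *\<^sub>R q
        + (m + i * c) *\<^sub>R z + (n + i * d) *\<^sub>R w = 0" by (simp add: t v_def algebra_simps)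
    from frame4_coeffs[OF F this] have 0: "i * a + j * k = 0" "i * b + j * l = 0"
      "m + i * c = 0" "n + i * d = 0" by auto
    have "i * (a * l - b * k) = l * (i * a + j * k) - k * (i * b + j * l)"
      "j * (a * l - b * k) = a * (i * b + j * l) - b * (i * a + j * k)"
      by (simp_all add: algebra_simps)
    then have "i = 0" "j = 0" using kl 0 by auto
    then show "i = 0 \<and> j = 0 \<and> m = 0 \<and> n = 0" using 0(3,4) by simp
  qed (use frame4_mem[OF F] u h_closed in \<open>auto simp: v_def\<close>)
  moreover have "br u v = (a * l - b * k) *\<^sub>R z"
    by (simp add: t v_def br_simps br_self rel skew algebra_simps)
  then have "br u v = z" using kl by simp
  ultimately have "heisenberg_frame u v z w"
    by (simp add: heisenberg_frame_def) (simp add: t v_def br_simps br_self rel skew)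
  then show ?thesis by (rule that)
qed

text \<open>
  Suppose the centre is \<open>J\<close>-invariant and write \<open>[y,z] = a(y) z\<close>, \<open>[y,Jz] = t(y) z - 2 a(y) Jz\<close>. Integrability gives
  \<open>t(y) = -3 a(Jy)\<close>, and since \<open>[y,Jy] \<in> h\<close> kills the centre, the actions of \<open>y\<close> and \<open>Jy\<close> on it commute, which reads
  \<open>a(y)\<^sup>2 + a(Jy)\<^sup>2 = 0\<close>. So \<open>\<gg>\<close> centralises \<open>z\<close>, against \<open>heisenberg_center_weight\<close>.
\<close>

lemma heisenberg_J_center:
  assumes H: "heisenberg_frame p q z w"
  shows "J z \<notin> span {z, w}"
proof
  assume Jz: "J z \<in> span {z, w}"
  have z0: "z \<noteq> 0" using H frame4_coeffs[of h p q z w 0 0 1 0] by (auto simp: heisenberg_frame_def)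
  have "J z \<notin> span {z}"
  proof
    assume "J z \<in> span {z}"
    then obtain k where "J z = k *\<^sub>R z" by (auto simp: span_singleton)
    with J_line_independent[OF z0, of "- k" 1] show False by simp
  qed
  with H Jz have H': "heisenberg_frame p q z (J z)" by (rule heisenberg_frame_change_w)
  have "br y z = 0" for y
  proof -
    obtain a t where y: "br y z = a *\<^sub>R z" "br y (J z) = t *\<^sub>R z + (- 2 * a) *\<^sub>R J z"
      using heisenberg_action[OF H', of y] by metis
    obtain a' t' where y': "br (J y) z = a' *\<^sub>R z" "br (J y) (J z) = t' *\<^sub>R z + (- 2 * a') *\<^sub>R J z"
      using heisenberg_action[OF H', of "J y"] by metis
    have sk: "br z y = - (a *\<^sub>R z)" "br (J z) y = - (t *\<^sub>R z + (- 2 * a) *\<^sub>R J z)"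
      "br z (J y) = - (a' *\<^sub>R z)" "br (J z) (J y) = - (t' *\<^sub>R z + (- 2 * a') *\<^sub>R J z)"
      using br_skew[of z y] br_skew[of "J z" y] br_skew[of z "J y"] br_skew[of "J z" "J y"]
      by (simp_all only: y y')
    have "(3 * a - t') *\<^sub>R z + (t + 3 * a') *\<^sub>R J z
        = br (J z) (J y) - (br z y + J (br (J z) y + br z (J y)))"
      by (simp add: sk J_simps JJ algebra_simps) (simp add: scaleR_mult_numeral algebra_simps)
    also have "\<dots> = 0" by (simp add: integrable[of z y])
    finally have tt: "t' = 3 * a" "t = - 3 * a'" using J_line_independent[OF z0] by fastforce+
    have "(3 * (a * t' - a' * t)) *\<^sub>R z = br y (br (J y) (J z)) - br (J y) (br y (J z))"
      by (simp add: y y' br_simps algebra_simps) (simp add: scaleR_mult_numeral algebra_simps)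
    also have "\<dots> = br (br y (J y)) (J z)" by (simp add: jacobi[of y "J y" "J z"])
    also have "\<dots> = 0" by (rule heisenberg_central(2)[OF H Jz br_in_h])
    finally have "9 * (a\<^sup>2 + a'\<^sup>2) = 0" using z0 by (simp add: tt power2_eq_square)
    then have "a\<^sup>2 + a'\<^sup>2 = 0" by (simp only: mult_eq_0_iff) simp
    then show ?thesis using y(1) by simp
  qed
  with heisenberg_center_weight[OF H] show False by blast
qed

text \<open>
  Otherwise \<open>[Jz,y]\<close> and \<open>[Jz,Jy] = J[Jz,y]\<close> would both be multiples of \<open>z\<close>. They would vanish, and \<open>Jz\<close> would be central.
\<close>

lemma heisenberg_not_J_invariant:
  assumes H: "heisenberg_frame p q z w"
  shows "\<exists>x\<in>h. J x \<notin> h"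
proof (rule ccontr)
  assume "\<not> ?thesis"
  then have Jh: "J x \<in> h" if "x \<in> h" for x using that by blast
  have F: "frame4 h p q z w" using H by (auto simp: heisenberg_frame_def)
  have z0: "z \<noteq> 0" using frame4_coeffs[OF F, of 0 0 1 0] by auto
  have z: "z \<in> span {z, w}" by (simp add: span_base)
  have zh: "z \<in> h" using frame4_mem[OF F] by simp
  have "br (J z) y = 0" if y: "y \<in> h" for y
  proof -
    obtain \<beta> where \<beta>: "br (J z) y = \<beta> *\<^sub>R z" using heisenberg_bracket[OF H Jh[OF zh] y] .
    obtain \<beta>' where \<beta>': "br (J z) (J y) = \<beta>' *\<^sub>R z" using heisenberg_bracket[OF H Jh[OF zh] Jh[OF y]] .
    have "br (J z) (J y) = J (br (J z) y)"
      using integrable[of z y] heisenberg_central(1)[OF H z y] heisenberg_central(1)[OF H z Jh[OF y]] by simp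
    then have "\<beta>' *\<^sub>R z + (- \<beta>) *\<^sub>R J z = 0" using \<beta> \<beta>' by (simp add: J_simps)
    with J_line_independent[OF z0, of "\<beta>'" "- \<beta>"] \<beta> show ?thesis by simp
  qed
  then have "br p (J z) = 0" "br q (J z) = 0"
    using frame4_mem[OF F] br_skew[of p "J z"] br_skew[of q "J z"] by auto
  then have "J z \<in> span {z, w}" using heisenberg_centralizer[OF H Jh[OF zh]] by simp
  with heisenberg_J_center[OF H] show False by simp
qed

text \<open>
  Suppose \<open>h\<close> is the direct sum of its centre and a \<open>J\<close>-line spanned by \<open>e\<close> and \<open>Je\<close>. For central \<open>y\<close> integrability makes
  \<open>ad (Jy)\<close> complex linear on the \<open>J\<close>-line, with eigenvalue \<open>\<mu> + i\<sigma>\<close>, and it acts on \<open>\<zeta> = [e,Je]\<close> by \<open>2\<mu>\<close>. From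
  \<open>[J\<zeta>,w] = [Jw,\<zeta>]\<close> and tracelessness follows \<open>\<mu> = 0\<close> for \<open>y = \<zeta>\<close>, and then closedness of the torsion on
  \<open>e, Je, \<zeta>, Jw\<close> gives it for \<open>y = w\<close>. Among the \<open>Jy\<close> there is then one that acts nilpotently although it
  is outside \<open>h\<close>.
\<close>

lemma heisenberg_J_line_meets_center:
  assumes H: "heisenberg_frame p q z w"
  shows "\<exists>t\<in>span {z, w}. t \<noteq> 0 \<and> J t \<in> h"
proof (rule ccontr)
  assume "\<not> ?thesis"
  then have out: "t = 0" if "t \<in> span {z, w}" "J t \<in> h" for t using that by blast
  have F: "frame4 h p q z w" using H by (auto simp: heisenberg_frame_def)
  obtain e where e: "e \<noteq> 0" "e \<in> h" "J e \<in> h" by (rule exists_J_line)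
  have Fe: "frame4 h e (J e) z w"
  proof (rule frame4I_coeffs[OF h_subspace dimh])
    fix \<alpha> \<beta> \<gamma> \<delta> assume eq: "\<alpha> *\<^sub>R e + \<beta> *\<^sub>R J e + \<gamma> *\<^sub>R z + \<delta> *\<^sub>R w = 0"
    let ?t = "\<gamma> *\<^sub>R z + \<delta> *\<^sub>R w"
    have t: "?t = - (\<alpha> *\<^sub>R e + \<beta> *\<^sub>R J e)" using eq by (simp add: eq_neg_iff_add_eq_0 algebra_simps)
    have "J ?t = - (\<alpha> *\<^sub>R J e - \<beta> *\<^sub>R e)" unfolding t by (simp add: J_simps JJ)
    also have "\<dots> \<in> h" using e by (intro h_closed)
    finally have "?t = 0" by (intro out) (auto simp: in_span2)
    then have "\<alpha> *\<^sub>R e + \<beta> *\<^sub>R J e = 0" using eq by (simp add: add.assoc)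
    then show "\<alpha> = 0 \<and> \<beta> = 0 \<and> \<gamma> = 0 \<and> \<delta> = 0"
      using J_line_independent[OF e(1)] frame4_coeffs[OF F, of 0 0 \<gamma> \<delta>] \<open>?t = 0\<close> by simp
  qed (use e frame4_mem[OF F] in auto)
  obtain c where c: "br e (J e) = c *\<^sub>R z" using heisenberg_bracket[OF H e(2,3)] .
  have zw: "z \<in> span {z, w}" "w \<in> span {z, w}" by (auto intro: span_base)
  have "c \<noteq> 0"
  proof
    assume "c = 0"
    have "br e x = 0" if x: "x \<in> h" for x
    proof -
      obtain x1 x2 x3 x4 where "x = x1 *\<^sub>R e + x2 *\<^sub>R J e + x3 *\<^sub>R z + x4 *\<^sub>R w"
        using frame4_expand[OF Fe x] .
      then show ?thesis
        using c \<open>c = 0\<close> heisenberg_central(2)[OF H zw(1) e(2)] heisenberg_central(2)[OF H zw(2) e(2)]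
        by (simp add: br_simps br_self)
    qed
    then have "e \<in> span {z, w}"
      using frame4_mem[OF F] br_skew[of p e] br_skew[of q e] e(2) by (intro heisenberg_centralizer[OF H]) auto
    with out[of e] e show False by simp
  qed
  define \<zeta> where "\<zeta> = c *\<^sub>R z"
  have H': "heisenberg_frame e (J e) \<zeta> w"
  proof -
    have "frame4 h e (J e) \<zeta> w"
    proof (rule frame4I_coeffs[OF h_subspace dimh])
      fix \<alpha> \<beta> \<gamma> \<delta> assume "\<alpha> *\<^sub>R e + \<beta> *\<^sub>R J e + \<gamma> *\<^sub>R \<zeta> + \<delta> *\<^sub>R w = 0"
      then have "\<alpha> *\<^sub>R e + \<beta> *\<^sub>R J e + (\<gamma> * c) *\<^sub>R z + \<delta> *\<^sub>R w = 0" by (simp add: \<zeta>_def)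
      from frame4_coeffs[OF Fe this] \<open>c \<noteq> 0\<close> show "\<alpha> = 0 \<and> \<beta> = 0 \<and> \<gamma> = 0 \<and> \<delta> = 0" by simp
    qed (use e frame4_mem[OF F] h_closed in \<open>auto simp: \<zeta>_def\<close>)
    then show ?thesis
      using c heisenberg_central(2)[OF H zw(1)] heisenberg_central(2)[OF H zw(2)] e frame4_mem[OF F]
      by (simp add: heisenberg_frame_def \<zeta>_def br_simps)
  qed
  have F': "frame4 h e (J e) \<zeta> w" using H' by (simp add: heisenberg_frame_def)
  have \<zeta>0: "\<zeta> \<noteq> 0" using frame4_coeffs[OF F', of 0 0 1 0] by auto
  have out': "t = 0" if "t \<in> span {\<zeta>, w}" "J t \<in> h" for t
  proof (rule out[OF _ that(2)])
    show "t \<in> span {z, w}" using that(1) by (auto simp: in_span2 \<zeta>_def)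
  qed
  have zw': "\<zeta> \<in> span {\<zeta>, w}" "w \<in> span {\<zeta>, w}" by (auto intro: span_base)
  have act: "\<exists>t \<mu> \<sigma>. br (J y) e = \<mu> *\<^sub>R e + \<sigma> *\<^sub>R J e \<and> br (J y) (J e) = \<mu> *\<^sub>R J e - \<sigma> *\<^sub>R e \<and>
      br (J y) \<zeta> = (2 * \<mu>) *\<^sub>R \<zeta> \<and> br (J y) w = t *\<^sub>R \<zeta> + (- 4 * \<mu>) *\<^sub>R w"
    if y: "y \<in> span {\<zeta>, w}" for y
  proof -
    obtain \<alpha> \<beta> \<gamma> \<delta> p3 p4 q3 q4 t where A:
      "br (J y) e = \<alpha> *\<^sub>R e + \<beta> *\<^sub>R J e + p3 *\<^sub>R \<zeta> + p4 *\<^sub>R w"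
      "br (J y) (J e) = \<gamma> *\<^sub>R e + \<delta> *\<^sub>R J e + q3 *\<^sub>R \<zeta> + q4 *\<^sub>R w"
      "br (J y) \<zeta> = (\<alpha> + \<delta>) *\<^sub>R \<zeta>" "br (J y) w = t *\<^sub>R \<zeta> + (- 2 * (\<alpha> + \<delta>)) *\<^sub>R w"
      by (rule heisenberg_action[OF H'])
    have eq: "br (J y) (J e) = J (br (J y) e)"
      using integrable[of y e] heisenberg_central(1)[OF H' y e(2)] heisenberg_central(1)[OF H' y e(3)]
      by simp
    let ?t = "p3 *\<^sub>R \<zeta> + p4 *\<^sub>R w"
    have "J ?t = br (J y) (J e) - (\<alpha> *\<^sub>R J e - \<beta> *\<^sub>R e)"
      unfolding eq A(1) by (simp add: J_simps JJ)
    also have "\<dots> \<in> h" using e by (intro h_closed br_in_h)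
    finally have t0: "?t = 0" by (intro out') (auto simp: in_span2)
    then have p: "p3 = 0" "p4 = 0" using frame4_coeffs[OF F', of 0 0 p3 p4] by auto
    have "\<gamma> *\<^sub>R e + \<delta> *\<^sub>R J e + q3 *\<^sub>R \<zeta> + q4 *\<^sub>R w = (- \<beta>) *\<^sub>R e + \<alpha> *\<^sub>R J e + 0 *\<^sub>R \<zeta> + 0 *\<^sub>R w"
      using eq unfolding A(1,2) p by (simp add: J_simps JJ)
    from frame4_coeffs_eq[OF F' this] have "br (J y) e = \<alpha> *\<^sub>R e + \<beta> *\<^sub>R J e \<and>
        br (J y) (J e) = \<alpha> *\<^sub>R J e - \<beta> *\<^sub>R e \<and> br (J y) \<zeta> = (2 * \<alpha>) *\<^sub>R \<zeta> \<and>
        br (J y) w = t *\<^sub>R \<zeta> + (- 4 * \<alpha>) *\<^sub>R w"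
      using A p by auto
    then show ?thesis by blast
  qed
  obtain \<mu>1 \<sigma>1 t1 where 1: "br (J \<zeta>) e = \<mu>1 *\<^sub>R e + \<sigma>1 *\<^sub>R J e" "br (J \<zeta>) (J e) = \<mu>1 *\<^sub>R J e - \<sigma>1 *\<^sub>R e"
      "br (J \<zeta>) \<zeta> = (2 * \<mu>1) *\<^sub>R \<zeta>" "br (J \<zeta>) w = t1 *\<^sub>R \<zeta> + (- 4 * \<mu>1) *\<^sub>R w"
    using act[OF zw'(1)] by blast
  obtain \<mu>2 \<sigma>2 t2 where 2: "br (J w) e = \<mu>2 *\<^sub>R e + \<sigma>2 *\<^sub>R J e" "br (J w) (J e) = \<mu>2 *\<^sub>R J e - \<sigma>2 *\<^sub>R e"
      "br (J w) \<zeta> = (2 * \<mu>2) *\<^sub>R \<zeta>" "br (J w) w = t2 *\<^sub>R \<zeta> + (- 4 * \<mu>2) *\<^sub>R w"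
    using act[OF zw'(2)] by blast
  have wh: "w \<in> h" and \<zeta>h: "\<zeta> \<in> h" using frame4_mem[OF F'] by auto
  have "br (J \<zeta>) w - br (J w) \<zeta> = 0"
  proof (rule out')
    show "br (J \<zeta>) w - br (J w) \<zeta> \<in> span {\<zeta>, w}"
      unfolding 1 2 by (intro span_diff span_add span_scale zw')
    have "J (br (J \<zeta>) w - br (J w) \<zeta>) = br (J \<zeta>) (J w) - br \<zeta> w"
      using br_skew[of \<zeta> "J w"] integrable[of \<zeta> w] by (simp add: J_simps)
    then show "J (br (J \<zeta>) w - br (J w) \<zeta>) \<in> h" using br_in_h h_closed by simp
  qed
  then have "0 *\<^sub>R e + 0 *\<^sub>R J e + (t1 - 2 * \<mu>2) *\<^sub>R \<zeta> + (- 4 * \<mu>1) *\<^sub>R w = 0"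
    unfolding 1 2 by (simp add: algebra_simps)
  from frame4_coeffs[OF F' this] have \<mu>1: "\<mu>1 = 0" by simp
  have tor: "torsion e (J e) \<zeta> \<noteq> 0"
    using g_pos[OF \<zeta>0] c by (simp add: torsion_J_line 1 \<mu>1 g_simps g_J_self g_JJ flip: \<zeta>_def)
  have "(\<mu>2 + \<mu>2) * torsion e (J e) \<zeta> + torsion e (J e) (br (J w) \<zeta>) = torsion (br e (J e)) \<zeta> (J w)"
    by (rule torsion_closed_J_line[OF _ _ 2(1,2), of _ 0])
      (use heisenberg_central(2)[OF H' zw'(1)] e in auto)
  then have "4 * \<mu>2 * torsion e (J e) \<zeta> = 0"
    unfolding 2(3) c \<zeta>_def[symmetric] by (simp add: torsion_simps torsion_alternating(4-6))
  with tor have \<mu>2: "\<mu>2 = 0" by simp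
  obtain \<xi> \<eta> where ne: "(\<xi>, \<eta>) \<noteq> (0, 0)" and 0: "\<xi> * \<sigma>1 + \<eta> * \<sigma>2 = 0"
    using parallel_coefficients[of \<sigma>1 0 \<sigma>2 0 0 0] by auto
  let ?y = "\<xi> *\<^sub>R \<zeta> + \<eta> *\<^sub>R w"
  have "J ?y \<in> h"
  proof (rule ad_triangular_in_h)
    show "frame4 h e (J e) w \<zeta>" using F' by (simp add: frame4_def insert_commute)
    have "br (J ?y) e = (\<xi> * \<sigma>1 + \<eta> * \<sigma>2) *\<^sub>R J e"
      by (simp add: J_simps br_simps 1 2 \<mu>1 \<mu>2 algebra_simps)
    then show "br (J ?y) e \<in> span {J e, w, \<zeta>}" unfolding 0 by (simp add: span_zero)
    have "br (J ?y) (J e) = - ((\<xi> * \<sigma>1 + \<eta> * \<sigma>2) *\<^sub>R e)"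
      by (simp add: J_simps br_simps 1 2 \<mu>1 \<mu>2 algebra_simps)
    then show "br (J ?y) (J e) \<in> span {w, \<zeta>}" unfolding 0 by (simp add: span_zero)
    have "br (J ?y) w = (\<xi> * t1 + \<eta> * t2) *\<^sub>R \<zeta>"
      by (simp add: J_simps br_simps 1 2 \<mu>1 \<mu>2 algebra_simps)
    then show "br (J ?y) w \<in> span {\<zeta>}" by (auto simp: span_singleton)
    show "br (J ?y) \<zeta> = 0" by (simp add: J_simps br_simps 1 2 \<mu>1 \<mu>2)
  qed
  then have "?y = 0" by (intro out') (auto simp: in_span2)
  with frame4_coeffs[OF F', of 0 0 \<xi> \<eta>] ne show False by simp
qed

text \<open>
  It remains to exclude a central \<open>z\<^sub>0\<close> with \<open>u = Jz\<^sub>0 \<in> h\<close>. If \<open>z\<^sub>0\<close> is not on the line \<open>[h,h]\<close>, integrability shows that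
  \<open>J z\<close> acts nilpotently. If it is, take \<open>v\<close> with \<open>[u,v] = z\<close>: closedness of the torsion on \<open>z, Jz, v, Jw\<close> and
  integrability for \<open>v, w\<close> determine the component of \<open>[Jw,v]\<close> along \<open>w\<close> in two ways that differ by \<open>1\<close>.
\<close>

lemma nilradical_not_heisenberg: "\<not> heisenberg_frame p q z w"
proof
  assume H0: "heisenberg_frame p q z w"
  obtain x where x: "x \<in> h" "J x \<notin> h" using heisenberg_not_J_invariant[OF H0] by blast
  obtain z0 where z0: "z0 \<in> span {z, w}" "z0 \<noteq> 0" "J z0 \<in> h"
    using heisenberg_J_line_meets_center[OF H0] by blast
  have z0h: "z0 \<in> h" using heisenberg_central(3)[OF H0 z0(1)] z0(3) by simp
  have line: "f \<in> span {z0, J z0}" if "f \<in> h" "J f \<in> h" for f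
    using J_line_unique[OF z0(2) z0h z0(3) that x] .
  have int: "br (J y) (J z0) = J (br (J y) z0 - br (J z0) y)" if y: "y \<in> h" for y
  proof -
    have "br (J y) (J z0) = - br (J z0) (J y)" by (rule br_skew)
    also have "\<dots> = - J (br (J z0) y - br (J y) z0)"
      using heisenberg_central(1)[OF H0 z0(1) y] br_skew[of z0 "J y"] by (simp add: integrable[of z0 y])
    finally show ?thesis by (simp add: J_simps)
  qed
  have lie: "br (J y) v - br (J v) y \<in> span {z0, J z0}" if "y \<in> h" "v \<in> h" for y v
  proof (rule line)
    show "br (J y) v - br (J v) y \<in> h" by (intro h_closed br_in_h)
    have "J (br (J y) v - br (J v) y) = br (J y) (J v) - br y v"
      using integrable[of y v] br_skew[of y "J v"] by (simp add: J_simps)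
    then show "J (br (J y) v - br (J v) y) \<in> h" using h_closed br_in_h by simp
  qed
  show False
  proof (cases "z0 \<in> span {z}")
    case False
    have H1: "heisenberg_frame p q z z0" using heisenberg_frame_change_w[OF H0 z0(1) False] .
    have "J z0 \<notin> span {z, z0}"
    proof
      assume "J z0 \<in> span {z, z0}"
      then obtain a b where ab: "J z0 = a *\<^sub>R z + b *\<^sub>R z0" by (auto simp: in_span2)
      have "a \<noteq> 0" using J_line_independent[OF z0(2), of "- b" 1] ab by auto
      have "a *\<^sub>R J z = J (J z0 - b *\<^sub>R z0)" by (simp add: ab J_simps)
      also have "\<dots> = J (J z0) - b *\<^sub>R J z0" by (simp only: J_simps)
      also have "\<dots> = - z0 - b *\<^sub>R (a *\<^sub>R z + b *\<^sub>R z0)" unfolding JJ unfolding ab ..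
      also have "\<dots> \<in> span {z, z0}"
        by (intro span_diff span_add span_scale span_neg span_base) auto
      finally have "(1 / a) *\<^sub>R a *\<^sub>R J z \<in> span {z, z0}" by (rule span_scale)
      then have "J z \<in> span {z, z0}" using \<open>a \<noteq> 0\<close> by simp
      with heisenberg_J_center[OF H1] show False by simp
    qed
    then obtain v where H: "heisenberg_frame (J z0) v z z0"
      using heisenberg_frame_change_p[OF H1 z0(3)] by blast
    then have F: "frame4 h (J z0) v z z0" and uv: "br (J z0) v = z" "br (J z0) z = 0"
      by (auto simp: heisenberg_frame_def)
    have zh: "z \<in> h" and vh: "v \<in> h" using frame4_mem[OF F] by auto
    have Jz: "J z \<notin> h"
    proof
      assume "J z \<in> h"
      from line[OF zh this] obtain a b where "z = a *\<^sub>R z0 + b *\<^sub>R J z0" by (auto simp: in_span2)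
      with frame4_coeffs[OF F, of b 0 "-1" a] show False by simp
    qed
    obtain \<alpha> \<beta> \<gamma> \<delta> p3 p4 q3 q4 t where A:
      "br (J z) (J z0) = \<alpha> *\<^sub>R J z0 + \<beta> *\<^sub>R v + p3 *\<^sub>R z + p4 *\<^sub>R z0"
      "br (J z) v = \<gamma> *\<^sub>R J z0 + \<delta> *\<^sub>R v + q3 *\<^sub>R z + q4 *\<^sub>R z0"
      "br (J z) z = (\<alpha> + \<delta>) *\<^sub>R z" "br (J z) z0 = t *\<^sub>R z + (- 2 * (\<alpha> + \<delta>)) *\<^sub>R z0"
      by (rule heisenberg_action[OF H])
    obtain a' t' where A': "br (J v) z = a' *\<^sub>R z" "br (J v) z0 = t' *\<^sub>R z + (- 2 * a') *\<^sub>R z0"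
      using heisenberg_action[OF H, of "J v"] by metis
    have coeff: "s = 0" if "J (s *\<^sub>R z + r *\<^sub>R z0) \<in> h" for s r
    proof (rule ccontr)
      assume "s \<noteq> 0"
      have "J z = (1 / s) *\<^sub>R (J (s *\<^sub>R z + r *\<^sub>R z0) - r *\<^sub>R J z0)"
        using \<open>s \<noteq> 0\<close> by (simp add: J_simps)
      also have "\<dots> \<in> h" using that z0(3) by (intro h_closed)
      finally show False using Jz by simp
    qed
    have "t = 0"
      by (rule coeff[of t "- 2 * (\<alpha> + \<delta>)"]) (use int[OF zh] uv A br_in_h[of "J z" "J z0"] in simp)
    have "t' - 1 = 0"
    proof (rule coeff[of "t' - 1" "- 2 * a'"])
      have "J ((t' - 1) *\<^sub>R z + (- 2 * a') *\<^sub>R z0) = br (J v) (J z0)"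
        unfolding int[OF vh] A' uv by (simp add: algebra_simps)
      then show "J ((t' - 1) *\<^sub>R z + (- 2 * a') *\<^sub>R z0) \<in> h" by (simp only: br_in_h)
    qed
    then have t': "t' = 1" by simp
    \<comment> \<open>The actions of \<open>J z\<close> and \<open>J v\<close> on the centre commute; comparing them on
      \<open>z0\<close> shows that the weight of \<open>z\<close> under \<open>J z\<close> is zero.\<close>
    have "(3 * (\<alpha> + \<delta>)) *\<^sub>R z = br (J z) (br (J v) z0) - br (J v) (br (J z) z0)"
      unfolding A A' \<open>t = 0\<close> t' by (simp add: br_simps A A' \<open>t = 0\<close> t' scaleR_mult_numeral algebra_simps)
    also have "\<dots> = br (br (J z) (J v)) z0" by (simp add: jacobi[of "J z" "J v" z0])
    also have "\<dots> = 0" by (rule heisenberg_central(2)[OF H0 z0(1) br_in_h])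
    finally have \<alpha>\<delta>: "\<alpha> + \<delta> = 0" using frame4_coeffs[OF F, of 0 0 "3 * (\<alpha> + \<delta>)" 0] by simp
    have "br (J z) (J z0) = 0" using int[OF zh] uv A(4) \<alpha>\<delta> \<open>t = 0\<close> by (simp add: J_simps)
    then have "\<alpha> = 0" using frame4_coeffs[OF F] A(1) by metis
    with \<alpha>\<delta> have "\<delta> = 0" by simp
    have "frame4 h v (J z0) z z0" using F by (simp add: frame4_def insert_commute)
    from ad_triangular_in_h[OF this, of "J z"] have "J z \<in> h"
      using A \<open>br (J z) (J z0) = 0\<close> \<open>\<delta> = 0\<close> \<open>t = 0\<close> \<open>\<alpha> = 0\<close> by (auto simp: in_span3 span_zero)
    with Jz show False by simp
  next
    case True
    then obtain c where c: "z0 = c *\<^sub>R z" by (auto simp: span_singleton)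
    with z0(2) have c0: "c \<noteq> 0" by auto
    have zz: "z = (1 / c) *\<^sub>R z0" using c c0 by simp
    have Jzh: "J z \<in> h" unfolding zz using z0(3) h_closed by (simp add: J_simps)
    obtain v where H: "heisenberg_frame (J z) v z w"
      using heisenberg_frame_change_p[OF H0 Jzh heisenberg_J_center[OF H0]] by blast
    then have F: "frame4 h (J z) v z w" and uv: "br (J z) v = z" "br (J z) z = 0" "br (J z) w = 0"
      by (auto simp: heisenberg_frame_def)
    have z0': "z \<noteq> 0" using frame4_coeffs[OF F, of 0 0 1 0] by auto
    have wh: "w \<in> h" and vh: "v \<in> h" and zh: "z \<in> h" using frame4_mem[OF F] by auto
    have int': "br (J y) (J z) = J (br (J y) z - br (J z) y)" if y: "y \<in> h" for y
      using int[OF y] c0 by (simp add: c J_simps br_simps flip: scaleR_diff_right)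
    obtain \<alpha> \<beta> \<gamma> \<delta> p3 p4 q3 q4 t where A:
      "br (J w) (J z) = \<alpha> *\<^sub>R J z + \<beta> *\<^sub>R v + p3 *\<^sub>R z + p4 *\<^sub>R w"
      "br (J w) v = \<gamma> *\<^sub>R J z + \<delta> *\<^sub>R v + q3 *\<^sub>R z + q4 *\<^sub>R w"
      "br (J w) z = (\<alpha> + \<delta>) *\<^sub>R z" "br (J w) w = t *\<^sub>R z + (- 2 * (\<alpha> + \<delta>)) *\<^sub>R w"
      by (rule heisenberg_action[OF H])
    obtain a' t' where A': "br (J v) z = a' *\<^sub>R z" "br (J v) w = t' *\<^sub>R z + (- 2 * a') *\<^sub>R w"
      using heisenberg_action[OF H, of "J v"] by metis
    have Jw: "J w \<notin> h"
    proof
      assume "J w \<in> h"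
      from line[OF wh this] obtain a b where "w = a *\<^sub>R z0 + b *\<^sub>R J z0" by (auto simp: in_span2)
      then have "w = (a * c) *\<^sub>R z + (b * c) *\<^sub>R J z" by (simp add: c J_simps)
      with frame4_coeffs[OF F, of "b * c" 0 "a * c" "-1"] show False by simp
    qed
    have wu: "br (J w) (J z) = (\<alpha> + \<delta>) *\<^sub>R J z"
      using int'[OF wh] uv A(3) by (simp add: J_simps)
    then have \<delta>: "\<delta> = 0"
      using frame4_coeffs_eq[OF F, of \<alpha> \<beta> p3 p4 "\<alpha> + \<delta>" 0 0 0] A(1) by simp
    have vu: "br (J v) (J z) = (a' - 1) *\<^sub>R J z"
      using int'[OF vh] uv A'(1) by (simp add: J_simps algebra_simps)
    \<comment> \<open>The weight of \<open>z\<close> under \<open>J w\<close> is nonzero, since otherwise \<open>J w\<close> would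
      act nilpotently.\<close>
    have \<alpha>0: "\<alpha> \<noteq> 0"
    proof
      assume "\<alpha> = 0"
      have F': "frame4 h v (J z) w z" using F by (simp add: frame4_def insert_commute)
      have "J w \<in> h"
      proof (rule ad_triangular_in_h[OF F'])
        show "br (J w) v \<in> span {J z, w, z}" unfolding A(2) \<delta>
          by (auto intro!: span_add span_scale intro: span_base)
        show "br (J w) (J z) \<in> span {w, z}" using wu \<delta> \<open>\<alpha> = 0\<close> by (simp add: span_zero)
        show "br (J w) w \<in> span {z}" using A(4) \<delta> \<open>\<alpha> = 0\<close> by (auto simp: span_singleton)
        show "br (J w) z = 0" using A(3) \<delta> \<open>\<alpha> = 0\<close> by simp
      qed
      with Jw show False by simp
    qed
    have tor_v: "torsion z (J z) v = - (2 * a' - 1) * g z z"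
      using br_skew[of z "J z"] uv
      by (simp add: torsion_J_line A' vu g_simps g_JJ algebra_simps)
    have tor_w: "torsion z (J z) w = - 2 * \<alpha> * g z z"
      using br_skew[of z "J z"] uv
      by (simp add: torsion_J_line A(3) wu \<delta> g_simps g_JJ algebra_simps)
    have "(\<alpha> + \<alpha>) * torsion z (J z) v + torsion z (J z) (br (J w) v) = torsion (br z (J z)) v (J w)"
    proof (rule torsion_closed_J_line)
      show "br z v = 0" by (rule heisenberg_central(1)[OF H0 _ vh]) (simp add: span_base)
      show "br (J z) v = 1 *\<^sub>R z" using uv by simp
      show "br (J w) z = \<alpha> *\<^sub>R z + 0 *\<^sub>R J z" using A(3) \<delta> by simp
      show "br (J w) (J z) = \<alpha> *\<^sub>R J z - 0 *\<^sub>R z" using wu \<delta> by simp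
    qed
    then have "2 * \<alpha> * (- (2 * a' - 1) - q4) * g z z = 0"
      using br_skew[of z "J z"] uv
      by (simp add: A(2) \<delta> torsion_simps torsion_alternating(4-6) tor_v tor_w algebra_simps)
    then have q4: "q4 = 1 - 2 * a'" using \<alpha>0 g_pos[OF z0'] by simp
    have "br (J v) w - br (J w) v \<in> span {z0, J z0}" using lie[OF vh wh] .
    then obtain a b where "br (J v) w - br (J w) v = a *\<^sub>R z0 + b *\<^sub>R J z0" by (auto simp: in_span2)
    then have "(- \<gamma> - b * c) *\<^sub>R J z + 0 *\<^sub>R v + (t' - q3 - a * c) *\<^sub>R z + (- 2 * a' - q4) *\<^sub>R w = 0"
      by (simp add: A'(2) A(2) \<delta> c J_simps algebra_simps)
    from frame4_coeffs[OF F this] q4 show False by simp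
  qed
qed

theorem nilradical_abelian: "lie_abelian_on br h"
  using nilradical_cases nilradical_not_filiform nilradical_not_heisenberg by blast

end

section \<open>Recognising the two model algebras\<close>

context unimodular_codim2
begin

lemma lie_iso_of_basis:
  fixes br' :: "real^6 \<Rightarrow> real^6 \<Rightarrow> real^6"
  assumes F: "frame4 h f1 f2 f3 f4" and T: "transversal h f5 f6"
    and \<psi>: "\<psi> = (\<lambda>x :: real^6. x $ 1 *\<^sub>R f1 + x $ 2 *\<^sub>R f2 + x $ 3 *\<^sub>R f3 + x $ 4 *\<^sub>R f4
      + x $ 5 *\<^sub>R f5 + x $ 6 *\<^sub>R f6)"
    and hom: "\<And>x y. \<psi> (br' x y) = br (\<psi> x) (\<psi> y)"
  shows "lie_iso br br'"
proof -
  have lin: "linear \<psi>" by (rule linearI) (simp_all add: \<psi> algebra_simps)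
  have "x = 0" if 0: "\<psi> x = 0" for x
  proof -
    have "x $ 5 *\<^sub>R f5 + x $ 6 *\<^sub>R f6 = - (x $ 1 *\<^sub>R f1 + x $ 2 *\<^sub>R f2 + x $ 3 *\<^sub>R f3 + x $ 4 *\<^sub>R f4)"
      using 0 by (simp add: \<psi> eq_neg_iff_add_eq_0 algebra_simps)
    also have "\<dots> \<in> h" using frame4_mem[OF F] by (intro h_closed)
    finally have 56: "x $ 5 = 0" "x $ 6 = 0" using T by (auto simp: transversal_def)
    from 0 56 frame4_coeffs[OF F, of "x $ 1" "x $ 2" "x $ 3" "x $ 4"] show ?thesis
      by (simp add: \<psi> vec_eq_iff forall_6)
  qed
  then have inj: "inj \<psi>" using linear_injective_0[OF lin] by blast
  have "\<exists>x. v = \<psi> x" for v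
  proof -
    obtain \<alpha> \<beta> t where t: "t \<in> h" "v = \<alpha> *\<^sub>R f5 + \<beta> *\<^sub>R f6 + t"
      by (rule transversal_expand[OF h_subspace dimh dimU T])
    obtain a b c d where "t = a *\<^sub>R f1 + b *\<^sub>R f2 + c *\<^sub>R f3 + d *\<^sub>R f4"
      by (rule frame4_expand[OF F t(1)])
    with t(2) have "v = \<psi> (vector [a, b, c, d, \<alpha>, \<beta>])" by (simp add: \<psi> vector_6)
    then show ?thesis by blast
  qed
  then have bij: "bij \<psi>" using inj by (auto simp: bij_def surj_def)
  define \<phi> where "\<phi> = inv \<psi>"
  have \<psi>\<phi>: "\<psi> (\<phi> v) = v" and \<phi>\<psi>: "\<phi> (\<psi> x) = x" for v x
    using bij by (auto simp: \<phi>_def bij_def surj_f_inv_f)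
  have "linear \<phi>"
  proof (rule linearI)
    fix u v :: 'a and c :: real
    have "\<phi> u + \<phi> v = \<phi> (\<psi> (\<phi> u + \<phi> v))" by (simp only: \<phi>\<psi>)
    then show "\<phi> (u + v) = \<phi> u + \<phi> v" by (simp add: linear_add[OF lin] \<psi>\<phi>)
    have "c *\<^sub>R \<phi> u = \<phi> (\<psi> (c *\<^sub>R \<phi> u))" by (simp only: \<phi>\<psi>)
    then show "\<phi> (c *\<^sub>R u) = c *\<^sub>R \<phi> u" by (simp add: linear_scale[OF lin] \<psi>\<phi>)
  qed
  moreover have "bij \<phi>" unfolding \<phi>_def using bij by (rule bij_imp_bij_inv)
  moreover have "\<phi> (br u v) = br' (\<phi> u) (\<phi> v)" for u v
    using hom[of "\<phi> u" "\<phi> v"] \<phi>\<psi>[of "br' (\<phi> u) (\<phi> v)"] by (simp add: \<psi>\<phi>)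
  ultimately show ?thesis unfolding lie_iso_def by blast
qed

lemma lie_iso_tau30_tau30_of_basis:
  assumes F: "frame4 h f1 f2 f3 f4" and T: "transversal h f5 f6" and ab: "lie_abelian_on br h"
    and f5: "br f5 f1 = f2" "br f5 f2 = - f1" "br f5 f3 = 0" "br f5 f4 = 0"
    and f6: "br f6 f1 = 0" "br f6 f2 = 0" "br f6 f3 = f4" "br f6 f4 = - f3"
    and f56: "br f5 f6 = 0"
  shows "lie_iso br tau30_tau30"
proof (rule lie_iso_of_basis[OF F T refl])
  have h: "br u v = 0" if "u \<in> {f1, f2, f3, f4}" "v \<in> {f1, f2, f3, f4}" for u v
    using ab that frame4_mem[OF F] by (auto simp: lie_abelian_on_def)
  have sk: "br f1 f5 = - f2" "br f2 f5 = f1" "br f3 f5 = 0" "br f4 f5 = 0" "br f6 f5 = 0"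
    "br f1 f6 = 0" "br f2 f6 = 0" "br f3 f6 = - f4" "br f4 f6 = f3"
    using br_skew[of f1 f5] br_skew[of f2 f5] br_skew[of f3 f5] br_skew[of f4 f5] br_skew[of f6 f5]
      br_skew[of f1 f6] br_skew[of f2 f6] br_skew[of f3 f6] br_skew[of f4 f6] f5 f6 f56 by auto
  fix x y :: "real^6"
  show "(tau30_tau30 x y) $ 1 *\<^sub>R f1 + (tau30_tau30 x y) $ 2 *\<^sub>R f2 + (tau30_tau30 x y) $ 3 *\<^sub>R f3
      + (tau30_tau30 x y) $ 4 *\<^sub>R f4 + (tau30_tau30 x y) $ 5 *\<^sub>R f5 + (tau30_tau30 x y) $ 6 *\<^sub>R f6
    = br (x $ 1 *\<^sub>R f1 + x $ 2 *\<^sub>R f2 + x $ 3 *\<^sub>R f3 + x $ 4 *\<^sub>R f4 + x $ 5 *\<^sub>R f5 + x $ 6 *\<^sub>R f6)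
      (y $ 1 *\<^sub>R f1 + y $ 2 *\<^sub>R f2 + y $ 3 *\<^sub>R f3 + y $ 4 *\<^sub>R f4 + y $ 5 *\<^sub>R f5 + y $ 6 *\<^sub>R f6)"
    by (simp add: br_simps br_self h f5 f6 f56 sk tau30_tau30_def structure_bracket_def vector_6
        f_wedge_def algebra_simps)
qed

lemma lie_iso_g535_R_of_basis:
  assumes F: "frame4 h f1 f2 f3 f4" and T: "transversal h f5 f6" and ab: "lie_abelian_on br h"
    and f5: "br f5 f1 = 2 *\<^sub>R f1" "br f5 f2 = - f2" "br f5 f3 = - f3" "br f5 f4 = 0"
    and f6: "br f6 f1 = 0" "br f6 f2 = f3" "br f6 f3 = - f2" "br f6 f4 = 0"
    and f56: "br f5 f6 = 0"
  shows "lie_iso br g535_R"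
proof (rule lie_iso_of_basis[OF F T refl])
  have h: "br u v = 0" if "u \<in> {f1, f2, f3, f4}" "v \<in> {f1, f2, f3, f4}" for u v
    using ab that frame4_mem[OF F] by (auto simp: lie_abelian_on_def)
  have sk: "br f1 f5 = - 2 *\<^sub>R f1" "br f2 f5 = f2" "br f3 f5 = f3" "br f4 f5 = 0" "br f6 f5 = 0"
    "br f1 f6 = 0" "br f2 f6 = - f3" "br f3 f6 = f2" "br f4 f6 = 0"
    using br_skew[of f1 f5] br_skew[of f2 f5] br_skew[of f3 f5] br_skew[of f4 f5] br_skew[of f6 f5]
      br_skew[of f1 f6] br_skew[of f2 f6] br_skew[of f3 f6] br_skew[of f4 f6] f5 f6 f56 by auto
  fix x y :: "real^6"
  show "(g535_R x y) $ 1 *\<^sub>R f1 + (g535_R x y) $ 2 *\<^sub>R f2 + (g535_R x y) $ 3 *\<^sub>R f3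
      + (g535_R x y) $ 4 *\<^sub>R f4 + (g535_R x y) $ 5 *\<^sub>R f5 + (g535_R x y) $ 6 *\<^sub>R f6
    = br (x $ 1 *\<^sub>R f1 + x $ 2 *\<^sub>R f2 + x $ 3 *\<^sub>R f3 + x $ 4 *\<^sub>R f4 + x $ 5 *\<^sub>R f5 + x $ 6 *\<^sub>R f6)
      (y $ 1 *\<^sub>R f1 + y $ 2 *\<^sub>R f2 + y $ 3 *\<^sub>R f3 + y $ 4 *\<^sub>R f4 + y $ 5 *\<^sub>R f5 + y $ 6 *\<^sub>R f6)"
    by (simp add: br_simps br_self h f5 f6 f56 sk g535_R_def structure_bracket_def vector_6
        f_wedge_def algebra_simps)
qed

end

section \<open>Nilradicals that are not complex subspaces\<close>

context skt_codim2
begin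

lemma abelian: "x \<in> h \<Longrightarrow> y \<in> h \<Longrightarrow> br x y = 0"
  using nilradical_abelian by (simp add: lie_abelian_on_def)

lemma ad_commute: "y \<in> h \<Longrightarrow> br u (br v y) = br v (br u y)"
  using jacobi[of u v y] abelian[OF br_in_h, of y u v] by simp

text \<open>
  Let \<open>K\<close> be the \<open>J\<close>-line in \<open>h\<close>, and let \<open>\<mu> + i\<sigma>\<close> be the complex number by which \<open>ad (Jy)\<close> acts on \<open>K\<close>. The product
  \<open>x \<cdot> y = [Jx,y]\<close> on \<open>h/K\<close> is commutative by integrability, and its multiplication operators commute and have trace \<open>-2\<mu>\<close>.
  The SKT condition gives \<open>\<mu>([Jy,x]) = -2 \<mu>(x) \<mu>(y)\<close>. If \<open>\<mu> = 0\<close>, an element with \<open>\<sigma> = 0\<close> acts nilpotently. Otherwise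
  a basis \<open>u, w\<close> with \<open>-2\<mu>(u) = 1\<close> and \<open>\<mu>(w) = 0\<close> brings the product into normal form.
\<close>

lemma lie_iso_g535_R:
  assumes x0: "x0 \<in> h" "J x0 \<notin> h"
  shows "lie_iso br g535_R"
proof -
  obtain e where e: "e \<noteq> 0" "e \<in> h" "J e \<in> h" by (rule exists_J_line)
  let ?K = "span {e, J e}"
  have Kh: "t \<in> h \<and> J t \<in> h" if "t \<in> ?K" for t
  proof -
    obtain a b where "t = a *\<^sub>R e + b *\<^sub>R J e" using \<open>t \<in> ?K\<close> by (auto simp: in_span2)
    moreover from this have "J t = a *\<^sub>R J e + (- b) *\<^sub>R e" by (simp add: J_simps JJ)
    ultimately show ?thesis using e(2,3) by (simp only: h_closed(1,2))
  qed
  have K: "f \<in> ?K" if "f \<in> h" "J f \<in> h" for f using J_line_unique[OF e that x0] .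
  have ge: "g e e > 0" using e(1) by (rule g_pos)
  define \<mu> where "\<mu> y = g (br (J y) e) e / g e e" for y
  define \<sigma> where "\<sigma> y = g (br (J y) e) (J e) / g e e" for y
  have lin: "\<mu> (x + y) = \<mu> x + \<mu> y" "\<mu> (c *\<^sub>R x) = c * \<mu> x" "\<mu> (x - y) = \<mu> x - \<mu> y"
    "\<sigma> (x + y) = \<sigma> x + \<sigma> y" "\<sigma> (c *\<^sub>R x) = c * \<sigma> x" for x y c
    by (simp_all add: \<mu>_def \<sigma>_def J_simps br_simps g_simps add_divide_distrib diff_divide_distrib)
  have De: "br (J y) e = \<mu> y *\<^sub>R e + \<sigma> y *\<^sub>R J e" "br (J y) (J e) = \<mu> y *\<^sub>R J e - \<sigma> y *\<^sub>R e" if y: "y \<in> h" for y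
  proof -
    have eq: "br (J y) (J e) = J (br (J y) e)"
      using integrable[of y e] abelian[OF y e(2)] abelian[OF y e(3)] by simp
    have "br (J y) e \<in> ?K" by (rule K) (simp_all add: br_in_h flip: eq)
    then obtain a b where ab: "br (J y) e = a *\<^sub>R e + b *\<^sub>R J e" by (auto simp: in_span2)
    then have "\<mu> y = a" "\<sigma> y = b" using ge by (simp_all add: \<mu>_def \<sigma>_def g_simps g_J_self g_JJ)
    then show "br (J y) e = \<mu> y *\<^sub>R e + \<sigma> y *\<^sub>R J e" using ab by simp
    then show "br (J y) (J e) = \<mu> y *\<^sub>R J e - \<sigma> y *\<^sub>R e" by (simp add: eq J_simps JJ)
  qed
  have DK: "br (J y) t \<in> ?K" if "y \<in> h" "t \<in> ?K" for y t
  proof -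
    obtain a b where t: "t = a *\<^sub>R e + b *\<^sub>R J e" using \<open>t \<in> ?K\<close> by (auto simp: in_span2)
    show ?thesis unfolding t br_simps De[OF that(1)]
      by (intro span_add span_diff span_scale span_base) auto
  qed
  have \<mu>K: "\<mu> t = 0" if "t \<in> ?K" for t
    using abelian[of "J t" e] Kh[OF that] e(2) by (simp add: \<mu>_def g_simps)
  have tor: "torsion e (J e) v = - 2 * \<mu> v * g e e" if "v \<in> h" for v
    using abelian[OF e(2,3)] by (simp add: torsion_J_line De[OF that] g_simps g_J_self g_JJ)
  have \<mu>_mult: "\<mu> (br (J y) x) = - 2 * \<mu> x * \<mu> y" if "x \<in> h" "y \<in> h" for x y
  proof -
    have "(\<mu> y + \<mu> y) * torsion e (J e) x + torsion e (J e) (br (J y) x) = torsion (br e (J e)) x (J y)"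
      by (rule torsion_closed_J_line[OF _ _ De[OF that(2)], of _ 0]) (use that e abelian in auto)
    then have "2 * g e e * (\<mu> (br (J y) x) + 2 * \<mu> x * \<mu> y) = 0"
      using abelian[OF e(2,3)] tor[OF that(1)] tor[OF br_in_h, of "J y" x]
      by (simp add: torsion_simps algebra_simps)
    then show ?thesis using ge by simp
  qed
  have comm: "br (J x) y - br (J y) x \<in> ?K" if "x \<in> h" "y \<in> h" for x y
  proof (rule K)
    show "br (J x) y - br (J y) x \<in> h" by (intro h_closed br_in_h)
    have "J (br (J x) y - br (J y) x) = br (J x) (J y)"
      using integrable[of x y] br_skew[of x "J y"] abelian[OF that] by simp
    then show "J (br (J x) y - br (J y) x) \<in> h" by (simp only: br_in_h)
  qed
  have frameI: "frame4 h u w e (J e)" if "u \<in> h" "w \<in> h" "w \<notin> ?K" "u \<notin> span {w, e, J e}" for u w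
  proof (rule frame4I[OF h_subspace dimh])
    show "J e \<noteq> 0" using J_line_independent[OF e(1), of 0 1] by auto
    show "e \<notin> span {J e}"
    proof
      assume "e \<in> span {J e}"
      then obtain k where "e = k *\<^sub>R J e" by (auto simp: span_singleton)
      then show False using J_line_independent[OF e(1), of 1 "- k"] by simp
    qed
  qed (use that e in auto)
  \<comment> \<open>A linear functional on \<open>h\<close> vanishes somewhere outside \<open>K\<close>, as \<open>h/K\<close> is
    a plane.\<close>
  have outK: "\<exists>w\<in>h. w \<notin> ?K \<and> L w = 0"
    if L: "\<And>x y. L (x + y) = L x + L y" "\<And>c x. L (c *\<^sub>R x) = c * L x" for L :: "'a \<Rightarrow> real"
  proof -
    have "card {e, J e} < 4" "card {w, e, J e} < 4" for w by (auto simp: card_insert_if)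
    then obtain w u where w: "w \<in> h" "w \<notin> ?K" and u: "u \<in> h" "u \<notin> span {w, e, J e}"
      using h_not_in_small_span by (metis finite.emptyI finite.insertI subsetI)
    obtain \<xi> \<eta> where ne: "(\<xi>, \<eta>) \<noteq> (0, 0)" and 0: "\<xi> * L w + \<eta> * L u = 0"
      using parallel_coefficients[of "L w" 0 "L u" 0 0 0] by auto
    have "\<xi> *\<^sub>R w + \<eta> *\<^sub>R u \<notin> ?K"
    proof
      assume "\<xi> *\<^sub>R w + \<eta> *\<^sub>R u \<in> ?K"
      then obtain a b where "\<xi> *\<^sub>R w + \<eta> *\<^sub>R u = a *\<^sub>R e + b *\<^sub>R J e" by (auto simp: in_span2)
      then have "\<eta> *\<^sub>R u + \<xi> *\<^sub>R w + (- a) *\<^sub>R e + (- b) *\<^sub>R J e = 0" by (simp add: algebra_simps)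
      from frame4_coeffs[OF frameI[OF u(1) w u(2)] this] ne show False by simp
    qed
    moreover have "\<xi> *\<^sub>R w + \<eta> *\<^sub>R u \<in> h" using w u h_closed by simp
    ultimately show ?thesis using 0 L by (intro bexI[of _ "\<xi> *\<^sub>R w + \<eta> *\<^sub>R u"]) auto
  qed
  have "\<exists>u\<in>h. \<mu> u \<noteq> 0"
  proof (rule ccontr)
    assume "\<not> ?thesis"
    then have \<mu>0: "\<mu> u = 0" if "u \<in> h" for u using that by blast
    obtain x where x: "x \<in> h" "x \<notin> ?K" "\<sigma> x = 0" using outK[of \<sigma>] lin(4,5) by blast
    have "card {x, e, J e} < 4" by (auto simp: card_insert_if)
    then obtain v where v: "v \<in> h" "v \<notin> span {x, e, J e}"
      using h_not_in_small_span by (metis finite.emptyI finite.insertI subsetI)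
    have F: "frame4 h v x e (J e)" by (rule frameI) (use v x in auto)
    obtain r p k l where X: "br (J x) x = r *\<^sub>R v + p *\<^sub>R x + k *\<^sub>R e + l *\<^sub>R J e"
      using frame4_expand[OF F br_in_h] .
    obtain s q k' l' where V: "br (J x) v = s *\<^sub>R v + q *\<^sub>R x + k' *\<^sub>R e + l' *\<^sub>R J e"
      using frame4_expand[OF F br_in_h] .
    obtain s' q' k2 l2 where XV: "br (J v) x = s' *\<^sub>R v + q' *\<^sub>R x + k2 *\<^sub>R e + l2 *\<^sub>R J e"
      using frame4_expand[OF F br_in_h] .
    obtain n m k3 l3 where VV: "br (J v) v = n *\<^sub>R v + m *\<^sub>R x + k3 *\<^sub>R e + l3 *\<^sub>R J e"
      using frame4_expand[OF F br_in_h] .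
    have D0: "br (J x) e = 0" "br (J x) (J e) = 0" using De[OF x(1)] x(3) \<mu>0[OF x(1)] by auto
    obtain a b where "br (J x) v - br (J v) x = a *\<^sub>R e + b *\<^sub>R J e"
      using comm[OF x(1) v(1)] by (auto simp: in_span2)
    then have "(s - s') *\<^sub>R v + (q - q') *\<^sub>R x + (k' - k2 - a) *\<^sub>R e + (l' - l2 - b) *\<^sub>R J e = 0"
      by (simp add: V XV algebra_simps)
    from frame4_coeffs[OF F this] have sq: "s' = s" "q' = q" by auto
    have "s + p + 0 + 0 = 0"
      by (rule trace_ad_h[OF F, of "J x" s q k' l' r p k l 0 0 0 0 0 0 0 0]) (use X V D0 in auto)
    then have s: "s = - p" by simp
    have "n + q + \<mu> v + \<mu> v = 0"
      by (rule trace_ad_h[OF F, of "J v" n m k3 l3 "- p" q k2 l2 0 0 "\<mu> v" "\<sigma> v" 0 0 "- \<sigma> v" "\<mu> v"])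
        (use XV VV De[OF v(1)] sq s in auto)
    then have n: "n = - q" using \<mu>0[OF v(1)] by simp
    have Dv: "br (J v) e = \<sigma> v *\<^sub>R J e" "br (J v) (J e) = - \<sigma> v *\<^sub>R e" using De[OF v(1)] \<mu>0[OF v(1)] by auto
    have "(2 * (p\<^sup>2 + q * r)) *\<^sub>R v + (q * p - p * q - (r * m + p * q)) *\<^sub>R x
        + (q * k - p * k' - r * k3 - p * k2 + l * \<sigma> v) *\<^sub>R e
        + (q * l - p * l' - r * l3 - p * l2 - k * \<sigma> v) *\<^sub>R J e
      = br (J x) (br (J v) x) - br (J v) (br (J x) x)"
      by (simp add: X V XV VV sq s n br_simps D0 Dv power2_eq_square scaleR_mult_numeral algebra_simps)
    also have "\<dots> = 0" using ad_commute[OF x(1)] by simp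
    \<comment> \<open>Multiplication by \<open>x\<close> on \<open>h/K\<close> has the matrix with rows \<open>p, q\<close> and
      \<open>r, -p\<close>, so its square is \<open>p\<^sup>2 + qr\<close> times the identity.\<close>
    finally have pq: "p\<^sup>2 + q * r = 0" using frame4_coeffs[OF F] by (metis mult_eq_0_iff zero_neq_numeral)
    have "J x \<in> h"
    proof (rule ad_nilpotent4_in_h)
      fix y assume "y \<in> h"
      then obtain a b c d where y: "y = a *\<^sub>R v + b *\<^sub>R x + c *\<^sub>R e + d *\<^sub>R J e"
        using frame4_expand[OF F] by metis
      have xx: "br (J x) (br (J x) x) = (p\<^sup>2 + q * r) *\<^sub>R x + (r * k' + p * k) *\<^sub>R e + (r * l' + p * l) *\<^sub>R J e"
        by (simp add: X V s br_simps D0 power2_eq_square algebra_simps)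
      have xv: "br (J x) (br (J x) v) = (p\<^sup>2 + q * r) *\<^sub>R v + (q * k - p * k') *\<^sub>R e + (q * l - p * l') *\<^sub>R J e"
        by (simp add: X V s br_simps D0 power2_eq_square algebra_simps)
      have lin: "br (J x) (u + u') = br (J x) u + br (J x) u'" "br (J x) (\<alpha> *\<^sub>R u) = \<alpha> *\<^sub>R br (J x) u"
        "br (J x) 0 = 0" for u u' \<alpha> by (rule br_simps)+
      show "br (J x) (br (J x) (br (J x) (br (J x) y))) = 0"
        unfolding y lin xx xv pq D0 by (simp only: lin D0 xx xv pq scaleR_zero_left scaleR_zero_right add_0_left add_0_right)
    qed
    with K[OF x(1)] x(2) show False by simp
  qed
  then obtain u0 where u0: "u0 \<in> h" "\<mu> u0 \<noteq> 0" by blast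
  define u where "u = (- 1 / (2 * \<mu> u0)) *\<^sub>R u0"
  have u: "u \<in> h" "\<mu> u = - 1 / 2"
    unfolding u_def lin(2) using u0 by (intro h_closed, simp_all)
  obtain w where w: "w \<in> h" "w \<notin> ?K" "\<mu> w = 0" using outK[of \<mu>] lin(1,2) by blast
  have uo: "u \<notin> span {w, e, J e}"
  proof
    assume "u \<in> span {w, e, J e}"
    then obtain a b c where "u = a *\<^sub>R w + b *\<^sub>R e + c *\<^sub>R J e" by (auto simp: in_span3)
    moreover have "\<mu> e = 0" "\<mu> (J e) = 0" by (rule \<mu>K; simp add: span_base)+
    ultimately have "\<mu> u = 0" using w(3) by (simp add: lin)
    with u(2) show False by simp
  qed
  have F: "frame4 h u w e (J e)" using frameI[OF u(1) w(1,2) uo] .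
  have \<mu>F: "\<mu> (a *\<^sub>R u + b *\<^sub>R w + c *\<^sub>R e + d *\<^sub>R J e) = - a / 2" for a b c d
    using \<mu>K[of e] \<mu>K[of "J e"] w(3) u(2) by (simp add: lin span_base)
  obtain a1 a2 a3 a4 where UU: "br (J u) u = a1 *\<^sub>R u + a2 *\<^sub>R w + a3 *\<^sub>R e + a4 *\<^sub>R J e"
    using frame4_expand[OF F br_in_h] .
  obtain b1 b2 b3 b4 where UW: "br (J u) w = b1 *\<^sub>R u + b2 *\<^sub>R w + b3 *\<^sub>R e + b4 *\<^sub>R J e"
    using frame4_expand[OF F br_in_h] .
  obtain c1 c2 c3 c4 where WU: "br (J w) u = c1 *\<^sub>R u + c2 *\<^sub>R w + c3 *\<^sub>R e + c4 *\<^sub>R J e"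
    using frame4_expand[OF F br_in_h] .
  obtain d1 d2 d3 d4 where WW: "br (J w) w = d1 *\<^sub>R u + d2 *\<^sub>R w + d3 *\<^sub>R e + d4 *\<^sub>R J e"
    using frame4_expand[OF F br_in_h] .
  \<comment> \<open>Applying the multiplicative functional \<open>-2\<mu>\<close> to the four products reads off their components
    along \<open>u\<close>.\<close>
  have 1: "a1 = 1" "b1 = 0" "c1 = 0" "d1 = 0"
    using \<mu>_mult[OF u(1) u(1)] \<mu>_mult[OF w(1) u(1)] \<mu>_mult[OF u(1) w(1)] \<mu>_mult[OF w(1) w(1)] u(2) w(3)
    unfolding UU UW WU WW \<mu>F by auto
  have De': "br (J y) e = 0 *\<^sub>R u + 0 *\<^sub>R w + \<mu> y *\<^sub>R e + \<sigma> y *\<^sub>R J e"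
    "br (J y) (J e) = 0 *\<^sub>R u + 0 *\<^sub>R w + (- \<sigma> y) *\<^sub>R e + \<mu> y *\<^sub>R J e" if "y \<in> h" for y
    using De[OF that] by auto
  have "a1 + b2 + \<mu> u + \<mu> u = 0" by (rule trace_ad_h[OF F UU UW De'[OF u(1)]])
  then have b2: "b2 = 0" using 1 u(2) by simp
  obtain a b where "br (J u) w - br (J w) u = a *\<^sub>R e + b *\<^sub>R J e"
    using comm[OF u(1) w(1)] by (auto simp: in_span2)
  then have "0 *\<^sub>R u + (b2 - c2) *\<^sub>R w + (b3 - c3 - a) *\<^sub>R e + (b4 - c4 - b) *\<^sub>R J e = 0"
    by (simp add: UW WU 1 algebra_simps)
  from frame4_coeffs[OF F this] have c2: "c2 = 0" using b2 by simp
  have "c1 + d2 + \<mu> w + \<mu> w = 0"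
    by (rule trace_ad_h[OF F WU WW De'[OF w(1)]])
  then have d2: "d2 = 0" using 1 w(3) by simp
  define s where "s = \<sigma> w"
  have Dw: "br (J w) e = s *\<^sub>R J e" "br (J w) (J e) = - s *\<^sub>R e" using De[OF w(1)] w(3) by (auto simp: s_def)
  have s: "s \<noteq> 0"
  proof
    assume "s = 0"
    have "J w \<in> h"
    proof (rule ad_triangular_in_h[OF F])
      show "br (J w) u \<in> span {w, e, J e}" unfolding WU 1 c2
        by (auto intro!: span_add span_scale intro: span_base)
      show "br (J w) w \<in> span {e, J e}" unfolding WW 1 d2
        by (auto intro!: span_add span_scale intro: span_base)
    qed (use Dw \<open>s = 0\<close> in \<open>auto simp: span_zero\<close>)
    with K[OF w(1)] w(2) show False by simp
  qed
  have Dw_inj: "t = 0" if "t \<in> ?K" "br (J w) t = 0" for t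
  proof -
    obtain a b where t: "t = a *\<^sub>R e + b *\<^sub>R J e" using \<open>t \<in> ?K\<close> by (auto simp: in_span2)
    have "(- b * s) *\<^sub>R e + (a * s) *\<^sub>R J e = 0" using that(2) by (simp add: t br_simps Dw algebra_simps)
    from J_line_independent[OF e(1) this] s show ?thesis by (simp add: t)
  qed
  \<comment> \<open>Modulo \<open>K\<close>, the element \<open>u + a2 w\<close> is idempotent and \<open>w\<close> annihilates
    the algebra. As \<open>ad (J w)\<close> is invertible on \<open>K\<close>, both can be corrected by elements
    \<open>t1\<close>, \<open>t2\<close> of \<open>K\<close> into its kernel, and \<open>ad (J f1)\<close> preserves this
    kernel.\<close>
  define t1 where "t1 = (c4 / s) *\<^sub>R e - (c3 / s) *\<^sub>R J e + a2 *\<^sub>R ((d4 / s) *\<^sub>R e - (d3 / s) *\<^sub>R J e)"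
  define t2 where "t2 = (d4 / s) *\<^sub>R e - (d3 / s) *\<^sub>R J e"
  have tK: "t1 \<in> ?K" "t2 \<in> ?K" unfolding t1_def t2_def
    by (intro span_add span_diff span_scale span_base; simp)+
  define f1 where "f1 = u + a2 *\<^sub>R w - t1"
  define f4 where "f4 = w - t2"
  have fh: "f1 \<in> h" "f4 \<in> h" using u w Kh[OF tK(1)] Kh[OF tK(2)] h_closed by (auto simp: f1_def f4_def)
  have Jt: "br (J t1) y = 0" "br (J t2) y = 0" if "y \<in> h" for y
    using abelian[OF _ that] Kh[OF tK(1)] Kh[OF tK(2)] by auto
  have D4: "br (J f4) y = br (J w) y" if "y \<in> h" for y
    using Jt[OF that] by (simp add: f4_def J_simps br_simps)
  have w1: "br (J w) f1 = 0" and w4: "br (J w) f4 = 0"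
    using s by (simp_all add: f1_def f4_def t1_def t2_def br_simps WU WW Dw 1 c2 d2 algebra_simps)
  have D14: "br (J f1) f4 = 0"
  proof (rule Dw_inj)
    have "br (J f1) f4 = b3 *\<^sub>R e + b4 *\<^sub>R J e + a2 *\<^sub>R (d3 *\<^sub>R e + d4 *\<^sub>R J e) - br (J (u + a2 *\<^sub>R w)) t2"
      using Jt(1)[OF fh(2)] by (simp add: f1_def J_simps br_simps) (simp add: f4_def br_simps UW WW 1 b2 d2 algebra_simps)
    also have "\<dots> \<in> ?K"
    proof (intro span_diff)
      show "br (J (u + a2 *\<^sub>R w)) t2 \<in> ?K" using u(1) w(1) h_closed by (intro DK tK) simp
    qed (intro span_add span_scale span_base; simp)
    finally show "br (J f1) f4 \<in> ?K" .
    show "br (J w) (br (J f1) f4) = 0" using ad_commute[OF fh(2), of "J w" "J f1"] w4 by (simp add: br_simps)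
  qed
  have D11: "br (J f1) f1 - f1 = 0"
  proof (rule Dw_inj)
    have "br (J f1) f1 - f1 = (a3 *\<^sub>R e + a4 *\<^sub>R J e) + a2 *\<^sub>R (b3 *\<^sub>R e + b4 *\<^sub>R J e)
        + a2 *\<^sub>R (c3 *\<^sub>R e + c4 *\<^sub>R J e) + (a2 * a2) *\<^sub>R (d3 *\<^sub>R e + d4 *\<^sub>R J e) + t1 - br (J (u + a2 *\<^sub>R w)) t1"
      using Jt(1)[OF fh(1)] by (simp add: f1_def J_simps br_simps) (simp add: UU UW WU WW 1 b2 c2 d2 algebra_simps)
    also have "\<dots> \<in> ?K"
    proof (intro span_diff)
      show "br (J (u + a2 *\<^sub>R w)) t1 \<in> ?K" using u(1) w(1) h_closed by (intro DK tK) simp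
    qed (intro span_add span_scale tK span_base; simp)
    finally show "br (J f1) f1 - f1 \<in> ?K" .
    show "br (J w) (br (J f1) f1 - f1) = 0"
      using ad_commute[OF fh(1), of "J w" "J f1"] w1 by (simp add: br_simps)
  qed
  have \<mu>1: "\<mu> f1 = - 1 / 2" using \<mu>K[OF tK(1)] u(2) w(3) by (simp add: f1_def lin)
  define \<tau> where "\<tau> = \<sigma> f1"
  have D1e: "br (J f1) e = (- 1 / 2) *\<^sub>R e + \<tau> *\<^sub>R J e" "br (J f1) (J e) = (- 1 / 2) *\<^sub>R J e - \<tau> *\<^sub>R e"
    using De[OF fh(1)] by (simp_all add: \<mu>1 \<tau>_def)
  have J14: "br (J f1) (J f4) = 0"
    using integrable[of f1 f4] br_skew[of f1 "J f4"] D4[OF fh(1)]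
    by (simp add: abelian[OF fh] D14 w1 J_simps)
  have F14: "frame4 h f1 e (J e) f4"
  proof (rule frame4I_coeffs[OF h_subspace dimh])
    fix a b c d assume "a *\<^sub>R f1 + b *\<^sub>R e + c *\<^sub>R J e + d *\<^sub>R f4 = 0"
    then have "a *\<^sub>R u + (a * a2 + d) *\<^sub>R w + (b - (a * (c4 / s + a2 * (d4 / s)) + d * (d4 / s))) *\<^sub>R e
        + (c + (a * (c3 / s + a2 * (d3 / s)) + d * (d3 / s))) *\<^sub>R J e = 0"
      by (simp add: f1_def f4_def t1_def t2_def algebra_simps)
    from frame4_coeffs[OF F this] show "a = 0 \<and> b = 0 \<and> c = 0 \<and> d = 0" by auto
  qed (use fh e in auto)
  \<comment> \<open>The multiple of \<open>J f4\<close> removes the rotation from the action of \<open>J f1\<close> on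
    \<open>K\<close>.\<close>
  let ?f5 = "2 *\<^sub>R J f1 - (2 * \<tau> / s) *\<^sub>R J f4" and ?f6 = "(1 / s) *\<^sub>R J f4"
  have T: "transversal h ?f5 ?f6"
    unfolding transversal_def
  proof (intro allI impI)
    fix \<alpha> \<beta>
    let ?t = "(2 * \<alpha>) *\<^sub>R f1 + ((\<beta> - 2 * \<alpha> * \<tau>) / s) *\<^sub>R f4"
    assume "\<alpha> *\<^sub>R ?f5 + \<beta> *\<^sub>R ?f6 \<in> h"
    also have "\<alpha> *\<^sub>R ?f5 + \<beta> *\<^sub>R ?f6 = J ?t"
      by (simp add: J_simps diff_divide_distrib algebra_simps)
    finally have "?t \<in> ?K" using fh h_closed by (intro K) auto
    then obtain a b where "?t = a *\<^sub>R e + b *\<^sub>R J e" by (auto simp: in_span2)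
    then have "(2 * \<alpha>) *\<^sub>R f1 + (- a) *\<^sub>R e + (- b) *\<^sub>R J e + ((\<beta> - 2 * \<alpha> * \<tau>) / s) *\<^sub>R f4 = 0"
      by (simp add: algebra_simps)
    from frame4_coeffs[OF F14 this] s show "\<alpha> = 0 \<and> \<beta> = 0" by auto
  qed
  show ?thesis
  proof (rule lie_iso_g535_R_of_basis[OF F14 T nilradical_abelian])
    show "br ?f5 f1 = 2 *\<^sub>R f1" using D11 D4[OF fh(1)] w1 by (simp add: br_simps)
    show "br ?f5 e = - e" using s D4[OF e(2)] by (simp add: br_simps D1e Dw algebra_simps)
    show "br ?f5 (J e) = - J e" using s D4[OF e(3)] by (simp add: br_simps D1e Dw algebra_simps)
    show "br ?f5 f4 = 0" using D14 D4[OF fh(2)] w4 by (simp add: br_simps)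
    show "br ?f6 f1 = 0" using D4[OF fh(1)] w1 by (simp add: br_simps)
    show "br ?f6 e = J e" using s D4[OF e(2)] by (simp add: br_simps Dw)
    show "br ?f6 (J e) = - e" using s D4[OF e(3)] by (simp add: br_simps Dw)
    show "br ?f6 f4 = 0" using D4[OF fh(2)] w4 by (simp add: br_simps)
    show "br ?f5 ?f6 = 0" by (simp add: br_simps br_self J14)
  qed
qed

end

section \<open>Nilradicals that are complex subspaces\<close>

context skt_codim2
begin

text \<open>
  The operators \<open>J\<close> and \<open>S = ad n\<close> are commuting square roots of \<open>-1\<close>, so \<open>h\<close> is the sum of the spaces where \<open>S = -J\<close> and
  \<open>S = J\<close>. Neither of them is zero, as that would put \<open>n + m\<close> or \<open>n - m\<close> into \<open>h\<close>. Half the difference and half the sum of \<open>m\<close> and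
  \<open>n\<close> each rotate one space and annihilate the other.
\<close>

lemma lie_iso_tau30_tau30_of_involutions:
  assumes Jh: "\<And>y. y \<in> h \<Longrightarrow> J y \<in> h" and T: "transversal h m n"
    and m: "\<And>y. y \<in> h \<Longrightarrow> br m y = J y"
    and n: "\<And>y. y \<in> h \<Longrightarrow> br n (br n y) = - y" "\<And>y. y \<in> h \<Longrightarrow> br n (J y) = J (br n y)"
  shows "lie_iso br tau30_tau30"
proof -
  have T1: "n - m \<notin> h" "n + m \<notin> h"
    using transversal_combination[OF h_subspace T, of "-1" 1] transversal_combination[OF h_subspace T, of 1 1]
    by (auto simp: add.commute)
  have nh: "br n y \<in> h" for y by (rule br_in_h)
  have "\<exists>v\<in>h. v + br n (J v) \<noteq> 0"
  proof (rule ccontr)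
    assume "\<not> ?thesis"
    then have 0: "v + br n (J v) = 0" if "v \<in> h" for v using that by blast
    have "br (n - m) y = 0" if "y \<in> h" for y
      using 0[OF Jh[OF that]] m[OF that] by (simp add: JJ br_simps)
    then have "n - m \<in> h" by (intro ad_nilpotent4_in_h) (simp add: br_simps)
    with T1 show False by simp
  qed
  then obtain v where v: "v \<in> h" "v + br n (J v) \<noteq> 0" by blast
  have "\<exists>v\<in>h. v - br n (J v) \<noteq> 0"
  proof (rule ccontr)
    assume "\<not> ?thesis"
    then have 0: "v - br n (J v) = 0" if "v \<in> h" for v using that by blast
    have "br (n + m) y = 0" if "y \<in> h" for y
      using 0[OF Jh[OF that]] m[OF that] by (simp add: JJ br_simps add.commute)
    then have "n + m \<in> h" by (intro ad_nilpotent4_in_h) (simp add: br_simps)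
    with T1 show False by simp
  qed
  then obtain w where w: "w \<in> h" "w - br n (J w) \<noteq> 0" by blast
  define f1 where "f1 = v + br n (J v)"
  define f3 where "f3 = w - br n (J w)"
  have f: "f1 \<noteq> 0" "f3 \<noteq> 0" "f1 \<in> h" "f3 \<in> h" "J f1 \<in> h" "J f3 \<in> h"
    using v w nh h_closed Jh by (auto simp: f1_def f3_def)
  have nJ: "br n (J (br n (J y))) = y" if "y \<in> h" for y
    using n(2)[OF Jh[OF that]] n(2)[OF that] n(1)[OF that] n(2)[OF nh, of "J y"] n(1)[OF Jh[OF that]]
    by (simp add: JJ J_simps br_simps)
  have "br n (J f1) = f1" "br n (J f3) = - f3"
    using nJ[OF v(1)] nJ[OF w(1)] by (simp_all add: f1_def f3_def J_simps br_simps add.commute)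
  moreover from this have n1: "br n f1 = - J f1" and n3: "br n f3 = J f3"
    using n(1)[OF f(5)] n(1)[OF f(6)] by (simp_all add: br_simps)
  ultimately have nf: "br n f1 = - J f1" "br n (J f1) = f1" "br n f3 = J f3" "br n (J f3) = - f3"
    by auto
  have mf: "br m f1 = J f1" "br m (J f1) = - f1" "br m f3 = J f3" "br m (J f3) = - f3"
    using m f by (simp_all add: JJ)
  have "f1 \<notin> span {f3, J f3}"
  proof
    assume "f1 \<in> span {f3, J f3}"
    then obtain a b where ab: "f1 = a *\<^sub>R f3 + b *\<^sub>R J f3" by (auto simp: in_span2)
    have "br n (J f1) = - f1" unfolding ab by (simp add: J_simps JJ br_simps nf)
    then have "f1 = - f1" using nf(2) by simp
    then have "2 *\<^sub>R f1 = 0" by (metis scaleR_2 add.right_inverse)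
    with f(1) show False by simp
  qed
  then have F: "frame4 h f1 (J f1) f3 (J f3)"
    using f J_pair_independent[OF f(2)] by (intro frame4I_coeffs[OF h_subspace dimh]) auto
  define x where "x = (1/2) *\<^sub>R (m - n)"
  define y where "y = (1/2) *\<^sub>R (m + n)"
  have half: "(1/2) *\<^sub>R (a + a) = a" for a :: 'a
    by (simp only: scaleR_2[symmetric] scaleR_scaleR) simp
  have x: "br x f1 = J f1" "br x (J f1) = - f1" "br x f3 = 0" "br x (J f3) = 0"
    using half[of "J f1"] half[of "- f1"] by (simp_all add: x_def br_simps mf nf)
  have y: "br y f1 = 0" "br y (J f1) = 0" "br y f3 = J f3" "br y (J f3) = - f3"
    using half[of "J f3"] half[of "- f3"] by (simp_all add: y_def br_simps mf nf)
  obtain a b c d where xy: "br x y = a *\<^sub>R f1 + b *\<^sub>R J f1 + c *\<^sub>R f3 + d *\<^sub>R J f3"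
    using frame4_expand[OF F br_in_h] .
  \<comment> \<open>The corrections by elements of \<open>h\<close> make the bracket of the two rotations vanish.\<close>
  define x' where "x' = x + (d *\<^sub>R f3 - c *\<^sub>R J f3)"
  define y' where "y' = y + (a *\<^sub>R J f1 - b *\<^sub>R f1)"
  have ab0: "br u u' = 0" if "u \<in> {f1, J f1, f3, J f3}" "u' \<in> {f1, J f1, f3, J f3}" for u u'
    using that f abelian by auto
  show ?thesis
  proof (rule lie_iso_tau30_tau30_of_basis[OF F _ nilradical_abelian])
    show "transversal h x' y'"
      unfolding transversal_def
    proof (intro allI impI)
      fix \<alpha> \<beta> assume *: "\<alpha> *\<^sub>R x' + \<beta> *\<^sub>R y' \<in> h"
      have "((\<alpha> + \<beta>) / 2) *\<^sub>R m + ((\<beta> - \<alpha>) / 2) *\<^sub>R n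
          = (\<alpha> *\<^sub>R x' + \<beta> *\<^sub>R y') - (\<alpha> *\<^sub>R (d *\<^sub>R f3 - c *\<^sub>R J f3) + \<beta> *\<^sub>R (a *\<^sub>R J f1 - b *\<^sub>R f1))"
        by (simp add: x'_def y'_def x_def y_def algebra_simps add_divide_distrib diff_divide_distrib)
      also have "\<dots> \<in> h" using f by (intro h_closed(4)[OF *] h_closed)
      finally have "(\<alpha> + \<beta>) / 2 = 0 \<and> (\<beta> - \<alpha>) / 2 = 0" using T unfolding transversal_def by blast
      then show "\<alpha> = 0 \<and> \<beta> = 0" by auto
    qed
    show "br x' f1 = J f1" "br x' (J f1) = - f1" "br x' f3 = 0" "br x' (J f3) = 0"
      "br y' f1 = 0" "br y' (J f1) = 0" "br y' f3 = J f3" "br y' (J f3) = - f3"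
      by (simp_all add: x'_def y'_def br_simps x y ab0)
    have "br f3 y = - J f3" "br (J f3) y = f3" using br_skew[of f3 y] br_skew[of "J f3" y] y by auto
    then show "br x' y' = 0"
      by (simp add: x'_def y'_def br_simps x y xy ab0 algebra_simps)
  qed
qed

text \<open>
  This is the closedness of the torsion on \<open>e, Je, X, Y\<close>. On the abelian complex subspace \<open>h\<close> the torsion itself vanishes, so the
  bracket \<open>[e,Je]\<close> drops out.
\<close>

lemma invariant_torsion_identity:
  assumes Jh: "\<And>y. y \<in> h \<Longrightarrow> J y \<in> h" and X: "X \<in> h" and Y: "Y \<in> h"
  shows "g (br e (J Y)) (br e X) - g (br e (J (br e X))) Y
    - g (br e (J X)) (br e Y) + g (br e (J (br e Y))) X
    + g (br (J e) (J Y)) (br (J e) X) - g (br (J e) (J (br (J e) X))) Y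
    - g (br (J e) (J X)) (br (J e) Y) + g (br (J e) (J (br (J e) Y))) X = 0"
proof -
  have t1: "torsion u (J e) v = g (br e (J v)) u - g (br e (J u)) v" if "u \<in> h" "v \<in> h" for u v
    using abelian[OF Jh[OF that(2)] Jh[OF that(1)]] br_skew[of "J u" e]
    by (simp add: torsion_eq JJ br_simps g_simps)
  have t2: "torsion u e v = g (br (J e) (J u)) v - g (br (J e) (J v)) u" if "u \<in> h" "v \<in> h" for u v
    using abelian[OF Jh[OF that(2)] Jh[OF that(1)]] br_skew[of "J u" "J e"]
    by (simp add: torsion_eq g_simps)
  have t3: "torsion u v w = 0" if "u \<in> h" "v \<in> h" "w \<in> h" for u v w
    using abelian Jh that by (simp add: torsion_eq g_simps)
  show ?thesis
    using torsion_closed[of e "J e" X Y] t3[OF br_in_h X Y] abelian[OF X Y]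
    by (simp add: t1 t2 X Y br_in_h torsion_simps)
qed

lemma normalize:
  assumes "v \<noteq> 0"
  obtains c where "c \<noteq> 0" "g (c *\<^sub>R v) (c *\<^sub>R v) = 1"
proof (rule that)
  have p: "g v v > 0" using assms by (rule g_pos)
  then show "1 / sqrt (g v v) \<noteq> 0" by simp
  show "g ((1 / sqrt (g v v)) *\<^sub>R v) ((1 / sqrt (g v v)) *\<^sub>R v) = 1"
    using p by (simp add: g_simps)
qed

text \<open>
  The identity \<open>invariant_torsion_identity\<close>, summed over the \<open>J\<close>-lines of a unitary basis \<open>e1, e2 = J e1, e3, e4 = J e3\<close>, is a negative multiple of
  the squared norm of the skew parts of \<open>AJ\<close> and \<open>BJ\<close>, where \<open>A = ad e5\<close> and \<open>B = ad (J e5)\<close>. Once these vanish, integrability determines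
  the antilinear part of \<open>B\<close> as \<open>J\<close> times that of \<open>A\<close>, and the trace of \<open>J(AB - BA) = 0\<close> is a multiple of the squared norm of the
  latter. So \<open>A\<close> and \<open>B\<close> are skew-Hermitian.
\<close>

lemma lie_iso_tau30_tau30:
  assumes Jh: "\<And>y. y \<in> h \<Longrightarrow> J y \<in> h"
  shows "lie_iso br tau30_tau30"
proof -
  obtain e where e: "e \<noteq> 0" "e \<in> h" using exists_J_line by metis
  obtain c0 where "c0 \<noteq> 0" "g (c0 *\<^sub>R e) (c0 *\<^sub>R e) = 1" by (rule normalize[OF e(1)])
  then obtain e1 where e1: "e1 \<in> h" "g e1 e1 = 1" using e h_closed by blast
  have e1_0: "e1 \<noteq> 0" using e1 by (auto simp: g_simps)
  define e2 where "e2 = J e1"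
  have "card {e1, e2} < 4" by (auto simp: card_insert_if)
  then obtain f where f: "f \<in> h" "f \<notin> span {e1, e2}"
    using h_not_in_small_span by (metis finite.emptyI finite.insertI subsetI)
  define f' where "f' = f - g f e1 *\<^sub>R e1 - g f e2 *\<^sub>R e2"
  have e2: "e2 \<in> h" using Jh[OF e1(1)] by (simp add: e2_def)
  have "f' \<noteq> 0"
  proof
    assume "f' = 0"
    then have "f = g f e1 *\<^sub>R e1 + g f e2 *\<^sub>R e2" by (simp add: f'_def algebra_simps)
    with f(2) show False unfolding in_span2 by blast
  qed
  then obtain c where c: "c \<noteq> 0" "g (c *\<^sub>R f') (c *\<^sub>R f') = 1" by (rule normalize)
  define e3 where "e3 = c *\<^sub>R f'"
  define e4 where "e4 = J e3"
  have J: "J e1 = e2" "J e2 = - e1" "J e3 = e4" "J e4 = - e3" by (simp_all add: e2_def e4_def JJ)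
  have e3: "e3 \<in> h" using f e1 e2 h_closed by (simp add: e3_def f'_def)
  have e4: "e4 \<in> h" using Jh[OF e3] by (simp add: e4_def)
  have g11: "g e1 e1 = 1" "g e2 e2 = 1" "g e1 e2 = 0" "g e2 e1 = 0"
    using e1 by (auto simp: e2_def g_JJ g_J_self)
  have g31: "g e3 e1 = 0" "g e3 e2 = 0" by (simp_all add: e3_def f'_def g_simps g11)
  have g41: "g e4 e1 = 0" "g e4 e2 = 0"
    using g_JJ[of e3 e2] g_JJ[of e3 e1] g31 by (simp_all add: J g_simps)
  have G: "g e1 e1 = 1" "g e2 e2 = 1" "g e3 e3 = 1" "g e4 e4 = 1"
    "g e1 e2 = 0" "g e2 e1 = 0" "g e1 e3 = 0" "g e3 e1 = 0" "g e1 e4 = 0" "g e4 e1 = 0"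
    "g e2 e3 = 0" "g e3 e2 = 0" "g e2 e4 = 0" "g e4 e2 = 0" "g e3 e4 = 0" "g e4 e3 = 0"
    using g11 g31 g41 c(2) g_sym[of e1 e3] g_sym[of e2 e3] g_sym[of e1 e4] g_sym[of e2 e4]
    by (auto simp: e3_def[symmetric] e4_def g_JJ g_J_self)
  have F: "frame4 h e1 e2 e3 e4"
  proof (rule frame4I_coeffs[OF h_subspace dimh])
    fix \<alpha> \<beta> \<gamma> \<delta> assume *: "\<alpha> *\<^sub>R e1 + \<beta> *\<^sub>R e2 + \<gamma> *\<^sub>R e3 + \<delta> *\<^sub>R e4 = 0"
    have "g (\<alpha> *\<^sub>R e1 + \<beta> *\<^sub>R e2 + \<gamma> *\<^sub>R e3 + \<delta> *\<^sub>R e4) u = 0" for u unfolding * by (simp add: g_simps)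
    from this[of e1] this[of e2] this[of e3] this[of e4] show "\<alpha> = 0 \<and> \<beta> = 0 \<and> \<gamma> = 0 \<and> \<delta> = 0"
      by (simp add: g_simps G)
  qed (use e1 e2 e3 e4 in auto)
  obtain u0 v0 where "transversal h u0 v0" using transversal_exists[OF h_subspace dimh dimU] .
  then obtain e5 where e5: "e5 \<notin> h" using transversal_notin[OF h_subspace] by blast
  let ?A = "br e5" and ?B = "br (J e5)"
  have T: "transversal h e5 (J e5)"
    unfolding transversal_def
  proof (intro allI impI)
    fix \<alpha> \<beta> assume *: "\<alpha> *\<^sub>R e5 + \<beta> *\<^sub>R J e5 \<in> h"
    have "\<alpha> *\<^sub>R (\<alpha> *\<^sub>R e5 + \<beta> *\<^sub>R J e5) - \<beta> *\<^sub>R J (\<alpha> *\<^sub>R e5 + \<beta> *\<^sub>R J e5) \<in> h"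
      by (rule h_closed(4)[OF h_closed(2)[OF *] h_closed(2)[OF Jh[OF *]]])
    then have "(\<alpha>\<^sup>2 + \<beta>\<^sup>2) *\<^sub>R e5 + 0 \<in> h"
      by (simp add: J_simps JJ power2_eq_square algebra_simps)
    from subspace_coeff_zero[OF h_subspace e5 this] h_closed have "\<alpha>\<^sup>2 + \<beta>\<^sup>2 = 0" by simp
    then show "\<alpha> = 0 \<and> \<beta> = 0" by simp
  qed
  obtain a11 a21 a31 a41 where A1: "?A e1 = a11 *\<^sub>R e1 + a21 *\<^sub>R e2 + a31 *\<^sub>R e3 + a41 *\<^sub>R e4"
    using frame4_expand[OF F br_in_h] .
  obtain a12 a22 a32 a42 where A2: "?A e2 = a12 *\<^sub>R e1 + a22 *\<^sub>R e2 + a32 *\<^sub>R e3 + a42 *\<^sub>R e4"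
    using frame4_expand[OF F br_in_h] .
  obtain a13 a23 a33 a43 where A3: "?A e3 = a13 *\<^sub>R e1 + a23 *\<^sub>R e2 + a33 *\<^sub>R e3 + a43 *\<^sub>R e4"
    using frame4_expand[OF F br_in_h] .
  obtain a14 a24 a34 a44 where A4: "?A e4 = a14 *\<^sub>R e1 + a24 *\<^sub>R e2 + a34 *\<^sub>R e3 + a44 *\<^sub>R e4"
    using frame4_expand[OF F br_in_h] .
  obtain b11 b21 b31 b41 where B1: "?B e1 = b11 *\<^sub>R e1 + b21 *\<^sub>R e2 + b31 *\<^sub>R e3 + b41 *\<^sub>R e4"
    using frame4_expand[OF F br_in_h] .
  obtain b12 b22 b32 b42 where B2: "?B e2 = b12 *\<^sub>R e1 + b22 *\<^sub>R e2 + b32 *\<^sub>R e3 + b42 *\<^sub>R e4"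
    using frame4_expand[OF F br_in_h] .
  obtain b13 b23 b33 b43 where B3: "?B e3 = b13 *\<^sub>R e1 + b23 *\<^sub>R e2 + b33 *\<^sub>R e3 + b43 *\<^sub>R e4"
    using frame4_expand[OF F br_in_h] .
  obtain b14 b24 b34 b44 where B4: "?B e4 = b14 *\<^sub>R e1 + b24 *\<^sub>R e2 + b34 *\<^sub>R e3 + b44 *\<^sub>R e4"
    using frame4_expand[OF F br_in_h] .
  note AB = A1 A2 A3 A4 B1 B2 B3 B4
  have int: "?B (J y) = ?A y + J (?A (J y)) + J (?B y)" for y
  proof -
    have "?B (J y) = - br (J y) (J e5)" by (rule br_skew)
    also have "\<dots> = - br y e5 - J (br (J y) e5 + br y (J e5))" by (simp add: integrable[of y e5])
    also have "\<dots> = ?A y + J (?A (J y) + ?B y)"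
      using br_skew[of e5 y] br_skew[of e5 "J y"] br_skew[of "J e5" y] by (simp add: J_simps)
    finally show ?thesis by (simp add: J_simps)
  qed
  have "b12 *\<^sub>R e1 + b22 *\<^sub>R e2 + b32 *\<^sub>R e3 + b42 *\<^sub>R e4 = (a11 - a22 - b21) *\<^sub>R e1
      + (a21 + a12 + b11) *\<^sub>R e2 + (a31 - a42 - b41) *\<^sub>R e3 + (a41 + a32 + b31) *\<^sub>R e4"
    using int[of e1] by (simp add: J AB J_simps algebra_simps)
  from frame4_coeffs_eq[OF F this]
  have I1: "b12 = a11 - a22 - b21" "b22 = a21 + a12 + b11" "b32 = a31 - a42 - b41" "b42 = a41 + a32 + b31"
    by auto
  have "b14 *\<^sub>R e1 + b24 *\<^sub>R e2 + b34 *\<^sub>R e3 + b44 *\<^sub>R e4 = (a13 - a24 - b23) *\<^sub>R e1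
      + (a23 + a14 + b13) *\<^sub>R e2 + (a33 - a44 - b43) *\<^sub>R e3 + (a43 + a34 + b33) *\<^sub>R e4"
    using int[of e3] by (simp add: J AB J_simps algebra_simps)
  from frame4_coeffs_eq[OF F this]
  have I2: "b14 = a13 - a24 - b23" "b24 = a23 + a14 + b13" "b34 = a33 - a44 - b43" "b44 = a43 + a34 + b33"
    by auto
  \<comment> \<open>Twice the squared norm of the skew part of \<open>AJ\<close>, in terms of the entries of
    \<open>A\<close>.\<close>
  let ?q = "\<lambda>a11 a22 a32 a14 a13 a42 a24 a31 a41 a23 a33 a44 :: real. (a11 + a22)\<^sup>2 + (a32 - a14)\<^sup>2
    + (a13 + a42)\<^sup>2 + (a24 + a31)\<^sup>2 + (a41 - a23)\<^sup>2 + (a33 + a44)\<^sup>2"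
  have "?q a11 a22 a32 a14 a13 a42 a24 a31 a41 a23 a33 a44 + ?q b11 b22 b32 b14 b13 b42 b24 b31 b41 b23 b33 b44 = 0"
    using invariant_torsion_identity[OF Jh e1(1) e2, of e5] invariant_torsion_identity[OF Jh e3 e4, of e5]
    by (simp add: J AB J_simps br_simps g_simps G power2_eq_square algebra_simps)
  then have "a22 = - a11" "a32 = a14" "a42 = - a13" "a31 = - a24" "a41 = a23" "a44 = - a33"
    "b22 = - b11" "b32 = b14" "b42 = - b13" "b31 = - b24" "b41 = b23" "b44 = - b33"
    by (smt (verit) zero_le_power2 zero_eq_power2)+
  note sym = this
  have bb: "b11 = - (a12 + a21) / 2" "b12 = 2 * a11 - b21" "b33 = - (a34 + a43) / 2" "b34 = 2 * a33 - b43"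
    using I1 I2 sym by auto
  have com: "g (?A (?B y)) u = g (?B (?A y)) u" if "y \<in> h" for y u using ad_commute[OF that] by simp
  \<comment> \<open>The trace of \<open>J(AB - BA)\<close>; the squared terms are the entries of the antilinear part of
    \<open>A\<close>.\<close>
  have "4 * a11\<^sup>2 + (a12 + a21)\<^sup>2 + 4 * a33\<^sup>2 + (a34 + a43)\<^sup>2 + 2 * (a13 - a24)\<^sup>2 + 2 * (a14 + a23)\<^sup>2 = 0"
    using com[OF e1(1), of e2] com[OF e2, of e1] com[OF e3, of e4] com[OF e4, of e3]
    by (simp add: AB br_simps g_simps G sym bb I2(1,2) power2_eq_square field_simps)
  then have "a11 = 0" "a12 = - a21" "a33 = 0" "a34 = - a43" "a24 = a13" "a14 = - a23"
    by (smt (verit) zero_le_power2 zero_eq_power2)+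
  note anti = this
  have A: "?A e1 = a21 *\<^sub>R e2 + (- a13) *\<^sub>R e3 + a23 *\<^sub>R e4" "?A e2 = (- a21) *\<^sub>R e1 + (- a23) *\<^sub>R e3 + (- a13) *\<^sub>R e4"
    "?A e3 = a13 *\<^sub>R e1 + a23 *\<^sub>R e2 + a43 *\<^sub>R e4" "?A e4 = (- a23) *\<^sub>R e1 + a13 *\<^sub>R e2 + (- a43) *\<^sub>R e3"
    using AB by (simp_all add: sym anti)
  have B: "?B e1 = b21 *\<^sub>R e2 + (- b13) *\<^sub>R e3 + b23 *\<^sub>R e4" "?B e2 = (- b21) *\<^sub>R e1 + (- b23) *\<^sub>R e3 + (- b13) *\<^sub>R e4"
    "?B e3 = b13 *\<^sub>R e1 + b23 *\<^sub>R e2 + b43 *\<^sub>R e4" "?B e4 = (- b23) *\<^sub>R e1 + b13 *\<^sub>R e2 + (- b43) *\<^sub>R e3"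
    using AB by (simp_all add: sym anti bb I2)
  \<comment> \<open>The commutator of \<open>A\<close> and \<open>B\<close> is the cross product of their
    \<open>\<ss>\<uu>(2)\<close> components. Hence some combination \<open>x\<close> is a multiple of \<open>J\<close>, and a
    second one, freed of its multiple of \<open>J\<close>, gives \<open>z\<close> in \<open>\<ss>\<uu>(2)\<close>, whose square is
    a negative scalar.\<close>
  have "(a21 - a43) * b13 = (b21 - b43) * a13" "(a21 - a43) * b23 = (b21 - b43) * a23" "a13 * b23 = b13 * a23"
    using com[OF e1(1), of e4] com[OF e1(1), of e3] com[OF e1(1), of e2]
    by (simp_all add: A B br_simps g_simps G algebra_simps)
  then obtain \<xi> \<eta> where ne: "(\<xi>, \<eta>) \<noteq> (0, 0)" and par: "\<xi> * (a21 - a43) + \<eta> * (b21 - b43) = 0"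
    "\<xi> * a13 + \<eta> * b13 = 0" "\<xi> * a23 + \<eta> * b23 = 0"
    by (rule parallel_coefficients)
  define x where "x = \<xi> *\<^sub>R e5 + \<eta> *\<^sub>R J e5"
  define r where "r = \<xi> * a21 + \<eta> * b21"
  have r': "\<xi> * a43 + \<eta> * b43 = r" using par(1) by (simp add: r_def algebra_simps)
  have x: "br x y = r *\<^sub>R J y" if yh: "y \<in> h" for y
  proof -
    obtain k l m n where y: "y = k *\<^sub>R e1 + l *\<^sub>R e2 + m *\<^sub>R e3 + n *\<^sub>R e4"
      using frame4_expand[OF F yh] .
    have "br x e1 = (\<xi> * a21 + \<eta> * b21) *\<^sub>R e2 - (\<xi> * a13 + \<eta> * b13) *\<^sub>R e3 + (\<xi> * a23 + \<eta> * b23) *\<^sub>R e4"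
      "br x e2 = - ((\<xi> * a21 + \<eta> * b21) *\<^sub>R e1) - (\<xi> * a23 + \<eta> * b23) *\<^sub>R e3 - (\<xi> * a13 + \<eta> * b13) *\<^sub>R e4"
      "br x e3 = (\<xi> * a13 + \<eta> * b13) *\<^sub>R e1 + (\<xi> * a23 + \<eta> * b23) *\<^sub>R e2 + (\<xi> * a43 + \<eta> * b43) *\<^sub>R e4"
      "br x e4 = - ((\<xi> * a23 + \<eta> * b23) *\<^sub>R e1) + (\<xi> * a13 + \<eta> * b13) *\<^sub>R e2 - (\<xi> * a43 + \<eta> * b43) *\<^sub>R e3"
      by (simp_all add: x_def A B br_simps algebra_simps)
    then have "br x e1 = r *\<^sub>R e2" "br x e2 = - (r *\<^sub>R e1)" "br x e3 = r *\<^sub>R e4" "br x e4 = - (r *\<^sub>R e3)"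
      unfolding par(2,3) r' r_def[symmetric] by simp_all
    then show ?thesis by (simp add: y br_simps J_simps J algebra_simps)
  qed
  have xh: "x \<notin> h" unfolding x_def by (rule transversal_combination[OF h_subspace T ne])
  have r: "r \<noteq> 0"
  proof
    assume "r = 0"
    then have "x \<in> h" using x by (intro ad_nilpotent4_in_h) (simp add: br_simps)
    with xh show False by simp
  qed
  define a where "a = \<xi> * b21 - \<eta> * a21"
  define a' where "a' = \<xi> * b43 - \<eta> * a43"
  define p where "p = \<eta> * a13 - \<xi> * b13"
  define q where "q = \<xi> * b23 - \<eta> * a23"
  define c where "c = (a - a') / 2"
  define k where "k = (a + a') / 2"
  define x' where "x' = (k / r) *\<^sub>R x"
  define z where "z = \<xi> *\<^sub>R J e5 - \<eta> *\<^sub>R e5 - x'"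
  have x': "br x' e1 = k *\<^sub>R e2" "br x' e2 = - (k *\<^sub>R e1)" "br x' e3 = k *\<^sub>R e4" "br x' e4 = - (k *\<^sub>R e3)"
    using x e1 e2 e3 e4 r by (simp_all add: x'_def br_simps J)
  have half: "\<xi> * b21 = c + k + \<eta> * a21" "\<xi> * b43 = k - c + \<eta> * a43"
    by (simp_all add: c_def k_def a_def a'_def field_simps)
  have z: "br z e1 = c *\<^sub>R e2 + p *\<^sub>R e3 + q *\<^sub>R e4" "br z e2 = - (c *\<^sub>R e1) - q *\<^sub>R e3 + p *\<^sub>R e4"
    "br z e3 = - (p *\<^sub>R e1) + q *\<^sub>R e2 - c *\<^sub>R e4" "br z e4 = - (q *\<^sub>R e1) - p *\<^sub>R e2 + c *\<^sub>R e3"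
    by (simp_all add: z_def A B br_simps x' half p_def q_def algebra_simps)
  have zsq: "br z (br z y) = - ((c\<^sup>2 + p\<^sup>2 + q\<^sup>2) *\<^sub>R y)" if yh: "y \<in> h" for y
  proof -
    obtain k l m n where y: "y = k *\<^sub>R e1 + l *\<^sub>R e2 + m *\<^sub>R e3 + n *\<^sub>R e4"
      using frame4_expand[OF F yh] .
    show ?thesis by (simp add: y br_simps z power2_eq_square algebra_simps)
  qed
  have zJ: "br z (J y) = J (br z y)" if yh: "y \<in> h" for y
  proof -
    obtain k l m n where y: "y = k *\<^sub>R e1 + l *\<^sub>R e2 + m *\<^sub>R e3 + n *\<^sub>R e4"
      using frame4_expand[OF F yh] .
    show ?thesis by (simp add: y br_simps z J_simps J algebra_simps)
  qed
  have Txz: "\<alpha> = 0 \<and> \<beta> = 0" if "\<alpha> *\<^sub>R x + \<beta> *\<^sub>R z \<in> h" for \<alpha> \<beta>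
  proof -
    let ?\<gamma> = "\<alpha> - \<beta> * (k / r)"
    have "\<alpha> *\<^sub>R x + \<beta> *\<^sub>R z = (?\<gamma> * \<xi> - \<beta> * \<eta>) *\<^sub>R e5 + (?\<gamma> * \<eta> + \<beta> * \<xi>) *\<^sub>R J e5"
      by (simp add: x_def z_def x'_def algebra_simps)
    with that have "(?\<gamma> * \<xi> - \<beta> * \<eta>) *\<^sub>R e5 + (?\<gamma> * \<eta> + \<beta> * \<xi>) *\<^sub>R J e5 \<in> h" by metis
    with T have 0: "?\<gamma> * \<xi> - \<beta> * \<eta> = 0" "?\<gamma> * \<eta> + \<beta> * \<xi> = 0"
      unfolding transversal_def by blast+
    have "\<beta> * (\<xi>\<^sup>2 + \<eta>\<^sup>2) = \<xi> * (?\<gamma> * \<eta> + \<beta> * \<xi>) - \<eta> * (?\<gamma> * \<xi> - \<beta> * \<eta>)"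
      by (simp add: power2_eq_square algebra_simps)
    then have "\<beta> * (\<xi>\<^sup>2 + \<eta>\<^sup>2) = 0" unfolding 0 by simp
    then have "\<beta> = 0" using ne by auto
    with 0 ne show ?thesis by auto
  qed
  have \<nu>: "c\<^sup>2 + p\<^sup>2 + q\<^sup>2 > 0"
  proof (rule ccontr)
    assume "\<not> ?thesis"
    then have "c\<^sup>2 + p\<^sup>2 + q\<^sup>2 = 0" by (smt (verit) zero_le_power2)
    then have "z \<in> h" using zsq by (intro ad_nilpotent4_in_h) (simp add: br_simps)
    with Txz[of 0 1] show False by simp
  qed
  define \<nu> where "\<nu> = sqrt (c\<^sup>2 + p\<^sup>2 + q\<^sup>2)"
  have \<nu>': "\<nu> \<noteq> 0" "c\<^sup>2 + p\<^sup>2 + q\<^sup>2 = \<nu> * \<nu>" using \<nu> by (auto simp: \<nu>_def)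
  show ?thesis
  proof (rule lie_iso_tau30_tau30_of_involutions[OF Jh])
    show "transversal h ((1 / r) *\<^sub>R x) ((1 / \<nu>) *\<^sub>R z)"
      unfolding transversal_def
    proof (intro allI impI)
      fix \<alpha> \<beta> assume "\<alpha> *\<^sub>R (1 / r) *\<^sub>R x + \<beta> *\<^sub>R (1 / \<nu>) *\<^sub>R z \<in> h"
      then show "\<alpha> = 0 \<and> \<beta> = 0" using Txz[of "\<alpha> / r" "\<beta> / \<nu>"] r \<nu>'(1) by simp
    qed
    show "br ((1 / r) *\<^sub>R x) y = J y" if "y \<in> h" for y using x[OF that] r by (simp add: br_simps)
    show "br ((1 / \<nu>) *\<^sub>R z) (br ((1 / \<nu>) *\<^sub>R z) y) = - y" if "y \<in> h" for y
      using zsq[OF that] \<nu>' by (simp add: br_simps)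
    show "br ((1 / \<nu>) *\<^sub>R z) (J y) = J (br ((1 / \<nu>) *\<^sub>R z) y)" if "y \<in> h" for y
      using zJ[OF that] by (simp add: br_simps J_simps)
  qed
qed

end

section \<open>Transport of structure and the explicit examples\<close>

context skt_codim2
begin

theorem lie_iso_model: "lie_iso br tau30_tau30 \<or> lie_iso br g535_R"
  using lie_iso_tau30_tau30 lie_iso_g535_R by blast

end

lemma skt_structure_pullback:
  fixes br :: "'a::real_vector \<Rightarrow> 'a \<Rightarrow> 'a" and br' :: "'b::real_vector \<Rightarrow> 'b \<Rightarrow> 'b"
  assumes iso: "lie_iso br br'" and skt: "skt_structure br' J g"
  shows "\<exists>J g. skt_structure br J g"
proof -
  obtain \<phi> where \<phi>: "linear \<phi>" "bij \<phi>" "\<And>x y. \<phi> (br x y) = br' (\<phi> x) (\<phi> y)"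
    using iso unfolding lie_iso_def by blast
  define \<psi> where "\<psi> = inv \<phi>"
  have inv: "\<phi> (\<psi> y) = y" "\<psi> (\<phi> x) = x" for x y
    using \<phi>(2) by (auto simp: \<psi>_def bij_def surj_f_inv_f)
  have inj: "\<phi> x = \<phi> y \<Longrightarrow> x = y" for x y using \<phi>(2) by (auto simp: bij_def inj_def)
  have phi0: "\<phi> x = 0 \<longleftrightarrow> x = 0" for x using inj[of x 0] linear_0[OF \<phi>(1)] by auto
  note lin = linear_add[OF \<phi>(1)] linear_scale[OF \<phi>(1)] linear_neg[OF \<phi>(1)] linear_diff[OF \<phi>(1)]
  have J: "linear J" "\<And>x. J (J x) = - x"
    "\<And>x y. br' x y + J (br' (J x) y + br' x (J y)) - br' (J x) (J y) = 0"
    and g: "bilinear g" "\<And>x y. g x y = g y x" "\<And>x. x \<noteq> 0 \<Longrightarrow> g x x > 0" "\<And>x y. g (J x) (J y) = g x y"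
    and c: "\<And>x y z w. ce_d3 br' (bismut_torsion br' J g) x y z w = 0"
    using skt unfolding skt_structure_def hermitian_structure_def complex_structure_def inner_product_def
    by blast+
  define J' where "J' x = \<psi> (J (\<phi> x))" for x
  define g' where "g' x y = g (\<phi> x) (\<phi> y)" for x y
  have \<phi>J: "\<phi> (J' x) = J (\<phi> x)" for x by (simp add: J'_def inv)
  have "linear J'"
    by (rule linearI; rule inj) (simp_all add: \<phi>J lin linear_add[OF J(1)] linear_scale[OF J(1)])
  moreover have "J' (J' x) = - x" for x by (rule inj) (simp add: \<phi>J lin J(2))
  moreover have "br x y + J' (br (J' x) y + br x (J' y)) - br (J' x) (J' y) = 0" for x y
    using J(3)[of "\<phi> x" "\<phi> y"] by (subst phi0[symmetric]) (simp add: \<phi>J lin \<phi>(3))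
  moreover have "bilinear g'"
    unfolding bilinear_def g'_def
    by (auto intro!: linearI simp: lin bilinear_ladd[OF g(1)] bilinear_radd[OF g(1)] bilinear_lmul[OF g(1)]
        bilinear_rmul[OF g(1)])
  moreover have "g' x y = g' y x" "g' (J' x) (J' y) = g' x y" for x y
    by (simp_all add: g'_def \<phi>J g(4)) (rule g(2))
  moreover have "g' x x > 0" if "x \<noteq> 0" for x using g(3) phi0 that by (simp add: g'_def)
  moreover have t: "bismut_torsion br J' g' x y z = bismut_torsion br' J g (\<phi> x) (\<phi> y) (\<phi> z)" for x y z
    by (simp add: bismut_torsion_def ce_d2_def fundamental_form_def g'_def \<phi>J \<phi>(3))
  have "ce_d3 br (bismut_torsion br J' g') x y z w = 0" for x y z w
    using c[of "\<phi> x" "\<phi> y" "\<phi> z" "\<phi> w"] by (simp add: ce_d3_def t \<phi>(3))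
  ultimately have "skt_structure br J' g'"
    unfolding skt_structure_def hermitian_structure_def complex_structure_def inner_product_def by blast
  then show ?thesis by blast
qed

lemma sum_UNIV_6: "(\<Sum>i\<in>UNIV. F i) = F 1 + F 2 + F 3 + F 4 + F 5 + F (6::6)"
  for F :: "6 \<Rightarrow> real"
proof -
  have U: "UNIV = {1, 2, 3, 4, 5, 6 :: 6}" using exhaust_6 by auto
  show ?thesis unfolding U by simp
qed

lemma inner_product_standard: "inner_product (\<lambda>x y :: real^6. \<Sum>i\<in>UNIV. x $ i * y $ i)"
proof -
  have eq: "(\<lambda>x y :: real^6. \<Sum>i\<in>UNIV. x $ i * y $ i) = (\<lambda>x y. x \<bullet> y)"
    by (simp add: inner_vec_def)
  show ?thesis
    unfolding inner_product_def eq
    by (auto intro!: linearI simp: bilinear_def inner_add_left inner_add_right inner_commute)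
qed

definition J_tau :: "real^6 \<Rightarrow> real^6" where
  "J_tau x = vector [- x $ 2, x $ 1, - x $ 4, x $ 3, - x $ 6, x $ 5]"

definition J_g535 :: "real^6 \<Rightarrow> real^6" where
  "J_g535 x = vector [- x $ 5, - x $ 3, x $ 2, - x $ 6, x $ 1, x $ 4]"

lemma f_vec_components:
  "f_vec 1 = vector [1, 0, 0, 0, 0, 0]" "f_vec 2 = vector [0, 1, 0, 0, 0, 0]"
  "f_vec 3 = vector [0, 0, 1, 0, 0, 0]" "f_vec 4 = vector [0, 0, 0, 1, 0, 0]"
  "f_vec 5 = vector [0, 0, 0, 0, 1, 0]" "f_vec 6 = vector [0, 0, 0, 0, 0, 1]"
  by (simp_all add: vec_eq_iff forall_6 vector_6 axis_def)

lemma tau30_tau30_components: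
  "tau30_tau30 x y = vector [x $ 2 * y $ 5 - x $ 5 * y $ 2, x $ 5 * y $ 1 - x $ 1 * y $ 5,
    x $ 4 * y $ 6 - x $ 6 * y $ 4, x $ 6 * y $ 3 - x $ 3 * y $ 6, 0, 0]"
  by (simp add: tau30_tau30_def structure_bracket_def f_wedge_def vec_eq_iff forall_6 vector_6)

lemma g535_R_components:
  "g535_R x y = vector [2 * (x $ 5 * y $ 1 - x $ 1 * y $ 5),
    x $ 2 * y $ 5 - x $ 5 * y $ 2 + (x $ 3 * y $ 6 - x $ 6 * y $ 3),
    x $ 3 * y $ 5 - x $ 5 * y $ 3 - (x $ 2 * y $ 6 - x $ 6 * y $ 2), 0, 0, 0]"
  by (simp add: g535_R_def structure_bracket_def f_wedge_def vec_eq_iff forall_6 vector_6)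

text \<open>
  The torsion vanishes: the nilradical and its orthogonal complement are abelian
  complex subspaces, and the complement acts on the nilradical by skew-Hermitian operators, so the fundamental form is closed.
\<close>

lemma skt_tau30_tau30: "skt_structure tau30_tau30 J_tau (\<lambda>x y. \<Sum>i\<in>UNIV. x $ i * y $ i)"
proof -
  have "complex_structure tau30_tau30 J_tau"
    unfolding complex_structure_def
    by (auto intro!: linearI simp: J_tau_def tau30_tau30_components vec_eq_iff forall_6 vector_6 algebra_simps)
  moreover have "bismut_torsion tau30_tau30 J_tau (\<lambda>x y. \<Sum>i\<in>UNIV. x $ i * y $ i) x y z = 0" for x y z
    by (simp add: bismut_torsion_def ce_d2_def fundamental_form_def J_tau_def tau30_tau30_components
        sum_UNIV_6 vector_6 algebra_simps)
  moreover have "(\<Sum>i\<in>UNIV. J_tau x $ i * J_tau y $ i) = (\<Sum>i\<in>UNIV. x $ i * y $ i)" for x y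
    by (simp add: sum_UNIV_6 J_tau_def vector_6)
  ultimately show ?thesis
    unfolding skt_structure_def hermitian_structure_def
    using inner_product_standard by (simp add: ce_d3_def)
qed

text \<open>
  The torsion is \<open>2f\<^sup>1\<^sup>2\<^sup>3\<close>. It is closed because every \<open>ad x\<close> is traceless on the span of \<open>f\<^sub>1, f\<^sub>2, f\<^sub>3\<close>, where \<open>f\<^sub>5\<close> has weights
  \<open>2, -1, -1\<close>.
\<close>

lemma torsion_g535_R:
  "bismut_torsion g535_R J_g535 (\<lambda>x y. \<Sum>i\<in>UNIV. x $ i * y $ i) x y z =
    2 * (x $ 1 * (y $ 2 * z $ 3 - y $ 3 * z $ 2) - x $ 2 * (y $ 1 * z $ 3 - y $ 3 * z $ 1)
      + x $ 3 * (y $ 1 * z $ 2 - y $ 2 * z $ 1))"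
  by (simp add: bismut_torsion_def ce_d2_def fundamental_form_def J_g535_def g535_R_components
      sum_UNIV_6 vector_6 algebra_simps)

lemma skt_g535_R: "skt_structure g535_R J_g535 (\<lambda>x y. \<Sum>i\<in>UNIV. x $ i * y $ i)"
proof -
  have "complex_structure g535_R J_g535"
    unfolding complex_structure_def
    by (auto intro!: linearI simp: J_g535_def g535_R_components vec_eq_iff forall_6 vector_6 algebra_simps)
  moreover have "ce_d3 g535_R (bismut_torsion g535_R J_g535 (\<lambda>x y. \<Sum>i\<in>UNIV. x $ i * y $ i)) x y z w = 0"
    for x y z w
    unfolding ce_d3_def torsion_g535_R
    by (simp add: g535_R_components vector_6 algebra_simps)
  moreover have "(\<Sum>i\<in>UNIV. J_g535 x $ i * J_g535 y $ i) = (\<Sum>i\<in>UNIV. x $ i * y $ i)" for x y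
    by (simp add: sum_UNIV_6 J_g535_def vector_6)
  ultimately show ?thesis
    unfolding skt_structure_def hermitian_structure_def
    using inner_product_standard by simp
qed

theorem theorem4p1:
  fixes br :: "'a::real_vector \<Rightarrow> 'a \<Rightarrow> 'a" and h :: "'a set"
  assumes "lie_algebra br" and "dim (UNIV :: 'a set) = 6"
    and "lie_solvable br" and "unimodular br"
    and "is_nilradical br h" and "dim h = 4"
  shows "((\<exists>J g. skt_structure br J g) \<longleftrightarrow> lie_iso br tau30_tau30 \<or> lie_iso br g535_R)
    \<and> ((\<exists>J g. skt_structure br J g) \<longrightarrow> lie_abelian_on br h)
    \<and> (\<exists>J. J (f_vec 1) = f_vec 2 \<and> J (f_vec 3) = f_vec 4 \<and> J (f_vec 5) = f_vec 6
          \<and> skt_structure tau30_tau30 J (\<lambda>x y. \<Sum>i\<in>UNIV. x $ i * y $ i))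
    \<and> (\<exists>J. J (f_vec 1) = f_vec 5 \<and> J (f_vec 2) = f_vec 3 \<and> J (f_vec 4) = f_vec 6
          \<and> skt_structure g535_R J (\<lambda>x y. \<Sum>i\<in>UNIV. x $ i * y $ i))"
proof (intro conjI)
  have loc: "skt_codim2 br h J g" if "skt_structure br J g" for J g
    by unfold_locales (use assms that in auto)
  show "(\<exists>J g. skt_structure br J g) \<longleftrightarrow> lie_iso br tau30_tau30 \<or> lie_iso br g535_R"
  proof
    assume "\<exists>J g. skt_structure br J g"
    then show "lie_iso br tau30_tau30 \<or> lie_iso br g535_R"
      using skt_codim2.lie_iso_model[OF loc] by blast
  next
    assume "lie_iso br tau30_tau30 \<or> lie_iso br g535_R"
    then show "\<exists>J g. skt_structure br J g"
      using skt_structure_pullback[OF _ skt_tau30_tau30] skt_structure_pullback[OF _ skt_g535_R] by blast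
  qed
  show "(\<exists>J g. skt_structure br J g) \<longrightarrow> lie_abelian_on br h"
    using skt_codim2.nilradical_abelian[OF loc] by blast
  show "\<exists>J. J (f_vec 1) = f_vec 2 \<and> J (f_vec 3) = f_vec 4 \<and> J (f_vec 5) = f_vec 6
      \<and> skt_structure tau30_tau30 J (\<lambda>x y. \<Sum>i\<in>UNIV. x $ i * y $ i)"
    by (rule exI[of _ J_tau])
      (simp add: skt_tau30_tau30, simp add: J_tau_def f_vec_components vec_eq_iff forall_6 vector_6)
  show "\<exists>J. J (f_vec 1) = f_vec 5 \<and> J (f_vec 2) = f_vec 3 \<and> J (f_vec 4) = f_vec 6
      \<and> skt_structure g535_R J (\<lambda>x y. \<Sum>i\<in>UNIV. x $ i * y $ i)"
    by (rule exI[of _ J_g535])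
      (simp add: skt_g535_R, simp add: J_g535_def f_vec_components vec_eq_iff forall_6 vector_6)
qed

end
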